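(* Let $\mathcal{C}$ be a regular virtual holonomic constraint (VHC) of order $m$ for the Lagrangian control system $(\mathcal{Q},g,P,\{F^1,\dots,F^m\})$, and let $\iota:\mathcal{C}\to\mathcal{Q}$ be the inclusion map. Then the constrained dynamics on $T\mathcal{C}$, i.e. the closed-loop dynamics on $T\mathcal{C}$ obtained by applying the unique smooth feedback $\tau^\star:T\mathcal{C}\to\mathbb{R}^m$ rendering $T\mathcal{C}$ invariant, are described by the equation of motion $$\nabla^{\mathcal{C}}_{\dot q}\,\dot q=-\sigma_q\big(\operatorname{grad}P(q)\big)\qquad(\ast)$$ in the following sense. If $q:I\to\mathcal{Q}$ is a maximal base integral curve of the Lagrangian control system with feedback $\tau^\star$ such that $q(I)\subset\mathcal{C}$, then $q:I\to\mathcal{C}$ is a maximal base integral curve of $(\ast)$. Vice versa, if $q:I\to\mathcal{C}$ is a maximal base integral curve of $(\ast)$, then $\iota\circ q$ is a maximal base integral curve of the Lagrangian control system with feedback $\tau^\star$.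
   Context: All manifolds, maps, vector fields and forms are smooth. A Lagrangian control system $(\mathcal{Q},g,P,\{F^1,\dots,F^m\})$ consists of an $n$-dimensional Riemannian manifold $(\mathcal{Q},g)$ with Levi-Civita connection $\nabla$, a smooth potential $P:\mathcal{Q}\to\mathbb{R}$, and one-forms $F^1,\dots,F^m$ on $\mathcal{Q}$, assumed linearly independent at every point. $(F^i)^\sharp$ is the vector field with $F^i(X)=g((F^i)^\sharp,X)$ for all $X$, and $\operatorname{grad}P=(dP)^\sharp$. The equation of motion is $$\nabla_{\dot q}\dot q=-\operatorname{grad}P(q)+\sum_{i=1}^m(F^i)^\sharp_q\,\tau_i .$$ A smooth curve $q:I\to\mathcal{Q}$ ($I$ an open interval) is a base integral curve if this holds for some smooth functions $\tau_i:I\to\mathbb{R}$; it is a base integral curve with feedback $\tau^\star$ if it holds with $\tau_i(t)=\tau_i^\star(q(t),\dot q(t))$, and it is maximal if it cannot be extended to a base integral curve with the same feedback on a strictly larger open interval. The acceleration distribution is $\mathcal{D}_A=\operatorname{span}\{(F^1)^\sharp,\dots,(F^m)^\sharp\}$. A regular VHC of order $m$ is a closed embedded submanifold $\mathcal{C}\subset\mathcal{Q}$ of codimension $m$ with $T_q\mathcal{C}\oplus\mathcal{D}_A(q)=T_q\mathcal{Q}$ for all $q\in\mathcal{C}$. A smooth feedback $\tau^\star:T\mathcal{C}\to\mathbb{R}^m$ renders $T\mathcal{C}$ invariant if for every $q_0\in\mathcal{C}$ and $v_{q_0}\in T_{q_0}\mathcal{C}$ the maximal base integral curve $q:I\to\mathcal{Q}$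 with feedback $\tau^\star$, $q(0)=q_0$ and $\dot q(0)=v_{q_0}$, satisfies $q(t)\in\mathcal{C}$ for all $t\in I$. (When a feedback is defined only on $T\mathcal{C}$, which is a closed embedded submanifold of $T\mathcal{Q}$, base integral curves with that feedback are understood by using any smooth extension to $T\mathcal{Q}$.) For a regular VHC of order $m$, there is exactly one smooth feedback $\tau^\star:T\mathcal{C}\to\mathbb{R}^m$ rendering $T\mathcal{C}$ invariant. For $q\in\mathcal{C}$, $\sigma_q:T_q\mathcal{Q}\to T_q\mathcal{C}$ is the linear projection onto $T_q\mathcal{C}$ along $\mathcal{D}_A(q)$; together these define a smooth vector bundle map $\sigma:T\mathcal{Q}|_{\mathcal{C}}\to T\mathcal{C}$. The induced connection on $\mathcal{C}$ is $\nabla^{\mathcal{C}}_XY:=\sigma(\nabla_XY)$ for vector fields $X,Y$ on $\mathcal{C}$, where $\nabla_XY$ on $\mathcal{C}$ is computed with arbitrary smooth local extensions of $X,Y$ to $\mathcal{Q}$ (the result does not depend on the extensions); $\nabla^{\mathcal{C}}$ is a symmetric (torsion-free) affine connection on $\mathcal{C}$. A base integral curve of $(\ast)$ is a smooth curve $q:I\to\mathcal{C}$, $I$ an open interval, satisfying $(\ast)$ for all $t\in I$; it is maximal if it cannot be extended to a base integral curve of $(\ast)$ on a strictly larger open interval. *)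

theory Defs
  imports "HOL-Analysis.Analysis"
begin

section \<open>Smooth maps between Euclidean spaces\<close>

primrec Ck_on :: "nat \<Rightarrow> 'a::euclidean_space set \<Rightarrow> ('a \<Rightarrow> 'b::euclidean_space) \<Rightarrow> bool" where
  "Ck_on 0 S f \<longleftrightarrow> continuous_on S f"
| "Ck_on (Suc k) S f \<longleftrightarrow>
     (\<forall>x\<in>S. f differentiable (at x)) \<and> (\<forall>v. Ck_on k S (\<lambda>x. frechet_derivative f (at x) v))"

text \<open>Meant for open sets only: the derivatives are taken in the ambient space.\<close>
definition smooth_on :: "'a::euclidean_space set \<Rightarrow> ('a \<Rightarrow> 'b::euclidean_space) \<Rightarrow> bool" where
  "smooth_on S f \<longleftrightarrow> (\<forall>k. Ck_on k S f)"

section \<open>Smooth manifolds\<close>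

text \<open>A chart is a pair of a domain and a coordinate map; the values of the map outside the domain
  are irrelevant. The manifold is the whole type \<open>'q\<close>, its dimension is \<open>DIM('e)\<close>, and its smooth
  structure is a maximal smooth atlas.\<close>

type_synonym ('q, 'e) chart = "'q set \<times> ('q \<Rightarrow> 'e)"

definition chart_inv :: "('q, 'e) chart \<Rightarrow> 'e \<Rightarrow> 'q" where
  "chart_inv c = inv_into (fst c) (snd c)"

definition topological_chart :: "('q::topological_space, 'e::euclidean_space) chart \<Rightarrow> bool" where
  "topological_chart c \<longleftrightarrow> open (fst c) \<and> open (snd c ` fst c) \<and>
     homeomorphism (fst c) (snd c ` fst c) (snd c) (chart_inv c)"

definition smooth_transition ::
    "('q, 'e::euclidean_space) chart \<Rightarrow> ('q, 'e) chart \<Rightarrow> bool" where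
  "smooth_transition c c' \<longleftrightarrow> smooth_on (snd c ` (fst c \<inter> fst c')) (snd c' \<circ> chart_inv c)"

definition smooth_structure ::
    "('q::{t2_space,second_countable_topology}, 'e::euclidean_space) chart set \<Rightarrow> bool" where
  "smooth_structure A \<longleftrightarrow>
     (\<forall>c\<in>A. topological_chart c) \<and>
     (\<Union>c\<in>A. fst c) = UNIV \<and>
     (\<forall>c\<in>A. \<forall>c'\<in>A. smooth_transition c c') \<and>
     (\<forall>c. topological_chart c \<and> (\<forall>c'\<in>A. smooth_transition c c' \<and> smooth_transition c' c)
        \<longrightarrow> c \<in> A)"

definition smooth_fun ::
    "('q::topological_space, 'e::euclidean_space) chart set \<Rightarrow> 'q set \<Rightarrow> ('q \<Rightarrow> real) \<Rightarrow> bool" where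
  "smooth_fun A U f \<longleftrightarrow> open U \<and> (\<forall>c\<in>A. smooth_on (snd c ` (U \<inter> fst c)) (f \<circ> chart_inv c))"

section \<open>Tangent vectors\<close>

text \<open>A tangent vector at \<open>p\<close> is a class of pairs (chart around \<open>p\<close>, vector of \<open>'e\<close>), where pairs are
  identified when they are related by the derivative of the transition map. Every class has exactly
  one representative in a preferred chart at \<open>p\<close>, chosen once and for all, and the tangent space at
  every point is modelled as the vector space \<open>'e\<close> of these representatives. Nothing is assumed about
  how the preferred chart depends on \<open>p\<close>, so a vector field is smooth when its components in the
  charts of the atlas are. The inner product that \<open>'e\<close> carries as a type plays no role.\<close>

definition chart_at :: "('q, 'e) chart set \<Rightarrow> 'q \<Rightarrow> ('q, 'e) chart" where
  "chart_at A p = (SOME c. c \<in> A \<and> p \<in> fst c)"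

definition coord_change ::
    "('q, 'e::euclidean_space) chart \<Rightarrow> ('q, 'e) chart \<Rightarrow> 'q \<Rightarrow> 'e \<Rightarrow> 'e" where
  "coord_change c c' p = frechet_derivative (snd c' \<circ> chart_inv c) (at (snd c p))"

text \<open>The components of a tangent vector in the chart \<open>c\<close>, and the tangent vector with given
  components. With \<open>w\<close> fixed, \<open>\<lambda>p. of_coords A c p w\<close> is the field on the domain of \<open>c\<close> that
  has the constant components \<open>w\<close>.\<close>

definition to_coords ::
    "('q, 'e::euclidean_space) chart set \<Rightarrow> ('q, 'e) chart \<Rightarrow> 'q \<Rightarrow> 'e \<Rightarrow> 'e" where
  "to_coords A c p = coord_change (chart_at A p) c p"

definition of_coords ::
    "('q, 'e::euclidean_space) chart set \<Rightarrow> ('q, 'e) chart \<Rightarrow> 'q \<Rightarrow> 'e \<Rightarrow> 'e" where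
  "of_coords A c p = coord_change c (chart_at A p) p"

definition smooth_vf ::
    "('q::topological_space, 'e::euclidean_space) chart set \<Rightarrow> 'q set \<Rightarrow> ('q \<Rightarrow> 'e) \<Rightarrow> bool" where
  "smooth_vf A U X \<longleftrightarrow> open U \<and>
     (\<forall>c\<in>A. smooth_on (snd c ` (U \<inter> fst c))
        (\<lambda>x. to_coords A c (chart_inv c x) (X (chart_inv c x))))"

definition differential ::
    "('q, 'e::euclidean_space) chart set \<Rightarrow> ('q \<Rightarrow> real) \<Rightarrow> 'q \<Rightarrow> 'e \<Rightarrow> real" where
  "differential A f p =
     frechet_derivative (f \<circ> chart_inv (chart_at A p)) (at (snd (chart_at A p) p))"

definition smooth_one_form ::
    "('q::topological_space, 'e::euclidean_space) chart set \<Rightarrow> ('q \<Rightarrow> 'e \<Rightarrow> real) \<Rightarrow> bool" where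
  "smooth_one_form A \<omega> \<longleftrightarrow> (\<forall>p. linear (\<omega> p)) \<and>
     (\<forall>c\<in>A. \<forall>u. smooth_fun A (fst c) (\<lambda>p. \<omega> p (of_coords A c p u)))"

definition riemannian_metric ::
    "('q::topological_space, 'e::euclidean_space) chart set \<Rightarrow> ('q \<Rightarrow> 'e \<Rightarrow> 'e \<Rightarrow> real) \<Rightarrow> bool" where
  "riemannian_metric A g \<longleftrightarrow>
     (\<forall>p. bilinear (g p) \<and> (\<forall>u v. g p u v = g p v u) \<and> (\<forall>v. v \<noteq> 0 \<longrightarrow> g p v v > 0)) \<and>
     (\<forall>c\<in>A. \<forall>u v. smooth_fun A (fst c) (\<lambda>p. g p (of_coords A c p u) (of_coords A c p v)))"

section \<open>Curves\<close>

definition open_interval :: "real set \<Rightarrow> bool" where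
  "open_interval I \<longleftrightarrow> open I \<and> is_interval I \<and> I \<noteq> {}"

definition smooth_curve ::
    "('q::topological_space, 'e::euclidean_space) chart set \<Rightarrow> real set \<Rightarrow> (real \<Rightarrow> 'q) \<Rightarrow> bool" where
  "smooth_curve A I q \<longleftrightarrow> continuous_on I q \<and>
     (\<forall>c\<in>A. smooth_on {t \<in> I. q t \<in> fst c} (snd c \<circ> q))"

definition velocity ::
    "('q, 'e::euclidean_space) chart set \<Rightarrow> (real \<Rightarrow> 'q) \<Rightarrow> real \<Rightarrow> 'e" where
  "velocity A q t = vector_derivative (snd (chart_at A (q t)) \<circ> q) (at t)"

section \<open>Connections\<close>

text \<open>\<open>D p v Y\<close> is the derivative at \<open>p\<close> in the direction of the tangent vector \<open>v\<close> of a field \<open>Y\<close>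
  that is smooth near \<open>p\<close>. It depends only on the germ of \<open>Y\<close> at \<open>p\<close>, and for other \<open>Y\<close> it is
  unspecified. For fields \<open>X\<close>, \<open>Y\<close>, the value at \<open>p\<close> of the derivative of \<open>Y\<close> along \<open>X\<close> is
  \<open>D p (X p) Y\<close>.\<close>

definition affine_connection ::
    "('q::topological_space, 'e::euclidean_space) chart set \<Rightarrow>
     ('q \<Rightarrow> 'e \<Rightarrow> ('q \<Rightarrow> 'e) \<Rightarrow> 'e) \<Rightarrow> bool" where
  "affine_connection A D \<longleftrightarrow>
     (\<forall>U p Y. smooth_vf A U Y \<and> p \<in> U \<longrightarrow> linear (\<lambda>v. D p v Y)) \<and>
     (\<forall>U p v Y Z. smooth_vf A U Y \<and> smooth_vf A U Z \<and> p \<in> U \<longrightarrow>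
        D p v (\<lambda>x. Y x + Z x) = D p v Y + D p v Z) \<and>
     (\<forall>U p v f Y. smooth_fun A U f \<and> smooth_vf A U Y \<and> p \<in> U \<longrightarrow>
        D p v (\<lambda>x. f x *\<^sub>R Y x) = differential A f p v *\<^sub>R Y p + f p *\<^sub>R D p v Y) \<and>
     (\<forall>U p v Y Z. smooth_vf A U Y \<and> smooth_vf A U Z \<and> p \<in> U \<and> (\<forall>x\<in>U. Y x = Z x) \<longrightarrow>
        D p v Y = D p v Z) \<and>
     (\<forall>U X Y. smooth_vf A U X \<and> smooth_vf A U Y \<longrightarrow> smooth_vf A U (\<lambda>p. D p (X p) Y))"

text \<open>In the condition of vanishing torsion the bracket of \<open>X\<close> and \<open>Y\<close> is written out as a
  derivation: it sends \<open>f\<close> to \<open>X (Y f) - Y (X f)\<close>.\<close>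

definition levi_civita ::
    "('q::topological_space, 'e::euclidean_space) chart set \<Rightarrow> ('q \<Rightarrow> 'e \<Rightarrow> 'e \<Rightarrow> real) \<Rightarrow>
     ('q \<Rightarrow> 'e \<Rightarrow> ('q \<Rightarrow> 'e) \<Rightarrow> 'e) \<Rightarrow> bool" where
  "levi_civita A g D \<longleftrightarrow> affine_connection A D \<and>
     (\<forall>U X Y f p. smooth_vf A U X \<and> smooth_vf A U Y \<and> smooth_fun A U f \<and> p \<in> U \<longrightarrow>
        differential A f p (D p (X p) Y - D p (Y p) X) =
          differential A (\<lambda>x. differential A f x (Y x)) p (X p) -
          differential A (\<lambda>x. differential A f x (X x)) p (Y p)) \<and>
     (\<forall>U Y Z p v. smooth_vf A U Y \<and> smooth_vf A U Z \<and> p \<in> U \<longrightarrow>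
        differential A (\<lambda>x. g x (Y x) (Z x)) p v = g p (D p v Y) (Z p) + g p (Y p) (D p v Z))"

text \<open>The covariant derivative at \<open>t\<close> of a field \<open>V\<close> along the curve \<open>q\<close>, computed in the chart \<open>c\<close>.
  If \<open>V\<close> has the components \<open>V\<^sup>b\<close> with respect to the coordinate fields \<open>\<partial>\<^sub>b\<close> and \<open>v\<close> is the velocity,
  it is the sum over \<open>b\<close> of \<open>(V\<^sup>b)'(t) \<partial>\<^sub>b + V\<^sup>b(t) D\<^sub>v \<partial>\<^sub>b\<close>. As \<open>D\<^sub>v\<close> is linear over the reals, the
  second terms add up to the derivative of the field with the constant components \<open>V\<^sup>b(t)\<close>.\<close>

definition cov_deriv_in ::
    "('q, 'e::euclidean_space) chart set \<Rightarrow> ('q, 'e) chart \<Rightarrow>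
     ('q \<Rightarrow> 'e \<Rightarrow> ('q \<Rightarrow> 'e) \<Rightarrow> 'e) \<Rightarrow> (real \<Rightarrow> 'q) \<Rightarrow> (real \<Rightarrow> 'e) \<Rightarrow> real \<Rightarrow> 'e" where
  "cov_deriv_in A c D q V t =
     of_coords A c (q t) (vector_derivative (\<lambda>s. to_coords A c (q s) (V s)) (at t)) +
     D (q t) (velocity A q t) (\<lambda>p. of_coords A c p (to_coords A c (q t) (V t)))"

section \<open>Lagrangian control systems\<close>

record ('q, 'e) control_system =
  atlas :: "('q, 'e) chart set"
  metric :: "'q \<Rightarrow> 'e \<Rightarrow> 'e \<Rightarrow> real"
  connection :: "'q \<Rightarrow> 'e \<Rightarrow> ('q \<Rightarrow> 'e) \<Rightarrow> 'e"
  potential :: "'q \<Rightarrow> real"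
  num_forces :: nat
  force :: "nat \<Rightarrow> 'q \<Rightarrow> 'e \<Rightarrow> real"

definition lagrangian_control_system ::
    "('q::{t2_space,second_countable_topology}, 'e::euclidean_space) control_system \<Rightarrow> bool" where
  "lagrangian_control_system L \<longleftrightarrow>
     smooth_structure (atlas L) \<and>
     riemannian_metric (atlas L) (metric L) \<and>
     levi_civita (atlas L) (metric L) (connection L) \<and>
     smooth_fun (atlas L) UNIV (potential L) \<and>
     (\<forall>i<num_forces L. smooth_one_form (atlas L) (force L i)) \<and>
     (\<forall>p a. (\<forall>v. (\<Sum>i<num_forces L. a i * force L i p v) = 0) \<longrightarrow> (\<forall>i<num_forces L. a i = (0::real)))"

definition sharp :: "('q, 'e::euclidean_space) control_system \<Rightarrow> 'q \<Rightarrow> ('e \<Rightarrow> real) \<Rightarrow> 'e" where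
  "sharp L p \<alpha> = (THE w. \<forall>v. \<alpha> v = metric L p w v)"

definition grad_potential :: "('q, 'e::euclidean_space) control_system \<Rightarrow> 'q \<Rightarrow> 'e" where
  "grad_potential L p = sharp L p (differential (atlas L) (potential L) p)"

definition acceleration_distribution ::
    "('q, 'e::euclidean_space) control_system \<Rightarrow> 'q \<Rightarrow> 'e set" where
  "acceleration_distribution L p = span ((\<lambda>i. sharp L p (force L i p)) ` {..<num_forces L})"

definition acceleration ::
    "('q, 'e::euclidean_space) control_system \<Rightarrow> (real \<Rightarrow> 'q) \<Rightarrow> real \<Rightarrow> 'e" where
  "acceleration L q t =
     cov_deriv_in (atlas L) (chart_at (atlas L) (q t)) (connection L) q (velocity (atlas L) q) t"

text \<open>A feedback is a family of functions \<open>\<tau> i\<close>, for \<open>i\<close> below the number of forces, of a point and a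
  tangent vector at this point. The smoothness on the tangent bundle refers to its natural charts.\<close>

definition smooth_feedback ::
    "('q::topological_space, 'e::euclidean_space) control_system \<Rightarrow> (nat \<Rightarrow> 'q \<Rightarrow> 'e \<Rightarrow> real) \<Rightarrow> bool"
  where
  "smooth_feedback L \<tau> \<longleftrightarrow> (\<forall>i<num_forces L. \<forall>c\<in>atlas L.
     smooth_on ((snd c ` fst c) \<times> UNIV)
       (\<lambda>(x, w). \<tau> i (chart_inv c x) (of_coords (atlas L) c (chart_inv c x) w)))"

definition base_integral_curve ::
    "('q::topological_space, 'e::euclidean_space) control_system \<Rightarrow> (nat \<Rightarrow> 'q \<Rightarrow> 'e \<Rightarrow> real) \<Rightarrow>
     real set \<Rightarrow> (real \<Rightarrow> 'q) \<Rightarrow> bool" where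
  "base_integral_curve L \<tau> I q \<longleftrightarrow> open_interval I \<and> smooth_curve (atlas L) I q \<and>
     (\<forall>t\<in>I. acceleration L q t = - grad_potential L (q t) +
        (\<Sum>i<num_forces L. \<tau> i (q t) (velocity (atlas L) q t) *\<^sub>R sharp L (q t) (force L i (q t))))"

definition maximal_base_integral_curve ::
    "('q::topological_space, 'e::euclidean_space) control_system \<Rightarrow> (nat \<Rightarrow> 'q \<Rightarrow> 'e \<Rightarrow> real) \<Rightarrow>
     real set \<Rightarrow> (real \<Rightarrow> 'q) \<Rightarrow> bool" where
  "maximal_base_integral_curve L \<tau> I q \<longleftrightarrow> base_integral_curve L \<tau> I q \<and>
     \<not> (\<exists>J q'. I \<subset> J \<and> base_integral_curve L \<tau> J q' \<and> (\<forall>t\<in>I. q' t = q t))"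

section \<open>Regular virtual holonomic constraints\<close>

text \<open>A chart \<open>c\<close> of the ambient manifold that turns \<open>C\<close> into an open piece of the linear subspace
  \<open>S\<close>. The restrictions of these charts to \<open>C\<close> are charts of \<open>C\<close> with values in \<open>S\<close>.\<close>

definition slice_chart ::
    "('q, 'e::euclidean_space) chart set \<Rightarrow> 'q set \<Rightarrow> 'e set \<Rightarrow> ('q, 'e) chart \<Rightarrow> bool" where
  "slice_chart A C S c \<longleftrightarrow> c \<in> A \<and> subspace S \<and> snd c ` (fst c \<inter> C) = snd c ` fst c \<inter> S"

definition embedded_submanifold ::
    "('q, 'e::euclidean_space) chart set \<Rightarrow> nat \<Rightarrow> 'q set \<Rightarrow> bool" where
  "embedded_submanifold A codim C \<longleftrightarrow>
     (\<forall>p\<in>C. \<exists>S c. slice_chart A C S c \<and> p \<in> fst c \<and> dim S + codim = DIM('e))"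

text \<open>The tangent space of \<open>C\<close> at \<open>p\<close>, as a subset of the tangent space of the ambient manifold.\<close>

definition tangent_space ::
    "('q::topological_space, 'e::euclidean_space) chart set \<Rightarrow> 'q set \<Rightarrow> 'q \<Rightarrow> 'e set" where
  "tangent_space A C p = {v. \<exists>I \<gamma>. open_interval I \<and> 0 \<in> I \<and> smooth_curve A I \<gamma> \<and> \<gamma> ` I \<subseteq> C \<and>
     \<gamma> 0 = p \<and> velocity A \<gamma> 0 = v}"

definition regular_vhc ::
    "('q::topological_space, 'e::euclidean_space) control_system \<Rightarrow> 'q set \<Rightarrow> bool" where
  "regular_vhc L C \<longleftrightarrow> closed C \<and> embedded_submanifold (atlas L) (num_forces L) C \<and>
     (\<forall>p\<in>C. tangent_space (atlas L) C p \<inter> acceleration_distribution L p = {0} \<and>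
        {u + w |u w. u \<in> tangent_space (atlas L) C p \<and> w \<in> acceleration_distribution L p} = UNIV)"

definition proj ::
    "('q::topological_space, 'e::euclidean_space) control_system \<Rightarrow> 'q set \<Rightarrow> 'q \<Rightarrow> 'e \<Rightarrow> 'e" where
  "proj L C p v =
     (THE u. u \<in> tangent_space (atlas L) C p \<and> v - u \<in> acceleration_distribution L p)"

text \<open>Smoothness of a feedback given only on the tangent bundle of \<open>C\<close>: near every point it is the
  restriction of a smooth map on an open subset of the ambient tangent bundle.\<close>

definition smooth_feedback_on ::
    "('q::topological_space, 'e::euclidean_space) control_system \<Rightarrow> 'q set \<Rightarrow>
     (nat \<Rightarrow> 'q \<Rightarrow> 'e \<Rightarrow> real) \<Rightarrow> bool" where
  "smooth_feedback_on L C \<tau> \<longleftrightarrow>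
     (\<forall>i<num_forces L. \<forall>p\<in>C. \<forall>v\<in>tangent_space (atlas L) C p.
        \<exists>c\<in>atlas L. \<exists>W h. p \<in> fst c \<and> open W \<and> W \<subseteq> (snd c ` fst c) \<times> UNIV \<and>
          (snd c p, to_coords (atlas L) c p v) \<in> W \<and> smooth_on W h \<and>
          (\<forall>x\<in>C \<inter> fst c. \<forall>w\<in>tangent_space (atlas L) C x.
             (snd c x, to_coords (atlas L) c x w) \<in> W \<longrightarrow>
             \<tau> i x w = h (snd c x, to_coords (atlas L) c x w)))"

definition smooth_extension ::
    "('q::topological_space, 'e::euclidean_space) control_system \<Rightarrow> 'q set \<Rightarrow>
     (nat \<Rightarrow> 'q \<Rightarrow> 'e \<Rightarrow> real) \<Rightarrow> (nat \<Rightarrow> 'q \<Rightarrow> 'e \<Rightarrow> real) \<Rightarrow> bool" where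
  "smooth_extension L C \<tau> \<tau>' \<longleftrightarrow> smooth_feedback L \<tau>' \<and>
     (\<forall>i<num_forces L. \<forall>p\<in>C. \<forall>v\<in>tangent_space (atlas L) C p. \<tau>' i p v = \<tau> i p v)"

definition renders_invariant ::
    "('q::topological_space, 'e::euclidean_space) control_system \<Rightarrow> 'q set \<Rightarrow>
     (nat \<Rightarrow> 'q \<Rightarrow> 'e \<Rightarrow> real) \<Rightarrow> bool" where
  "renders_invariant L C \<tau> \<longleftrightarrow>
     (\<forall>\<tau>'. smooth_extension L C \<tau> \<tau>' \<longrightarrow>
        (\<forall>p\<in>C. \<forall>v\<in>tangent_space (atlas L) C p. \<forall>I q.
           maximal_base_integral_curve L \<tau>' I q \<and> 0 \<in> I \<and> q 0 = p \<and> velocity (atlas L) q 0 = v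
           \<longrightarrow> (\<forall>t\<in>I. q t \<in> C)))"

section \<open>The constrained dynamics\<close>

text \<open>For a field \<open>Y\<close> tangent to \<open>C\<close>, of which only the values on \<open>C\<close> near \<open>p\<close> matter, and \<open>v\<close> tangent
  to \<open>C\<close> at \<open>p\<close>. Any smooth local extension of \<open>Y\<close> gives the same result.\<close>

definition induced_connection ::
    "('q::topological_space, 'e::euclidean_space) control_system \<Rightarrow> 'q set \<Rightarrow>
     'q \<Rightarrow> 'e \<Rightarrow> ('q \<Rightarrow> 'e) \<Rightarrow> 'e" where
  "induced_connection L C p v Y = proj L C p (connection L p v
     (SOME Z. \<exists>U. p \<in> U \<and> smooth_vf (atlas L) U Z \<and> (\<forall>x\<in>U \<inter> C. Z x = Y x)))"

text \<open>The covariant derivative of the velocity with respect to the induced connection. It is computed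
  in a chart of \<open>C\<close>, i.e. the restriction of a slice chart: there the velocity has components in
  the subspace \<open>S\<close>, so that the coordinate fields involved are tangent to \<open>C\<close>.\<close>

definition constrained_acceleration ::
    "('q::topological_space, 'e::euclidean_space) control_system \<Rightarrow> 'q set \<Rightarrow>
     (real \<Rightarrow> 'q) \<Rightarrow> real \<Rightarrow> 'e" where
  "constrained_acceleration L C q t =
     cov_deriv_in (atlas L) (SOME c. \<exists>S. slice_chart (atlas L) C S c \<and> q t \<in> fst c)
       (induced_connection L C) q (velocity (atlas L) q) t"

text \<open>As \<open>C\<close> is embedded, a smooth curve in \<open>C\<close> is a smooth curve of the ambient manifold with image
  in \<open>C\<close>.\<close>

definition constrained_integral_curve ::
    "('q::topological_space, 'e::euclidean_space) control_system \<Rightarrow> 'q set \<Rightarrow>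
     real set \<Rightarrow> (real \<Rightarrow> 'q) \<Rightarrow> bool" where
  "constrained_integral_curve L C I q \<longleftrightarrow>
     open_interval I \<and> smooth_curve (atlas L) I q \<and> q ` I \<subseteq> C \<and>
     (\<forall>t\<in>I. constrained_acceleration L C q t = - proj L C (q t) (grad_potential L (q t)))"

definition maximal_constrained_integral_curve ::
    "('q::topological_space, 'e::euclidean_space) control_system \<Rightarrow> 'q set \<Rightarrow>
     real set \<Rightarrow> (real \<Rightarrow> 'q) \<Rightarrow> bool" where
  "maximal_constrained_integral_curve L C I q \<longleftrightarrow> constrained_integral_curve L C I q \<and>
     \<not> (\<exists>J q'. I \<subset> J \<and> constrained_integral_curve L C J q' \<and> (\<forall>t\<in>I. q' t = q t))"

end

theory Submission
  imports Defs
begin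

text \<open>The projection along the acceleration distribution kills the control forces. Moreover, for a curve
  in \<open>C\<close> the constrained acceleration is the projection of the ambient acceleration
  (\<open>constrained_acceleration_eq_proj\<close>): in coordinates adapted to \<open>C\<close>, the second derivative of the curve is
  tangent to \<open>C\<close>, and projecting the connection term is the definition of the induced connection. Hence
  every curve of the controlled system that stays in \<open>C\<close> satisfies the constrained equation
  (\<open>base_integral_curve_constrained\<close>).

  For the converse (\<open>constrained_integral_curve_base\<close>), consider a constrained curve \<open>q\<close> at a time \<open>t\<close>.
  The velocity is tangent to \<open>C\<close>, so the controlled system has a maximal solution \<open>r\<close> with the position
  and velocity of \<open>q\<close> at \<open>t\<close>, and \<open>r\<close> stays in \<open>C\<close> by invariance. Both curves satisfy the constrained
  equation, so their accelerations at this point have the same projection and differ by an element of the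
  acceleration distribution. Since position and velocity agree, the difference is also tangent to \<open>C\<close>
  (\<open>acceleration_difference_tangent\<close>). The two subspaces are complementary, so the accelerations agree,
  and \<open>q\<close> satisfies the controlled equation at \<open>t\<close> because \<open>r\<close> does.

  Thus the two equations have the same solutions in \<open>C\<close>. A maximal constrained curve cannot be extended
  by a controlled curve either, since invariance, applied after a translation in time, confines every
  maximal extension to \<open>C\<close> (\<open>maximal_base_integral_curve_stays\<close>).

  The analytic input is the existence of a maximal solution for given initial data. Its local part is
  Picard iteration in a chart (\<open>smooth_ode_local_existence\<close>, \<open>base_integral_curve_exists\<close>), for which the
  right-hand side must be smooth, including the inverse of the metric (\<open>smooth_on_linear_system\<close>); Zorn's
  lemma extends the solution (\<open>maximal_extension\<close>). The geometric input is that the acceleration can be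
  computed in any chart (\<open>cov_deriv_velocity_chart\<close>).\<close>

section \<open>Calculus of smooth maps\<close>

lemma Ck_on_subset: "Ck_on k S f \<Longrightarrow> T \<subseteq> S \<Longrightarrow> Ck_on k T f"
  by (induction k arbitrary: f) (auto intro: continuous_on_subset)

lemma Ck_on_Suc_imp: "Ck_on (Suc k) S f \<Longrightarrow> Ck_on k S f"
proof (induction k arbitrary: f)
  case 0
  then show ?case
    by (simp add: differentiable_at_imp_differentiable_on differentiable_imp_continuous_on)
next
  case (Suc k)
  then show ?case by (metis Ck_on.simps(2))
qed

text \<open>On an open set the derivative of a map is determined by its values on that set. For this reason
  most closure properties below carry the assumption that the domain is open.\<close>

lemma Ck_on_cong:
  assumes "open S" "\<And>x. x \<in> S \<Longrightarrow> f x = g x"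
  shows "Ck_on k S f \<Longrightarrow> Ck_on k S g"
  using assms(2)
proof (induction k arbitrary: f g)
  case 0
  then show ?case using continuous_on_cong by force
next
  case (Suc k)
  have d: "g differentiable (at x)"
      and e: "frechet_derivative f (at x) = frechet_derivative g (at x)" if "x \<in> S" for x
  proof -
    have "f differentiable (at x)" using Suc that by auto
    then show "g differentiable (at x)"
      by (meson Suc.prems(2) assms(1) differentiable_def has_derivative_transform_within_open that)
    show "frechet_derivative f (at x) = frechet_derivative g (at x)"
      using frechet_derivative_transform_within_open[OF \<open>f differentiable (at x)\<close> assms(1) that] Suc.prems(2)
      by blast
  qed
  show ?case
    using Suc.IH[of "\<lambda>x. frechet_derivative f (at x) v" "\<lambda>x. frechet_derivative g (at x) v" for v]
      Suc.prems d e by auto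
qed

lemma Ck_on_local:
  assumes "\<And>x. x \<in> S \<Longrightarrow> \<exists>T. open T \<and> x \<in> T \<and> Ck_on k T f"
  shows "Ck_on k S f"
  using assms
proof (induction k arbitrary: f)
  case 0
  have "continuous (at x within S) f" if x: "x \<in> S" for x
  proof -
    obtain T where "open T" "x \<in> T" "continuous_on T f" using 0[OF x] by auto
    then show ?thesis
      using continuous_at_imp_continuous_within continuous_on_eq_continuous_at by blast
  qed
  then show ?case by (simp add: continuous_on_eq_continuous_within)
next
  case (Suc k)
  show ?case
  proof (simp, intro conjI ballI allI)
    fix x assume "x \<in> S" then show "f differentiable (at x)" using Suc.prems by fastforce
  next
    fix v
    show "Ck_on k S (\<lambda>x. frechet_derivative f (at x) v)"
      by (rule Suc.IH) (use Suc.prems in fastforce)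
  qed
qed

lemma Ck_on_const: "Ck_on k S (\<lambda>x. c)"
  by (induction k arbitrary: c) auto

lemma Ck_on_linear: assumes "bounded_linear h" shows "Ck_on k S h"
proof (cases k)
  case 0 then show ?thesis using assms by (simp add: linear_continuous_on)
next
  case (Suc j)
  have "frechet_derivative h (at x) = h" for x
    using bounded_linear_imp_has_derivative[OF assms] frechet_derivative_at by metis
  then show ?thesis
    using Suc assms bounded_linear_imp_differentiable Ck_on_const by auto
qed

text \<open>This form of the recursive step lets each closure property be proved by naming the derivative that
  the calculus rules produce and applying the induction hypothesis to it.\<close>

lemma Ck_on_SucI:
  assumes S: "open S"
    and "\<And>x. x \<in> S \<Longrightarrow> (f has_derivative f' x) (at x)"
    and "\<And>v. Ck_on k S (\<lambda>x. f' x v)"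
  shows "Ck_on (Suc k) S f"
proof -
  have "f differentiable (at x)" "f' x = frechet_derivative f (at x)" if "x \<in> S" for x
    using assms(2)[OF that] by (auto simp: differentiable_def intro: frechet_derivative_at)
  moreover from this have "Ck_on k S (\<lambda>x. frechet_derivative f (at x) v)" for v
    by (intro Ck_on_cong[OF S _ assms(3)[of v]]) simp
  ultimately show ?thesis by simp
qed

lemma Ck_on_has_derivative:
  "Ck_on (Suc k) S f \<Longrightarrow> x \<in> S \<Longrightarrow> (f has_derivative frechet_derivative f (at x)) (at x)"
  by (simp add: frechet_derivative_works)

lemma Ck_on_add:
  assumes S: "open S"
  shows "Ck_on k S f \<Longrightarrow> Ck_on k S g \<Longrightarrow> Ck_on k S (\<lambda>x. f x + g x)"
proof (induction k arbitrary: f g)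
  case 0 then show ?case by (simp add: continuous_on_add)
next
  case (Suc k)
  show ?case
    by (rule Ck_on_SucI[OF S has_derivative_add[OF Ck_on_has_derivative Ck_on_has_derivative]])
       (use Suc in auto)
qed

lemma Ck_on_bilinear:
  assumes B: "bounded_bilinear B" and S: "open S"
  shows "Ck_on k S f \<Longrightarrow> Ck_on k S g \<Longrightarrow> Ck_on k S (\<lambda>x. B (f x) (g x))"
proof (induction k arbitrary: f g)
  case 0 then show ?case by (simp add: bounded_bilinear.continuous_on[OF B])
next
  case (Suc k)
  note fg = Ck_on_Suc_imp[OF Suc.prems(1)] Ck_on_Suc_imp[OF Suc.prems(2)]
  show ?case
    by (rule Ck_on_SucI[OF S bounded_bilinear.FDERIV[OF B Ck_on_has_derivative Ck_on_has_derivative]])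
       (use Suc.prems fg in \<open>auto intro!: Ck_on_add S Suc.IH\<close>)
qed

lemma Ck_on_sum:
  assumes "open S" "\<And>i. i \<in> J \<Longrightarrow> Ck_on k S (f i)"
  shows "Ck_on k S (\<lambda>x. \<Sum>i\<in>J. f i x)"
  using assms(2) by (induction J rule: infinite_finite_induct) (auto intro: Ck_on_add Ck_on_const assms(1))

lemma linear_expand:
  fixes h :: "'a::euclidean_space \<Rightarrow> 'b::real_vector"
  assumes "linear h"
  shows "h v = (\<Sum>b\<in>Basis. (v \<bullet> b) *\<^sub>R h b)"
proof -
  have "h v = h (\<Sum>b\<in>Basis. (v \<bullet> b) *\<^sub>R b)" by (simp add: euclidean_representation)
  then show ?thesis using assms by (simp add: linear_sum linear_cmul del: euclidean_representation)
qed

text \<open>The chain rule expresses the derivative of \<open>g \<circ> f\<close> as a matrix product. Expanding it in the basis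
  leaves the directional derivatives of \<open>g\<close>, composed with \<open>f\<close> again, which is what the induction
  needs.\<close>

lemma Ck_on_compose:
  assumes S: "open S"
  shows "Ck_on k S f \<Longrightarrow> Ck_on k T g \<Longrightarrow> f ` S \<subseteq> T \<Longrightarrow> Ck_on k S (g \<circ> f)"
proof (induction k arbitrary: g)
  case 0 then show ?case by (simp add: o_def) (rule continuous_on_compose2)
next
  case (Suc k)
  have f: "Ck_on k S f" using Ck_on_Suc_imp Suc.prems(1) by blast
  have dg: "(g has_derivative frechet_derivative g (at (f x))) (at (f x))" if "x \<in> S" for x
    using Suc.prems that Ck_on_has_derivative by blast
  show ?case
  proof (rule Ck_on_SucI[OF S diff_chain_at[OF Ck_on_has_derivative[OF Suc.prems(1)] dg]])
    fix v
    have "Ck_on k S (\<lambda>x. \<Sum>b\<in>Basis. (frechet_derivative f (at x) v \<bullet> b) *\<^sub>R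
        ((\<lambda>y. frechet_derivative g (at y) b) \<circ> f) x)"
    proof (intro Ck_on_sum S Ck_on_bilinear[OF bounded_bilinear_scaleR])
      fix b :: 'b assume "b \<in> Basis"
      show "Ck_on k S (\<lambda>x. frechet_derivative f (at x) v \<bullet> b)"
        by (intro Ck_on_bilinear[OF bounded_bilinear_inner] S Ck_on_const) (use Suc.prems in simp)
      show "Ck_on k S ((\<lambda>y. frechet_derivative g (at y) b) \<circ> f)"
        by (rule Suc.IH) (use Suc.prems f in auto)
    qed
    then show "Ck_on k S (\<lambda>x. (frechet_derivative g (at (f x)) \<circ> frechet_derivative f (at x)) v)"
    proof (rule Ck_on_cong[OF S, rotated])
      fix x assume "x \<in> S"
      then have "linear (frechet_derivative g (at (f x)))"
        using has_derivative_linear[OF dg] by blast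
      from linear_expand[OF this, of "frechet_derivative f (at x) v"]
      show "(\<Sum>b\<in>Basis. (frechet_derivative f (at x) v \<bullet> b) *\<^sub>R
        ((\<lambda>y. frechet_derivative g (at y) b) \<circ> f) x) =
        (frechet_derivative g (at (f x)) \<circ> frechet_derivative f (at x)) v"
        by simp
    qed
  qed
qed

lemma smooth_on_subset: "smooth_on S f \<Longrightarrow> T \<subseteq> S \<Longrightarrow> smooth_on T f"
  using Ck_on_subset unfolding smooth_on_def by blast

lemma smooth_on_cong:
  assumes "open S" "\<And>x. x \<in> S \<Longrightarrow> f x = g x"
  shows "smooth_on S f \<longleftrightarrow> smooth_on S g"
  using Ck_on_cong[OF assms(1)] assms(2) unfolding smooth_on_def by metis

lemma smooth_on_local:
  assumes "\<And>x. x \<in> S \<Longrightarrow> \<exists>T. open T \<and> x \<in> T \<and> smooth_on T f"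
  shows "smooth_on S f"
  unfolding smooth_on_def
  by (intro allI Ck_on_local) (use assms in \<open>auto simp: smooth_on_def\<close>)

lemma smooth_on_const: "smooth_on S (\<lambda>x. c)"
  by (simp add: smooth_on_def Ck_on_const)

lemma smooth_on_linear: "bounded_linear h \<Longrightarrow> smooth_on S h"
  by (simp add: smooth_on_def Ck_on_linear)

lemma smooth_on_id: "smooth_on S (\<lambda>x. x)"
  by (simp add: smooth_on_linear)

lemma smooth_on_compose:
  "open S \<Longrightarrow> smooth_on S f \<Longrightarrow> smooth_on T g \<Longrightarrow> f ` S \<subseteq> T \<Longrightarrow> smooth_on S (g \<circ> f)"
  unfolding smooth_on_def using Ck_on_compose by blast

lemma smooth_on_compose_linear:
  assumes "open S" "bounded_linear h" "smooth_on S f"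
  shows "smooth_on S (\<lambda>x. h (f x))"
  using smooth_on_compose[OF assms(1,3) smooth_on_linear[OF assms(2)], of UNIV] by (simp add: o_def)

lemma smooth_on_add:
  "open S \<Longrightarrow> smooth_on S f \<Longrightarrow> smooth_on S g \<Longrightarrow> smooth_on S (\<lambda>x. f x + g x)"
  by (simp add: smooth_on_def Ck_on_add)

lemma smooth_on_minus: "open S \<Longrightarrow> smooth_on S f \<Longrightarrow> smooth_on S (\<lambda>x. - f x)"
  by (simp add: smooth_on_compose_linear[OF _ bounded_linear_minus[OF bounded_linear_ident]])

lemma smooth_on_sum:
  "open S \<Longrightarrow> (\<And>i. i \<in> J \<Longrightarrow> smooth_on S (f i)) \<Longrightarrow> smooth_on S (\<lambda>x. \<Sum>i\<in>J. f i x)"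
  by (simp add: smooth_on_def Ck_on_sum)

lemma smooth_on_bilinear:
  "bounded_bilinear B \<Longrightarrow> open S \<Longrightarrow> smooth_on S f \<Longrightarrow> smooth_on S g \<Longrightarrow> smooth_on S (\<lambda>x. B (f x) (g x))"
  by (simp add: smooth_on_def Ck_on_bilinear)

lemmas smooth_on_scaleR = smooth_on_bilinear[OF bounded_bilinear_scaleR]
lemmas smooth_on_inner = smooth_on_bilinear[OF bounded_bilinear_inner]

lemma smooth_on_Pair:
  assumes "open S" "smooth_on S f" "smooth_on S g"
  shows "smooth_on S (\<lambda>x. (f x, g x))"
proof -
  have "smooth_on S (\<lambda>x. (f x, 0) + (0, g x))"
    by (intro smooth_on_add assms(1) smooth_on_compose_linear[where h = "\<lambda>x. (x, 0)"]
       smooth_on_compose_linear[where h = "\<lambda>x. (0, x)"] assms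
       bounded_linear_Pair bounded_linear_ident bounded_linear_zero)
  then show ?thesis by simp
qed

lemma smooth_on_frechet: "smooth_on S f \<Longrightarrow> smooth_on S (\<lambda>x. frechet_derivative f (at x) v)"
  unfolding smooth_on_def using Ck_on.simps(2) by blast

lemma smooth_on_has_derivative:
  "smooth_on S f \<Longrightarrow> x \<in> S \<Longrightarrow> (f has_derivative frechet_derivative f (at x)) (at x)"
  unfolding smooth_on_def using Ck_on_has_derivative by blast

lemma smooth_on_continuous: "smooth_on S f \<Longrightarrow> continuous_on S f"
  unfolding smooth_on_def by (metis Ck_on.simps(1))

lemma smooth_on_has_vector_derivative:
  fixes f :: "real \<Rightarrow> 'b::euclidean_space"
  assumes "smooth_on S f" "t \<in> S"
  shows "(f has_vector_derivative vector_derivative f (at t)) (at t)"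
  using smooth_on_has_derivative[OF assms] differentiableI vector_derivative_works by blast

lemma smooth_on_vector_derivative:
  fixes f :: "real \<Rightarrow> 'b::euclidean_space"
  assumes "smooth_on S f" "open S"
  shows "smooth_on S (\<lambda>t. vector_derivative f (at t))"
proof -
  have "frechet_derivative f (at t) 1 = vector_derivative f (at t)" if "t \<in> S" for t
    using frechet_derivative_at[OF smooth_on_has_vector_derivative[OF assms(1) that, unfolded has_vector_derivative_def]]
    by (metis (no_types) scaleR_one)
  then show ?thesis
    using smooth_on_frechet[OF assms(1), of 1] by (simp cong: smooth_on_cong[OF assms(2)])
qed

lemma smooth_on_linear_apply:
  fixes h :: "'a::euclidean_space \<Rightarrow> 'b::euclidean_space \<Rightarrow> 'c::euclidean_space"
  assumes S: "open S" and "\<And>x. x \<in> S \<Longrightarrow> linear (h x)" "\<And>u. smooth_on S (\<lambda>x. h x u)" "smooth_on S w"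
  shows "smooth_on S (\<lambda>x. h x (w x))"
proof -
  have "smooth_on S (\<lambda>x. \<Sum>b\<in>Basis. (w x \<bullet> b) *\<^sub>R h x b)"
    by (intro smooth_on_sum S smooth_on_scaleR smooth_on_inner assms smooth_on_const)
  then show ?thesis
    by (rule smooth_on_cong[OF S, THEN iffD1, rotated]) (simp add: linear_expand[OF assms(2), symmetric])
qed

section \<open>Linear systems with smooth coefficients\<close>

text \<open>The solution of a linear system depends differentiably on the system. Near \<open>x0\<close> the matrices are
  bounded below, \<open>B * norm u \<le> 2 * norm (A x u)\<close>, so the error \<open>w x - w x0 - w' (x - x0)\<close> is
  controlled by its image under \<open>A x\<close>. That image splits into the remainder of \<open>r\<close> and the difference
  \<open>A x - A x0\<close> applied to a vector of size \<open>norm (x - x0)\<close>; both are of smaller order.\<close>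

lemma linear_system_has_derivative:
  fixes A :: "'a::euclidean_space \<Rightarrow> 'b::euclidean_space \<Rightarrow> 'b"
  assumes S: "open S" "x0 \<in> S"
    and lin: "\<And>x. x \<in> S \<Longrightarrow> linear (A x)" and inj: "inj (A x0)"
    and cA: "\<And>u. continuous_on S (\<lambda>x. A x u)"
    and r: "(r has_derivative r') (at x0)" "r x0 = 0"
    and eq: "\<And>x. x \<in> S \<Longrightarrow> A x (w x - w x0) = r x"
    and w': "\<And>v. A x0 (w' v) = r' v"
  shows "(w has_derivative w') (at x0)"
proof -
  obtain B where B: "B > 0" "\<And>u. B * norm u \<le> norm (A x0 u)"
    using linear_inj_bounded_below_pos[OF lin[OF S(2)] inj] by metis
  define e where "e x = (\<Sum>b\<in>Basis. norm (A x b - A x0 b))" for x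
  have eb: "norm (A x u - A x0 u) \<le> e x * norm u" if "x \<in> S" for x u
  proof -
    have "A x u - A x0 u = (\<Sum>b\<in>Basis. (u \<bullet> b) *\<^sub>R (A x b - A x0 b))"
      using linear_expand[OF lin[OF that], of u] linear_expand[OF lin[OF S(2)], of u]
      by (simp add: sum_subtractf scaleR_diff_right)
    also have "norm \<dots> \<le> (\<Sum>b\<in>Basis. norm u * norm (A x b - A x0 b))"
      by (rule sum_norm_le) (simp add: Basis_le_norm mult_right_mono)
    finally show ?thesis by (simp add: e_def sum_distrib_left mult.commute)
  qed
  have linw: "linear w'"
  proof -
    have l: "linear r'" using r(1) has_derivative_linear by blast
    have i: "A x0 u = A x0 v \<Longrightarrow> u = v" for u v using inj by (simp add: inj_eq)
    show ?thesis
      by (rule linearI; rule i)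
        (simp_all add: w' linear_add[OF lin[OF S(2)]] linear_cmul[OF lin[OF S(2)]] linear_add[OF l] linear_cmul[OF l])
  qed
  have et: "(e \<longlongrightarrow> 0) (at x0)"
  proof -
    have "((\<lambda>x. A x b) \<longlongrightarrow> A x0 b) (at x0)" for b
      using cA S continuous_on_eq_continuous_at isCont_def by blast
    then have "((\<lambda>x. \<Sum>b\<in>Basis. norm (A x b - A x0 b)) \<longlongrightarrow> (\<Sum>b\<in>(Basis::'b set). 0)) (at x0)"
      by (intro tendsto_sum tendsto_norm_zero) (simp add: LIM_zero)
    then show ?thesis by (simp add: e_def[abs_def])
  qed
  obtain K where K: "K > 0" "\<And>u. norm (w' u) \<le> norm u * K"
    using linear_conv_bounded_linear linw bounded_linear.pos_bounded by blast
  let ?R = "\<lambda>x. (r x - r x0 - r' (x - x0)) /\<^sub>R norm (x - x0)"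
  have R: "(?R \<longlongrightarrow> 0) (at x0)" using r(1) by (simp add: has_derivative_at_within)
  have ev: "eventually (\<lambda>x. e x < B/2) (at x0)"
    using order_tendstoD(2)[OF et, of "B/2"] B by simp
  have evS: "eventually (\<lambda>x. x \<in> S) (at x0)" using S eventually_at_in_open' by blast
  have bnd: "eventually (\<lambda>x. norm ((w x - w x0 - w' (x - x0)) /\<^sub>R norm (x - x0)) \<le>
     (2/B) * (norm (?R x) + e x * K)) (at x0)"
    using ev evS eventually_at_ball[OF zero_less_one]
  proof eventually_elim
    case (elim x)
    let ?d = "w x - w x0 - w' (x - x0)"
    have "B * norm ?d \<le> norm (A x0 ?d)" by (rule B)
    also have "\<dots> \<le> norm (A x ?d) + norm (A x ?d - A x0 ?d)"
      by (metis norm_minus_commute norm_triangle_sub)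
    also have "\<dots> \<le> norm (A x ?d) + (B/2) * norm ?d"
      using eb[OF elim(2), of ?d] elim(1) by (smt (verit) mult_right_mono norm_ge_zero)
    finally have d: "norm ?d \<le> (2/B) * norm (A x ?d)" using B(1) by (simp add: field_simps)
    have "A x ?d = (r x - r' (x - x0)) - (A x (w' (x - x0)) - A x0 (w' (x-x0)))"
      using eq[OF elim(2)] w' by (simp add: linear_diff[OF lin[OF elim(2)]])
    also have "norm \<dots> \<le> norm (r x - r' (x - x0)) + e x * (norm (x - x0) * K)"
    proof -
      have "norm (A x (w' (x - x0)) - A x0 (w' (x-x0))) \<le> e x * (norm (x - x0) * K)"
      proof -
        have "0 \<le> e x" unfolding e_def by (simp add: sum_nonneg)
        then show ?thesis using eb[OF elim(2), of "w' (x-x0)"] K(2)[of "x-x0"]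
          by (meson mult_left_mono order_trans)
      qed
      then show ?thesis by (smt (verit) norm_triangle_ineq4)
    qed
    finally have "(2/B) * norm (A x ?d) \<le> (2/B) * (norm (r x - r' (x - x0)) + e x * (norm (x - x0) * K))"
      by (rule mult_left_mono) (use B(1) in simp)
    with d have *: "norm ?d \<le> (2/B) * (norm (r x - r' (x - x0)) + e x * (norm (x - x0) * K))"
      by (rule order_trans)
    show ?case
    proof (cases "x = x0")
      case True
      then show ?thesis using B K by (simp add: e_def)
    next
      case False
      then have p: "norm (x - x0) > 0" by simp
      have "norm (?d /\<^sub>R norm (x - x0)) = norm ?d / norm (x - x0)"
        by (simp add: divide_inverse_commute)
      also have "\<dots> \<le> (2/B) * (norm (r x - r' (x - x0)) + e x * (norm (x - x0) * K)) / norm (x - x0)"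
        by (rule divide_right_mono[OF *]) simp
      also have "\<dots> = (2/B) * (norm (?R x) + e x * K)"
      proof -
        have "norm (?R x) = norm (r x - r' (x - x0)) / norm (x - x0)"
          using r(2) by (simp add: divide_inverse_commute)
        then show ?thesis unfolding \<open>norm (?R x) = _\<close> using p by (simp add: divide_simps) (simp add: algebra_simps)?
      qed
      finally show ?thesis .
    qed
  qed
  have lim0: "((\<lambda>x. (2/B) * (norm (?R x) + e x * K)) \<longlongrightarrow> 0) (at x0)"
  proof -
    have "((\<lambda>x. (2/B) * (norm (?R x) + e x * K)) \<longlongrightarrow> (2/B) * (0 + 0 * K)) (at x0)"
      by (intro tendsto_mult tendsto_const tendsto_add tendsto_norm_zero R et)
    then show ?thesis by simp
  qed
  have "((\<lambda>x. (w x - w x0 - w' (x - x0)) /\<^sub>R norm (x - x0)) \<longlongrightarrow> 0) (at x0)"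
    by (rule Lim_null_comparison[OF bnd lim0])
  then show ?thesis
    unfolding has_derivative_at_within using linw linear_conv_bounded_linear by auto
qed

lemma Ck_on_linear_apply:
  fixes h :: "'a::euclidean_space \<Rightarrow> 'b::euclidean_space \<Rightarrow> 'c::euclidean_space"
  assumes S: "open S" and "\<And>x. x \<in> S \<Longrightarrow> linear (h x)" "\<And>u. Ck_on k S (\<lambda>x. h x u)" "Ck_on k S w"
  shows "Ck_on k S (\<lambda>x. h x (w x))"
proof -
  have "Ck_on k S (\<lambda>x. \<Sum>b\<in>Basis. (w x \<bullet> b) *\<^sub>R h x b)"
    by (intro Ck_on_sum S Ck_on_bilinear[OF bounded_bilinear_scaleR] Ck_on_bilinear[OF bounded_bilinear_inner] assms Ck_on_const)
  then show ?thesis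
    by (rule Ck_on_cong[OF S, rotated]) (simp add: linear_expand[OF assms(2), symmetric])
qed

lemma linear_frechet_parameter:
  fixes A :: "'a::euclidean_space \<Rightarrow> 'b::euclidean_space \<Rightarrow> 'c::euclidean_space"
  assumes S: "open S" "x \<in> S" and lin: "\<And>x. x \<in> S \<Longrightarrow> linear (A x)"
    and d: "\<And>u. (\<lambda>y. A y u) differentiable (at x)"
  shows "linear (\<lambda>u. frechet_derivative (\<lambda>y. A y u) (at x) v)"
proof (rule linearI)
  note d' = d[unfolded frechet_derivative_works]
  fix u w
  have "((\<lambda>y. A y (u + w)) has_derivative
      (\<lambda>v. frechet_derivative (\<lambda>y. A y u) (at x) v + frechet_derivative (\<lambda>y. A y w) (at x) v)) (at x)"
    by (rule has_derivative_transform_within_open[OF has_derivative_add[OF d'[of u] d'[of w]] S])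
       (simp add: linear_add[OF lin])
  from frechet_derivative_at[OF this]
  show "frechet_derivative (\<lambda>y. A y (u + w)) (at x) v =
     frechet_derivative (\<lambda>y. A y u) (at x) v + frechet_derivative (\<lambda>y. A y w) (at x) v" by metis
next
  note d' = d[unfolded frechet_derivative_works]
  fix r u
  have "((\<lambda>y. A y (r *\<^sub>R u)) has_derivative
      (\<lambda>v. r *\<^sub>R frechet_derivative (\<lambda>y. A y u) (at x) v)) (at x)"
    by (rule has_derivative_transform_within_open[OF has_derivative_scaleR_right[OF d'[of u]] S])
       (simp add: linear_cmul[OF lin])
  from frechet_derivative_at[OF this]
  show "frechet_derivative (\<lambda>y. A y (r *\<^sub>R u)) (at x) v = r *\<^sub>R frechet_derivative (\<lambda>y. A y u) (at x) v"
    by metis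
qed

text \<open>Writing \<open>W x\<close> for the inverse of \<open>A x\<close> and \<open>D\<close> for the derivative of \<open>A\<close>, the derivative of
  \<open>W x c\<close> in the direction \<open>v\<close> is \<open>- W x (D x v (W x c))\<close>. The right-hand side involves only \<open>W\<close> and
  derivatives of \<open>A\<close>, so the inverse gains one order of differentiability at each induction step. This
  is how the inverse of the metric, and with it the operation \<open>sharp\<close>, is seen to be smooth.\<close>

lemma smooth_on_linear_system:
  fixes A :: "'a::euclidean_space \<Rightarrow> 'b::euclidean_space \<Rightarrow> 'b"
  assumes S: "open S"
    and lin: "\<And>x. x \<in> S \<Longrightarrow> linear (A x)" and inj: "\<And>x. x \<in> S \<Longrightarrow> inj (A x)"
    and A: "\<And>u. smooth_on S (\<lambda>x. A x u)" and b: "smooth_on S b"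
    and w: "\<And>x. x \<in> S \<Longrightarrow> A x (w x) = b x"
  shows "smooth_on S w"
proof -
  define W where "W x = inv (A x)" for x
  have AW: "A x (W x c) = c" and WA: "W x (A x c) = c" if "x \<in> S" for x c
    using linear_injective_imp_surjective[OF lin[OF that] inj[OF that]] inj[OF that]
    by (simp_all add: W_def surj_f_inv_f)
  have linW: "linear (W x)" if "x \<in> S" for x
    by (rule linearI; rule injD[OF inj[OF that]])
       (simp_all add: AW[OF that] linear_add[OF lin[OF that]] linear_cmul[OF lin[OF that]])
  define D where "D x v u = frechet_derivative (\<lambda>y. A y u) (at x) v" for x v u
  have linD: "linear (D x v)" if "x \<in> S" for x v
    unfolding D_def[abs_def]
    by (rule linear_frechet_parameter[OF S that lin])
       (use smooth_on_has_derivative[OF A that] differentiableI in blast)+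
  have smD: "smooth_on S (\<lambda>x. D x v u)" for v u
    unfolding D_def by (rule smooth_on_frechet[OF A])
  have dW: "((\<lambda>x. W x c) has_derivative (\<lambda>v. W x0 (- D x0 v (W x0 c)))) (at x0)" if x0: "x0 \<in> S" for x0 c
  proof (rule linear_system_has_derivative[OF S x0 lin inj[OF x0] smooth_on_continuous[OF A]])
    show "((\<lambda>x. c - A x (W x0 c)) has_derivative (\<lambda>v. - D x0 v (W x0 c))) (at x0)"
      using has_derivative_diff[OF has_derivative_const smooth_on_has_derivative[OF A x0]]
      by (simp add: D_def)
    show "A x (W x c - W x0 c) = c - A x (W x0 c)" if "x \<in> S" for x
      by (simp add: linear_diff[OF lin[OF that]] AW[OF that])
  qed (simp_all add: AW x0)
  have "Ck_on k S (\<lambda>x. W x c)" for k c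
  proof (induction k arbitrary: c)
    case 0
    have "(\<lambda>x. W x c) differentiable (at x)" if "x \<in> S" for x
      using dW[OF that] differentiableI by blast
    then show ?case
      by (simp add: differentiable_at_imp_differentiable_on differentiable_imp_continuous_on)
  next
    case (Suc k)
    show ?case
      using dW
    proof (rule Ck_on_SucI[OF S])
      fix v
      have 1: "Ck_on k S (\<lambda>x. D x v (W x c))"
        by (rule Ck_on_linear_apply[OF S linD _ Suc]) (use smD[unfolded smooth_on_def, rule_format] in blast)+
      have "Ck_on k S (\<lambda>x. - D x v (W x c))"
        using Ck_on_compose[OF S 1 Ck_on_linear[OF bounded_linear_minus[OF bounded_linear_ident]], of UNIV]
        by (simp add: o_def)
      from Ck_on_linear_apply[where h = W, OF S linW Suc this]
      show "Ck_on k S (\<lambda>x. W x (- D x v (W x c)))" by simp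
    qed
  qed
  then have "smooth_on S (\<lambda>x. W x c)" for c by (simp add: smooth_on_def)
  from smooth_on_linear_apply[where h = W, OF S linW this b]
  have "smooth_on S (\<lambda>x. W x (b x))" by simp
  then show ?thesis by (rule smooth_on_cong[OF S, THEN iffD1, rotated]) (metis w WA)
qed

section \<open>Local existence for ordinary differential equations\<close>

text \<open>The Picard operator, taken on the bounded continuous functions of time. Time is clamped to
  \<open>[-e, e]\<close> by \<open>c\<close>, so that the functions live on the whole line and form a complete metric space.
  The condition \<open>K * e \<le> 1/2\<close> makes the operator a contraction.\<close>

lemma picard_local_solution:
  fixes g :: "'a::euclidean_space \<Rightarrow> 'a"
  assumes lip: "\<And>x y. dist (g x) (g y) \<le> K * dist x y" and bd: "\<And>x. norm (g x) \<le> M"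
    and K: "K \<ge> 0" "K * e \<le> 1/2" and e: "e > 0"
  shows "\<exists>x. x 0 = x0 \<and> (\<forall>t\<in>{-e<..<e}. (x has_vector_derivative g (x t)) (at t)) \<and>
     (\<forall>t\<in>{-e<..<e}. dist (x t) x0 \<le> M * e)"
proof -
  have cg: "continuous_on S g" for S
    by (rule continuous_on_subset[OF lipschitz_on_continuous_on[OF lipschitz_onI[OF lip K(1)]] subset_UNIV])
  \<comment> \<open>The difference of two integrals replaces the integral from 0 to \<open>t\<close>, which would need an orientation for negative \<open>t\<close>.\<close>
  define I where "I \<phi> t = integral {-e..t} (\<lambda>s. g (\<phi> s)) - integral {-e..0} (\<lambda>s. g (\<phi> s))" for \<phi> t
  define c where "c t = max (-e) (min e t)" for t :: real
  have c: "c t \<in> {-e..e}" for t using e by (auto simp: c_def)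
  have c': "c t = t" if "t \<in> {-e..e}" for t using that by (auto simp: c_def)
  have dI: "(I \<phi> has_vector_derivative g (\<phi> t)) (at t within {-e..e})"
    if "continuous_on UNIV \<phi>" "t \<in> {-e..e}" for \<phi> t
  proof -
    have "continuous_on {-e..e} (\<lambda>s. g (\<phi> s))"
      by (rule continuous_on_compose2[OF cg[of UNIV]]) (use that continuous_on_subset in auto)
    from has_vector_derivative_diff[OF integral_has_vector_derivative[OF this that(2)] has_vector_derivative_const]
    show ?thesis unfolding I_def[abs_def] by simp
  qed
  have I0: "I \<phi> 0 = 0" for \<phi> by (simp add: I_def)
  have est: "norm (u t) \<le> B * e"
    if "\<And>t. t \<in> {-e..e} \<Longrightarrow> (u has_vector_derivative u' t) (at t within {-e..e})"
      "\<And>t. t \<in> {-e..e} \<Longrightarrow> norm (u' t) \<le> B" "u 0 = 0" "t \<in> {-e..e}" for u u' :: "real \<Rightarrow> 'a" and B t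
  proof -
    have B: "0 \<le> B" using that(2)[OF that(4)] order_trans[OF norm_ge_zero] by blast
    have "norm (u t - u 0) \<le> B * norm (t - 0)"
    proof (rule differentiable_bound[of "{-e..e}" u "\<lambda>t h. h *\<^sub>R u' t" B])
      fix x assume x: "x \<in> {-e..e}"
      show "(u has_derivative (\<lambda>h. h *\<^sub>R u' x)) (at x within {-e..e})"
        using that(1)[OF x] by (simp add: has_vector_derivative_def)
      show "onorm (\<lambda>h. h *\<^sub>R u' x) \<le> B"
        by (rule onorm_bound[OF B]) (simp add: mult.commute[of B] mult_left_mono[OF that(2)[OF x]])
    qed (use that(4) e in simp_all)
    also have "\<dots> \<le> B * e"
      by (rule mult_left_mono[OF _ B]) (use that(4) in auto)
    finally show ?thesis using that(3) by simp
  qed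
  have M: "M \<ge> 0" using bd order_trans norm_ge_zero by blast
  have cI: "continuous_on UNIV (\<lambda>t. x0 + I \<phi> (c t))" if "continuous_on UNIV \<phi>" for \<phi>
  proof -
    have "continuous_on {-e..e} (I \<phi>)"
      using dI[OF that] has_vector_derivative_continuous continuous_on_eq_continuous_within by blast
    then have "continuous_on UNIV (\<lambda>t. I \<phi> (c t))"
      by (rule continuous_on_compose2) (use c in \<open>auto simp: c_def intro!: continuous_intros\<close>)
    then show ?thesis by (intro continuous_intros)
  qed
  have nI: "norm (I \<phi> t) \<le> M * e" if "continuous_on UNIV \<phi>" "t \<in> {-e..e}" for \<phi> t
    by (rule est[OF dI[OF that(1)] bd I0 that(2)])
  define T where "T \<phi> = Bcontfun (\<lambda>t. x0 + I (apply_bcontfun \<phi>) (c t))" for \<phi> :: "real \<Rightarrow>\<^sub>C 'a"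
  have cphi: "continuous_on UNIV (apply_bcontfun \<phi>)" for \<phi> :: "real \<Rightarrow>\<^sub>C 'a"
    by (simp add: continuous_on_apply_bcontfun)
  have T: "apply_bcontfun (T \<phi>) t = x0 + I (apply_bcontfun \<phi>) (c t)" for \<phi> t
  proof -
    have "(\<lambda>t. x0 + I (apply_bcontfun \<phi>) (c t)) \<in> bcontfun"
      by (rule bcontfun_normI[where b = "norm x0 + M * e"])
         (use cI[OF cphi] nI[OF cphi c] in \<open>auto intro: order_trans[OF norm_triangle_ineq]\<close>)
    then show ?thesis by (simp add: T_def Bcontfun_inverse)
  qed
  have "dist (T \<phi>) (T \<psi>) \<le> 1/2 * dist \<phi> \<psi>" for \<phi> \<psi>
  proof (rule dist_bound)
    fix t
    let ?u = "\<lambda>t. I (apply_bcontfun \<phi>) t - I (apply_bcontfun \<psi>) t"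
    have "norm (?u (c t)) \<le> (K * dist \<phi> \<psi>) * e"
    proof (rule est[where u = ?u, OF has_vector_derivative_diff[OF dI[OF cphi] dI[OF cphi]]])
      show "norm (g (apply_bcontfun \<phi> t) - g (apply_bcontfun \<psi> t)) \<le> K * dist \<phi> \<psi>" for t
        using lip[of "apply_bcontfun \<phi> t" "apply_bcontfun \<psi> t"] dist_bounded[of \<phi> t \<psi>] K(1)
        by (smt (verit) dist_norm mult_left_mono)
    qed (use c in \<open>auto simp: I0\<close>)
    also have "\<dots> = (K * e) * dist \<phi> \<psi>" by simp
    also have "\<dots> \<le> 1/2 * dist \<phi> \<psi>" by (rule mult_right_mono[OF K(2)]) simp
    finally show "dist (apply_bcontfun (T \<phi>) t) (apply_bcontfun (T \<psi>) t) \<le> 1/2 * dist \<phi> \<psi>"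
      by (simp add: T dist_norm)
  qed
  then have "\<exists>!\<phi>. T \<phi> = \<phi>" by (intro banach_fix_type[of "1/2"]) auto
  then obtain \<phi> where fixp: "T \<phi> = \<phi>" by blast
  define x where "x = apply_bcontfun \<phi>"
  have x: "x t = x0 + I x t" if "t \<in> {-e..e}" for t
    using T[of \<phi> t] c'[OF that] by (simp add: fixp x_def)
  have "(x has_vector_derivative g (x t)) (at t)" if t: "t \<in> {-e<..<e}" for t
  proof -
    have "((\<lambda>t. x0 + I x t) has_vector_derivative 0 + g (x t)) (at t within {-e..e})"
      by (intro has_vector_derivative_add has_vector_derivative_const dI) (use t cphi x_def in auto)
    then have "((\<lambda>t. x0 + I x t) has_vector_derivative g (x t)) (at t)"
      using t by (simp add: at_within_Icc_at)
    then show ?thesis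
      by (rule has_vector_derivative_transform_within_open[of _ _ _ "{-e<..<e}"]) (use t x in auto)
  qed
  moreover have "x 0 = x0" using x[of 0] e by (simp add: I0)
  moreover have "dist (x t) x0 \<le> M * e" if "t \<in> {-e<..<e}" for t
    using x[of t] nI[of x t] that cphi by (simp add: dist_norm x_def)
  ultimately show ?thesis by blast
qed

text \<open>A smooth field is Lipschitz on a closed ball; composing it with the nearest-point map of that ball
  makes it globally Lipschitz and bounded, and the solution does not leave the ball for a short time.
  The equation expresses the derivative of the solution through the solution itself, which gives its
  smoothness by induction on the order.\<close>

lemma smooth_ode_local_existence:
  fixes f :: "'a::euclidean_space \<Rightarrow> 'a"
  assumes W: "open W" and f: "smooth_on W f" and x0: "x0 \<in> W"
  shows "\<exists>e x. e > 0 \<and> x 0 = x0 \<and> smooth_on {-e<..<e} x \<and>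
    (\<forall>t\<in>{-e<..<e}. x t \<in> W \<and> (x has_vector_derivative f (x t)) (at t))"
proof -
  obtain r where r: "r > 0" "cball x0 r \<subseteq> W" using W x0 open_contains_cball by blast
  let ?B = "cball x0 r"
  let ?f' = "\<lambda>x. frechet_derivative f (at x)"
  have d: "(f has_derivative ?f' x) (at x)" if "x \<in> ?B" for x
    by (rule smooth_on_has_derivative[OF f]) (use r(2) that in auto)
  have bdd: "\<exists>M. \<forall>x\<in>?B. norm (h x) \<le> M" if "smooth_on W h" for h :: "'a \<Rightarrow> 'a"
  proof -
    have "compact (h ` ?B)"
      by (rule compact_continuous_image[OF continuous_on_subset[OF smooth_on_continuous[OF that] r(2)] compact_cball])
    then show ?thesis using compact_imp_bounded[of "h ` ?B"] by (simp add: bounded_iff)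
  qed
  obtain M where M: "\<And>x. x \<in> ?B \<Longrightarrow> norm (f x) \<le> M" using bdd[OF f] by blast
  have "\<forall>b. \<exists>M. \<forall>x\<in>?B. norm (?f' x b) \<le> M"
    by (intro allI bdd smooth_on_frechet f)
  then obtain N where N: "\<And>b x. x \<in> ?B \<Longrightarrow> norm (?f' x b) \<le> N b" by metis
  define K where "K = (\<Sum>b\<in>Basis. N b)"
  have x0B: "x0 \<in> ?B" using r by simp
  have K: "K \<ge> 0" unfolding K_def by (rule sum_nonneg) (use N[OF x0B] order_trans norm_ge_zero in blast)
  have nf: "norm (?f' x v) \<le> K * norm v" if "x \<in> ?B" for x v
  proof -
    have "?f' x v = (\<Sum>b\<in>Basis. (v \<bullet> b) *\<^sub>R ?f' x b)"
      by (rule linear_expand[OF has_derivative_linear[OF d[OF that]]])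
    also have "norm \<dots> \<le> (\<Sum>b\<in>Basis. norm v * N b)"
      by (rule sum_norm_le) (use N[OF that] Basis_le_norm in \<open>auto intro!: mult_mono\<close>)
    finally show ?thesis by (simp add: K_def sum_distrib_left mult.commute)
  qed
  have lipB: "norm (f x - f y) \<le> K * norm (x - y)" if "x \<in> ?B" "y \<in> ?B" for x y
    by (rule differentiable_bound[of ?B f ?f' K])
       (use that in \<open>auto intro!: onorm_bound K nf has_derivative_at_withinI[OF d] simp del: mem_cball\<close>)
  let ?p = "closest_point ?B"
  have pB: "?p x \<in> ?B" for x by (rule closest_point_in_set) (use r in auto)
  define g where "g = f \<circ> ?p"
  have "dist (g x) (g y) \<le> K * dist x y" for x y
  proof -
    have "dist (g x) (g y) \<le> K * dist (?p x) (?p y)"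
      using lipB[OF pB pB] by (simp add: g_def dist_norm)
    also have "\<dots> \<le> K * dist x y"
      by (rule mult_left_mono[OF closest_point_lipschitz K]) (use r in auto)
    finally show ?thesis .
  qed
  moreover have "norm (g x) \<le> M" for x using M[OF pB] by (simp add: g_def)
  \<comment> \<open>The first bound makes the Picard operator contract, the second keeps the solution in the ball. The summands 1 prevent division by zero.\<close>
  moreover define e where "e = min (1 / (2 * (K + 1))) (r / (\<bar>M\<bar> + 1))"
  have e: "e > 0" using K r by (simp add: e_def)
  moreover have "K * e \<le> 1/2"
  proof -
    have "K * e \<le> K * (1 / (2 * (K + 1)))" by (rule mult_left_mono[OF _ K]) (simp add: e_def)
    also have "\<dots> \<le> 1/2" using K by (simp add: field_simps)
    finally show ?thesis .
  qed
  moreover have Me: "M * e \<le> r"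
  proof -
    have "M * e \<le> \<bar>M\<bar> * (r / (\<bar>M\<bar> + 1))" by (rule mult_mono) (use e in \<open>auto simp: e_def\<close>)
    also have "\<dots> \<le> r" using r by (simp add: field_simps)
    finally show ?thesis .
  qed
  ultimately obtain x where x: "x 0 = x0"
     "\<And>t. t \<in> {-e<..<e} \<Longrightarrow> (x has_vector_derivative g (x t)) (at t)"
     "\<And>t. t \<in> {-e<..<e} \<Longrightarrow> dist (x t) x0 \<le> M * e"
    using picard_local_solution[of g K M e x0] K by metis
  have xB: "x t \<in> ?B" if "t \<in> {-e<..<e}" for t
    using x(3)[OF that] Me by (simp add: dist_commute)
  have gx: "g (x t) = f (x t)" if "t \<in> {-e<..<e}" for t
    using closest_point_self[OF xB[OF that]] by (simp add: g_def)
  have xd: "(x has_vector_derivative f (x t)) (at t)" if "t \<in> {-e<..<e}" for t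
    using x(2)[OF that] gx[OF that] by simp
  have "Ck_on k {-e<..<e} x" for k
  proof (induction k)
    case 0
    show ?case
      using xd has_vector_derivative_continuous continuous_at_imp_continuous_on by (metis Ck_on.simps(1))
  next
    case (Suc k)
    have 1: "Ck_on k {-e<..<e} (f \<circ> x)"
      by (rule Ck_on_compose[OF _ Suc]) (use f xB r(2) in \<open>auto simp: smooth_on_def\<close>)
    show ?case
    proof (rule Ck_on_SucI)
      show "(x has_derivative (\<lambda>h. h *\<^sub>R f (x t))) (at t)" if "t \<in> {-e<..<e}" for t
        using xd[OF that] by (simp add: has_vector_derivative_def)
      show "Ck_on k {-e<..<e} (\<lambda>t. h *\<^sub>R f (x t))" for h
        using Ck_on_bilinear[OF bounded_bilinear_scaleR _ Ck_on_const 1] by simp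
    qed simp
  qed
  then have "smooth_on {-e<..<e} x" by (simp add: smooth_on_def)
  then show ?thesis using e x(1) xd xB r(2) by blast
qed

section \<open>Charts and tangent vectors\<close>

locale smooth_manifold =
  fixes A :: "('q::{t2_space,second_countable_topology}, 'e::euclidean_space) chart set"
  assumes smooth_structure: "smooth_structure A"
begin

lemma topological_chart: "c \<in> A \<Longrightarrow> topological_chart c"
  using smooth_structure by (simp add: smooth_structure_def)

lemma
  assumes "c \<in> A"
  shows open_domain: "open (fst c)" and open_codomain: "open (snd c ` fst c)"
    and continuous_chart_inv: "continuous_on (snd c ` fst c) (chart_inv c)"
    and chart_inv_chart: "p \<in> fst c \<Longrightarrow> chart_inv c (snd c p) = p"
    and chart_chart_inv: "x \<in> snd c ` fst c \<Longrightarrow> snd c (chart_inv c x) = x"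
    and chart_inv_in: "x \<in> snd c ` fst c \<Longrightarrow> chart_inv c x \<in> fst c"
  using topological_chart[OF assms] unfolding topological_chart_def homeomorphism_def by auto

lemma open_chart_image:
  assumes "c \<in> A" "open V" "V \<subseteq> fst c"
  shows "open (snd c ` V)"
proof -
  have "homeomorphism (fst c) (snd c ` fst c) (snd c) (chart_inv c)"
    using topological_chart[OF assms(1)] by (simp add: topological_chart_def)
  moreover have "openin (top_of_set (fst c)) V" using assms by (simp add: open_openin_trans open_domain)
  ultimately have "openin (top_of_set (snd c ` fst c)) (snd c ` V)" by (rule homeomorphism_imp_open_map)
  then show ?thesis using openin_open_trans open_codomain[OF assms(1)] by blast
qed

lemma smooth_transition:
  "c \<in> A \<Longrightarrow> c' \<in> A \<Longrightarrow> smooth_on (snd c ` (fst c \<inter> fst c')) (snd c' \<circ> chart_inv c)"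
  using smooth_structure unfolding smooth_structure_def smooth_transition_def by blast

lemma chart_at: "chart_at A p \<in> A" "p \<in> fst (chart_at A p)"
proof -
  have "\<exists>c. c \<in> A \<and> p \<in> fst c" using smooth_structure unfolding smooth_structure_def by blast
  from someI_ex[OF this] show "chart_at A p \<in> A" "p \<in> fst (chart_at A p)" by (simp_all add: chart_at_def)
qed

lemma coord_change_has_derivative:
  assumes "c \<in> A" "c' \<in> A" "p \<in> fst c" "p \<in> fst c'"
  shows "((snd c' \<circ> chart_inv c) has_derivative coord_change c c' p) (at (snd c p))"
  unfolding coord_change_def
  by (rule smooth_on_has_derivative[OF smooth_transition]) (use assms in auto)

lemma coord_change_linear:
  assumes "c \<in> A" "c' \<in> A" "p \<in> fst c" "p \<in> fst c'"
  shows "linear (coord_change c c' p)"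
  by (rule has_derivative_linear[OF coord_change_has_derivative[OF assms]])

text \<open>The chain rule for transition maps. It makes the description of a tangent vector by its components
  independent of the chart.\<close>

lemma coord_change_trans:
  assumes "c \<in> A" "c' \<in> A" "c'' \<in> A" "p \<in> fst c" "p \<in> fst c'" "p \<in> fst c''"
  shows "coord_change c' c'' p (coord_change c c' p v) = coord_change c c'' p v"
proof -
  have e: "(snd c' \<circ> chart_inv c) (snd c p) = snd c' p" using assms by (simp add: chart_inv_chart)
  have "((snd c'' \<circ> chart_inv c') \<circ> (snd c' \<circ> chart_inv c) has_derivative
      coord_change c' c'' p \<circ> coord_change c c' p) (at (snd c p))"
    by (rule diff_chain_at[OF coord_change_has_derivative])
       (use assms coord_change_has_derivative[of c' c'' p] e in auto)
  then have "((snd c'' \<circ> chart_inv c) has_derivative coord_change c' c'' p \<circ> coord_change c c' p) (at (snd c p))"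
  proof (rule has_derivative_transform_within_open)
    show "open (snd c ` (fst c \<inter> fst c' \<inter> fst c''))"
      by (rule open_chart_image) (use assms in \<open>auto intro!: open_Int open_domain\<close>)
  qed (use assms in \<open>auto simp: chart_inv_chart\<close>)
  from frechet_derivative_at[OF this] show ?thesis by (simp add: coord_change_def fun_eq_iff)
qed

lemma coord_change_self:
  assumes "c \<in> A" "p \<in> fst c"
  shows "coord_change c c p v = v"
proof -
  have "((\<lambda>x. x) has_derivative (\<lambda>v. v)) (at (snd c p))" by simp
  then have "((snd c \<circ> chart_inv c) has_derivative (\<lambda>v. v)) (at (snd c p))"
    by (rule has_derivative_transform_within_open[OF _ open_codomain[OF assms(1)]])
       (use assms in \<open>auto simp: chart_inv_chart\<close>)
  from frechet_derivative_at[OF this] show ?thesis by (simp add: coord_change_def fun_eq_iff)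
qed

lemma
  assumes "c \<in> A" "p \<in> fst c"
  shows to_coords_linear: "linear (to_coords A c p)"
    and of_coords_linear: "linear (of_coords A c p)"
    and to_coords_of_coords: "to_coords A c p (of_coords A c p v) = v"
    and of_coords_to_coords: "of_coords A c p (to_coords A c p v) = v"
  using assms chart_at[of p]
  by (simp_all add: to_coords_def of_coords_def coord_change_linear coord_change_trans coord_change_self)

lemma
  assumes "c \<in> A" "c' \<in> A" "p \<in> fst c" "p \<in> fst c'"
  shows to_coords_change: "coord_change c c' p (to_coords A c p v) = to_coords A c' p v"
  using assms chart_at[of p]
  by (simp_all add: to_coords_def of_coords_def coord_change_trans)

lemma smooth_coord_change:
  assumes "c \<in> A" "c' \<in> A"
  shows "smooth_on (snd c ` (fst c \<inter> fst c')) (\<lambda>x. coord_change c c' (chart_inv c x) v)"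
proof (rule smooth_on_cong[THEN iffD1])
  show "open (snd c ` (fst c \<inter> fst c'))" by (rule open_chart_image) (use assms in \<open>auto intro!: open_Int open_domain\<close>)
  show "smooth_on (snd c ` (fst c \<inter> fst c')) (\<lambda>x. frechet_derivative (snd c' \<circ> chart_inv c) (at x) v)"
    by (rule smooth_on_frechet[OF smooth_transition[OF assms]])
qed (use assms in \<open>auto simp: coord_change_def chart_inv_chart\<close>)

text \<open>With this, smoothness on an open set inside one chart domain can be tested in that single chart,
  both for functions and for vector fields.\<close>

lemma smooth_on_change_chart:
  assumes "c \<in> A" "c' \<in> A" "open V" "V \<subseteq> fst c" "smooth_on (snd c ` V) (\<lambda>x. f (chart_inv c x))"
  shows "smooth_on (snd c' ` (V \<inter> fst c')) (\<lambda>x. f (chart_inv c' x))"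
proof -
  have o: "open (snd c' ` (V \<inter> fst c'))"
    by (rule open_chart_image) (use assms in \<open>auto intro!: open_Int open_domain\<close>)
  have "smooth_on (snd c' ` (V \<inter> fst c')) ((\<lambda>x. f (chart_inv c x)) \<circ> (snd c \<circ> chart_inv c'))"
    by (rule smooth_on_compose[OF o smooth_on_subset[OF smooth_transition[OF assms(2,1)]] assms(5)])
       (use assms in \<open>auto simp: chart_inv_chart\<close>)
  then show ?thesis
    by (rule smooth_on_cong[OF o, THEN iffD1, rotated])
       (use assms in \<open>auto simp: chart_inv_chart subset_iff\<close>)
qed

lemma smooth_fun_chart:
  assumes "c \<in> A" "open V" "V \<subseteq> fst c"
  shows "smooth_fun A V f \<longleftrightarrow> smooth_on (snd c ` V) (\<lambda>x. f (chart_inv c x))"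
proof
  assume "smooth_fun A V f"
  then have "smooth_on (snd c ` (V \<inter> fst c)) (f \<circ> chart_inv c)"
    using assms by (simp add: smooth_fun_def)
  then show "smooth_on (snd c ` V) (\<lambda>x. f (chart_inv c x))"
    using assms by (simp add: Int_absorb2 o_def)
next
  assume *: "smooth_on (snd c ` V) (\<lambda>x. f (chart_inv c x))"
  show "smooth_fun A V f"
    using smooth_on_change_chart[OF assms(1) _ assms(2,3) *] assms(2) by (simp add: smooth_fun_def o_def)
qed

lemma smooth_vf_chart:
  assumes "c \<in> A" "open V" "V \<subseteq> fst c"
  shows "smooth_vf A V X \<longleftrightarrow>
    smooth_on (snd c ` V) (\<lambda>x. to_coords A c (chart_inv c x) (X (chart_inv c x)))"
proof
  assume "smooth_vf A V X"
  then have "smooth_on (snd c ` (V \<inter> fst c)) (\<lambda>x. to_coords A c (chart_inv c x) (X (chart_inv c x)))"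
    using assms by (simp add: smooth_vf_def)
  then show "smooth_on (snd c ` V) (\<lambda>x. to_coords A c (chart_inv c x) (X (chart_inv c x)))"
    using assms by (simp add: Int_absorb2)
next
  assume *: "smooth_on (snd c ` V) (\<lambda>x. to_coords A c (chart_inv c x) (X (chart_inv c x)))"
  show "smooth_vf A V X"
    unfolding smooth_vf_def
  proof (intro conjI ballI assms)
    fix c' assume c': "c' \<in> A"
    have "smooth_on (snd c ` (V \<inter> fst c')) (\<lambda>x. coord_change c c' (chart_inv c x)
          (to_coords A c (chart_inv c x) (X (chart_inv c x))))"
    proof (rule smooth_on_linear_apply[where h = "\<lambda>x. coord_change c c' (chart_inv c x)"])
      show "open (snd c ` (V \<inter> fst c'))"
        by (rule open_chart_image) (use assms c' in \<open>auto intro!: open_Int open_domain\<close>)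
      show "linear (coord_change c c' (chart_inv c x))" if "x \<in> snd c ` (V \<inter> fst c')" for x
        using that assms c' by (auto simp: chart_inv_chart subset_iff intro!: coord_change_linear)
      show "smooth_on (snd c ` (V \<inter> fst c')) (\<lambda>x. coord_change c c' (chart_inv c x) u)" for u
        by (rule smooth_on_subset[OF smooth_coord_change]) (use assms c' in auto)
    qed (rule smooth_on_subset[OF *], auto)
    then have "smooth_on (snd c' ` (V \<inter> fst c' \<inter> fst c')) (\<lambda>x. coord_change c c' (chart_inv c' x)
          (to_coords A c (chart_inv c' x) (X (chart_inv c' x))))"
      by (rule smooth_on_change_chart[rotated 4,
           where f = "\<lambda>p. coord_change c c' p (to_coords A c p (X p))"])
         (use assms c' in \<open>auto intro!: open_Int open_domain\<close>)
    then have 1: "smooth_on (snd c' ` (V \<inter> fst c')) (\<lambda>x. coord_change c c' (chart_inv c' x)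
          (to_coords A c (chart_inv c' x) (X (chart_inv c' x))))" by (simp add: Int_assoc)
    show "smooth_on (snd c' ` (V \<inter> fst c')) (\<lambda>x. to_coords A c' (chart_inv c' x) (X (chart_inv c' x)))"
    proof (rule smooth_on_cong[THEN iffD1, OF _ _ 1])
      show "open (snd c' ` (V \<inter> fst c'))"
        by (rule open_chart_image) (use assms c' in \<open>auto intro!: open_Int open_domain\<close>)
    qed (use assms c' in \<open>auto simp: chart_inv_chart subset_iff to_coords_change\<close>)
  qed
qed

lemma smooth_vf_subset: "smooth_vf A U X \<Longrightarrow> open V \<Longrightarrow> V \<subseteq> U \<Longrightarrow> smooth_vf A V X"
  using smooth_on_subset[OF _ image_mono[OF Int_mono[OF _ order_refl]]]
  unfolding smooth_vf_def by meson

lemma smooth_vf_coord_field: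
  assumes "c \<in> A" shows "smooth_vf A (fst c) (\<lambda>p. of_coords A c p w)"
  unfolding smooth_vf_chart[OF assms open_domain[OF assms] order_refl]
  by (rule smooth_on_cong[OF open_codomain[OF assms], THEN iffD1, OF _ smooth_on_const[of _ w]])
     (use assms in \<open>auto simp: chart_inv_chart to_coords_of_coords\<close>)

section \<open>Curves and differentials\<close>

lemma smooth_curve_open:
  assumes "smooth_curve A I q" "open I" "open V"
  shows "open {t \<in> I. q t \<in> V}"
proof -
  have "continuous_on I q" using assms(1) by (simp add: smooth_curve_def)
  from continuous_open_preimage[OF this assms(2,3)] show ?thesis by (simp add: vimage_def Int_def)
qed

lemma smooth_curve_in_chart:
  "smooth_curve A I q \<Longrightarrow> c \<in> A \<Longrightarrow> smooth_on {t \<in> I. q t \<in> fst c} (snd c \<circ> q)"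
  by (simp add: smooth_curve_def)

lemma curve_change_chart:
  assumes "c \<in> A" "c' \<in> A" and J: "open J" "t \<in> J" "\<And>s. s \<in> J \<Longrightarrow> q s \<in> fst c" and t: "q t \<in> fst c'"
    and d: "((snd c \<circ> q) has_vector_derivative u) (at t)"
  shows "((snd c' \<circ> q) has_vector_derivative coord_change c c' (q t) u) (at t)"
proof -
  have "((snd c' \<circ> chart_inv c) \<circ> (snd c \<circ> q) has_derivative coord_change c c' (q t) \<circ> (\<lambda>h. h *\<^sub>R u)) (at t)"
    by (rule diff_chain_at[OF d[unfolded has_vector_derivative_def]])
       (use coord_change_has_derivative[OF assms(1,2) J(3)[OF J(2)] t] in simp)
  then have "((snd c' \<circ> q) has_derivative coord_change c c' (q t) \<circ> (\<lambda>h. h *\<^sub>R u)) (at t)"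
    by (rule has_derivative_transform_within_open[OF _ J(1,2)])
       (use J assms in \<open>auto simp: chart_inv_chart\<close>)
  moreover have "coord_change c c' (q t) \<circ> (\<lambda>h. h *\<^sub>R u) = (\<lambda>h. h *\<^sub>R coord_change c c' (q t) u)"
    using linear_cmul[OF coord_change_linear[OF assms(1,2) J(3)[OF J(2)] t]] by auto
  ultimately show ?thesis by (simp only: has_vector_derivative_def)
qed

text \<open>Velocity is defined through the preferred chart at the current point, which may change abruptly along
  the curve. In a fixed chart it is the derivative of the coordinates.\<close>

lemma velocity_eq:
  assumes "c \<in> A" "open J" "t \<in> J" "\<And>s. s \<in> J \<Longrightarrow> q s \<in> fst c"
    and d: "((snd c \<circ> q) has_vector_derivative u) (at t)"
  shows "velocity A q t = of_coords A c (q t) u"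
  unfolding velocity_def of_coords_def
  by (rule vector_derivative_at[OF curve_change_chart[OF assms(1) chart_at(1) assms(2-4) chart_at(2) d]])

lemma velocity_coords:
  assumes q: "smooth_curve A I q" "open I" "t \<in> I" and c: "c \<in> A" "q t \<in> fst c"
  shows "((snd c \<circ> q) has_vector_derivative to_coords A c (q t) (velocity A q t)) (at t)"
proof -
  have d: "((snd c \<circ> q) has_vector_derivative vector_derivative (snd c \<circ> q) (at t)) (at t)"
    by (rule smooth_on_has_vector_derivative[OF smooth_curve_in_chart[OF q(1) c(1)]]) (use q c in auto)
  have "velocity A q t = of_coords A c (q t) (vector_derivative (snd c \<circ> q) (at t))"
    by (rule velocity_eq[OF c(1) smooth_curve_open[OF q(1,2) open_domain[OF c(1)]] _ _ d]) (use q c in auto)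
  then have "to_coords A c (q t) (velocity A q t) = vector_derivative (snd c \<circ> q) (at t)"
    by (simp only: to_coords_of_coords[OF c])
  then show ?thesis using d by (simp only:)
qed

text \<open>Smoothness of a curve can be tested in any charts that cover it, and it includes continuity.\<close>

lemma smooth_curveI:
  assumes "\<And>t. t \<in> I \<Longrightarrow> \<exists>c\<in>A. \<exists>J. open J \<and> t \<in> J \<and> q ` J \<subseteq> fst c \<and> smooth_on J (snd c \<circ> q)"
  shows "smooth_curve A I q"
  unfolding smooth_curve_def
proof (intro conjI ballI)
  have ct: "continuous_on J q" if "c \<in> A" "q ` J \<subseteq> fst c" "smooth_on J (snd c \<circ> q)" for c J
  proof -
    have "continuous_on J (\<lambda>t. chart_inv c ((snd c \<circ> q) t))"
      by (rule continuous_on_compose2[OF continuous_chart_inv[OF that(1)] smooth_on_continuous[OF that(3)]])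
         (use that in auto)
    then show ?thesis
      by (rule continuous_on_eq) (use that in \<open>auto simp: chart_inv_chart\<close>)
  qed
  have "continuous (at t within I) q" if "t \<in> I" for t
  proof -
    obtain c J where J: "c \<in> A" "open J" "t \<in> J" "q ` J \<subseteq> fst c" "smooth_on J (snd c \<circ> q)"
      using assms[OF \<open>t \<in> I\<close>] by auto
    then have "continuous (at t) q"
      using ct[OF J(1,4,5)] by (simp add: continuous_on_eq_continuous_at)
    then show ?thesis by (rule continuous_at_imp_continuous_within)
  qed
  then show "continuous_on I q" by (simp add: continuous_on_eq_continuous_within)
  fix c' assume c': "c' \<in> A"
  show "smooth_on {t \<in> I. q t \<in> fst c'} (snd c' \<circ> q)"
  proof (rule smooth_on_local)
    fix t assume t: "t \<in> {t \<in> I. q t \<in> fst c'}"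
    then obtain c J where c: "c \<in> A" and J: "open J" "t \<in> J" "q ` J \<subseteq> fst c" "smooth_on J (snd c \<circ> q)"
      using assms[of t] by auto
    let ?T = "{s \<in> J. q s \<in> fst c'}"
    have o: "open ?T"
      using continuous_open_preimage[OF ct[OF c J(3,4)] J(1) open_domain[OF c']]
      by (simp add: vimage_def Int_def)
    have "smooth_on ?T ((snd c' \<circ> chart_inv c) \<circ> (snd c \<circ> q))"
      by (rule smooth_on_compose[OF o smooth_on_subset[OF J(4)] smooth_transition[OF c c']]) (use J in auto)
    then have "smooth_on ?T (snd c' \<circ> q)"
      by (rule smooth_on_cong[OF o, THEN iffD1, rotated]) (use J c in \<open>auto simp: chart_inv_chart\<close>)
    then show "\<exists>T. open T \<and> t \<in> T \<and> smooth_on T (snd c' \<circ> q)" using o t J(2) by auto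
  qed
qed

lemma differential_of_coords:
  assumes f: "smooth_fun A U f" "p \<in> U" and c: "c \<in> A" "p \<in> fst c"
  shows "((\<lambda>x. f (chart_inv c x)) has_derivative (\<lambda>u. differential A f p (of_coords A c p u))) (at (snd c p))"
proof -
  let ?c = "chart_at A p"
  have U: "open U" using f by (simp add: smooth_fun_def)
  have 1: "((f \<circ> chart_inv ?c) has_derivative differential A f p) (at (snd ?c p))"
    unfolding differential_def
    by (rule smooth_on_has_derivative[of "snd ?c ` (U \<inter> fst ?c)"])
       (use f chart_at in \<open>auto simp: smooth_fun_def\<close>)
  have 2: "((snd ?c \<circ> chart_inv c) has_derivative of_coords A c p) (at (snd c p))"
    unfolding of_coords_def by (rule coord_change_has_derivative) (use c chart_at in auto)
  have "((f \<circ> chart_inv ?c) \<circ> (snd ?c \<circ> chart_inv c) has_derivative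
     differential A f p \<circ> of_coords A c p) (at (snd c p))"
    by (rule diff_chain_at[OF 2]) (use 1 c in \<open>simp add: chart_inv_chart\<close>)
  then have "((\<lambda>x. f (chart_inv c x)) has_derivative differential A f p \<circ> of_coords A c p) (at (snd c p))"
  proof (rule has_derivative_transform_within_open)
    show "open (snd c ` (fst c \<inter> fst ?c))"
      by (rule open_chart_image) (use c chart_at in \<open>auto intro!: open_Int open_domain\<close>)
  qed (use c chart_at in \<open>auto simp: chart_inv_chart\<close>)
  then show ?thesis by (simp add: o_def)
qed

text \<open>Chain rule: differentiating a function along a curve pairs its differential with the velocity.\<close>

lemma differential_curve:
  assumes f: "smooth_fun A U f" "q t \<in> U" and q: "smooth_curve A I q" "open I" "t \<in> I"
  shows "((\<lambda>s. f (q s)) has_vector_derivative differential A f (q t) (velocity A q t)) (at t)"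
proof -
  let ?c = "chart_at A (q t)"
  note c = chart_at[of "q t"]
  note d1 = differential_of_coords[OF f c]
  note d2 = velocity_coords[OF q c]
  have lin: "linear (\<lambda>u. differential A f (q t) (of_coords A ?c (q t) u))"
    by (rule has_derivative_linear[OF d1])
  have 1: "((\<lambda>x. f (chart_inv ?c x)) \<circ> (snd ?c \<circ> q) has_derivative
     (\<lambda>u. differential A f (q t) (of_coords A ?c (q t) u)) \<circ>
     (\<lambda>h. h *\<^sub>R to_coords A ?c (q t) (velocity A q t))) (at t)"
    by (rule diff_chain_at[OF d2[unfolded has_vector_derivative_def]]) (use d1 in simp)
  have 2: "(\<lambda>u. differential A f (q t) (of_coords A ?c (q t) u)) \<circ>
     (\<lambda>h. h *\<^sub>R to_coords A ?c (q t) (velocity A q t)) = (\<lambda>h. h *\<^sub>R differential A f (q t) (velocity A q t))"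
    by (rule ext) (simp only: o_apply linear_cmul[OF lin] of_coords_to_coords[OF c])
  have "((\<lambda>x. f (chart_inv ?c x)) \<circ> (snd ?c \<circ> q) has_vector_derivative
     differential A f (q t) (velocity A q t)) (at t)"
    unfolding has_vector_derivative_def by (rule 1[unfolded 2])
  then show ?thesis
    by (rule has_vector_derivative_transform_within_open[OF _ smooth_curve_open[OF q(1,2) open_domain[OF c(1)]]])
       (use q c in \<open>auto simp: chart_inv_chart\<close>)
qed

section \<open>Connections\<close>

lemma smooth_fun_const: "open U \<Longrightarrow> smooth_fun A U (\<lambda>x. r)"
  by (simp add: smooth_fun_def o_def smooth_on_const)

lemma differential_const: "differential A (\<lambda>x. r) p v = 0"
proof -
  have "((\<lambda>x. r) \<circ> chart_inv (chart_at A p)) = (\<lambda>x. r)" by (simp add: o_def)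
  then show ?thesis by (simp add: differential_def)
qed

lemma smooth_vf_scale:
  assumes "smooth_fun A U f" "smooth_vf A U X"
  shows "smooth_vf A U (\<lambda>p. f p *\<^sub>R X p)"
  unfolding smooth_vf_def
proof (intro conjI ballI)
  show U: "open U" using assms by (simp add: smooth_fun_def)
  fix c assume c: "c \<in> A"
  have o: "open (snd c ` (U \<inter> fst c))"
    by (rule open_chart_image) (use c U in \<open>auto intro!: open_Int open_domain\<close>)
  have f: "smooth_on (snd c ` (U \<inter> fst c)) (\<lambda>x. f (chart_inv c x))"
    using assms(1) c by (simp add: smooth_fun_def o_def)
  have X: "smooth_on (snd c ` (U \<inter> fst c)) (\<lambda>x. to_coords A c (chart_inv c x) (X (chart_inv c x)))"
    using assms(2) c by (simp add: smooth_vf_def)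
  show "smooth_on (snd c ` (U \<inter> fst c))
      (\<lambda>x. to_coords A c (chart_inv c x) (f (chart_inv c x) *\<^sub>R X (chart_inv c x)))"
    by (rule smooth_on_cong[OF o, THEN iffD1, OF _ smooth_on_scaleR[OF o f X]])
       (use c in \<open>auto simp: chart_inv_chart linear_cmul[OF to_coords_linear]\<close>)
qed

lemma smooth_vf_add:
  assumes "smooth_vf A U X" "smooth_vf A U Y"
  shows "smooth_vf A U (\<lambda>p. X p + Y p)"
  unfolding smooth_vf_def
proof (intro conjI ballI)
  show U: "open U" using assms by (simp add: smooth_vf_def)
  fix c assume c: "c \<in> A"
  have o: "open (snd c ` (U \<inter> fst c))"
    by (rule open_chart_image) (use c U in \<open>auto intro!: open_Int open_domain\<close>)
  have X: "smooth_on (snd c ` (U \<inter> fst c)) (\<lambda>x. to_coords A c (chart_inv c x) (X (chart_inv c x)))"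
    using assms(1) c by (simp add: smooth_vf_def)
  have Y: "smooth_on (snd c ` (U \<inter> fst c)) (\<lambda>x. to_coords A c (chart_inv c x) (Y (chart_inv c x)))"
    using assms(2) c by (simp add: smooth_vf_def)
  show "smooth_on (snd c ` (U \<inter> fst c))
      (\<lambda>x. to_coords A c (chart_inv c x) (X (chart_inv c x) + Y (chart_inv c x)))"
    by (rule smooth_on_cong[OF o, THEN iffD1, OF _ smooth_on_add[OF o X Y]])
       (use c in \<open>auto simp: chart_inv_chart linear_add[OF to_coords_linear]\<close>)
qed

lemma smooth_vf_zero: "open U \<Longrightarrow> smooth_vf A U (\<lambda>p. 0)"
  unfolding smooth_vf_def
proof (intro conjI ballI)
  fix c assume U: "open U" and c: "c \<in> A"
  have o: "open (snd c ` (U \<inter> fst c))"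
    by (rule open_chart_image) (use c U in \<open>auto intro!: open_Int open_domain\<close>)
  show "smooth_on (snd c ` (U \<inter> fst c)) (\<lambda>x. to_coords A c (chart_inv c x) 0)"
    by (rule smooth_on_cong[OF o, THEN iffD1, OF _ smooth_on_const[of _ 0]])
       (use c in \<open>auto simp: chart_inv_chart linear_0[OF to_coords_linear]\<close>)
qed

lemma smooth_vf_sum:
  assumes "open U" "\<And>i. i \<in> F \<Longrightarrow> smooth_vf A U (X i)"
  shows "smooth_vf A U (\<lambda>p. \<Sum>i\<in>F. X i p)"
  using assms(2) by (induction F rule: infinite_finite_induct) (simp_all add: smooth_vf_zero assms(1) smooth_vf_add)

lemma
  assumes D: "affine_connection A D"
  shows conn_linear: "smooth_vf A U Y \<Longrightarrow> p \<in> U \<Longrightarrow> linear (\<lambda>v. D p v Y)"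
    and conn_add: "smooth_vf A U Y \<Longrightarrow> smooth_vf A U Z \<Longrightarrow> p \<in> U \<Longrightarrow> D p v (\<lambda>x. Y x + Z x) = D p v Y + D p v Z"
    and conn_scale: "smooth_fun A U f \<Longrightarrow> smooth_vf A U Y \<Longrightarrow> p \<in> U \<Longrightarrow>
        D p v (\<lambda>x. f x *\<^sub>R Y x) = differential A f p v *\<^sub>R Y p + f p *\<^sub>R D p v Y"
    and conn_smooth: "smooth_vf A U X \<Longrightarrow> smooth_vf A U Y \<Longrightarrow> smooth_vf A U (\<lambda>p. D p (X p) Y)"
  using assms unfolding affine_connection_def by simp_all

lemma conn_cong:
  assumes D: "affine_connection A D"
    and "smooth_vf A U Y" "smooth_vf A U Z" "p \<in> U" "\<And>x. x \<in> U \<Longrightarrow> Y x = Z x"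
  shows "D p v Y = D p v Z"
  by (rule D[unfolded affine_connection_def, THEN conjunct2, THEN conjunct2, THEN conjunct2,
      THEN conjunct1, rule_format, of U]) (use assms in simp)

lemma conn_zero:
  assumes D: "affine_connection A D" and U: "open U" "p \<in> U"
  shows "D p v (\<lambda>x. 0) = 0"
  using conn_scale[OF D smooth_fun_const[OF U(1), of 0] smooth_vf_zero[OF U(1)] U(2), of v]
  by (simp add: differential_const)

lemma conn_sum:
  assumes D: "affine_connection A D" and U: "open U" "p \<in> U"
    and Y: "\<And>i. i \<in> F \<Longrightarrow> smooth_vf A U (Y i)"
  shows "D p v (\<lambda>x. \<Sum>i\<in>F. Y i x) = (\<Sum>i\<in>F. D p v (Y i))"
  using Y
proof (induction F rule: infinite_finite_induct)
  case (insert i F)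
  have "D p v (\<lambda>x. Y i x + (\<Sum>i\<in>F. Y i x)) = D p v (Y i) + D p v (\<lambda>x. (\<Sum>i\<in>F. Y i x))"
    by (rule conn_add[OF D _ _ U(2)]) (use insert U in \<open>auto intro!: smooth_vf_sum\<close>)
  then show ?case using insert by simp
qed (simp_all add: conn_zero[OF D U])

text \<open>A connection acts on a field through its components in a coordinate frame. This is the Leibniz rule
  applied to each summand of the expansion.\<close>

lemma conn_frame:
  assumes D: "affine_connection A D" and c: "c \<in> A" and V: "V \<subseteq> fst c" "p \<in> V"
    and f: "\<And>b. b \<in> Basis \<Longrightarrow> smooth_fun A V (f b)" and Y: "smooth_vf A V Y"
    and eq: "\<And>x. x \<in> V \<Longrightarrow> Y x = (\<Sum>b\<in>Basis. f b x *\<^sub>R of_coords A c x b)"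
  shows "D p v Y = (\<Sum>b\<in>Basis. differential A (f b) p v *\<^sub>R of_coords A c p b) +
     (\<Sum>b\<in>Basis. f b p *\<^sub>R D p v (\<lambda>x. of_coords A c x b))"
proof -
  have o: "open V" using Y by (simp add: smooth_vf_def)
  have cf: "smooth_vf A V (\<lambda>x. of_coords A c x b)" for b
    by (rule smooth_vf_subset[OF smooth_vf_coord_field[OF c] o V(1)])
  have sm: "smooth_vf A V (\<lambda>x. f b x *\<^sub>R of_coords A c x b)" if "b \<in> Basis" for b
    by (rule smooth_vf_scale[OF f[OF that] cf])
  have "D p v Y = D p v (\<lambda>x. \<Sum>b\<in>Basis. f b x *\<^sub>R of_coords A c x b)"
    by (rule conn_cong[OF D Y smooth_vf_sum[OF o sm] V(2) eq])
  also have "\<dots> = (\<Sum>b\<in>Basis. D p v (\<lambda>x. f b x *\<^sub>R of_coords A c x b))"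
    by (rule conn_sum[OF D o V(2) sm])
  also have "\<dots> = (\<Sum>b\<in>Basis. differential A (f b) p v *\<^sub>R of_coords A c p b + f b p *\<^sub>R D p v (\<lambda>x. of_coords A c x b))"
    by (rule sum.cong[OF refl], rule conn_scale[OF D f cf V(2)])
  finally show ?thesis by (simp only: sum.distrib)
qed

lemma conn_coord_field:
  assumes D: "affine_connection A D" and c: "c \<in> A" "p \<in> fst c"
  shows "D p v (\<lambda>x. of_coords A c x w) = (\<Sum>b\<in>Basis. (w \<bullet> b) *\<^sub>R D p v (\<lambda>x. of_coords A c x b))"
proof -
  have "D p v (\<lambda>x. of_coords A c x w) = (\<Sum>b\<in>Basis. differential A (\<lambda>x. w \<bullet> b) p v *\<^sub>R of_coords A c p b) +
     (\<Sum>b\<in>Basis. (w \<bullet> b) *\<^sub>R D p v (\<lambda>x. of_coords A c x b))"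
    by (rule conn_frame[OF D c(1) order_refl c(2) smooth_fun_const[OF open_domain[OF c(1)]] smooth_vf_coord_field[OF c(1)]])
       (rule linear_expand[OF of_coords_linear[OF c(1)]])
  then show ?thesis by (simp add: differential_const)
qed

lemma vf_along_curve:
  assumes Y: "smooth_vf A U Y" "q t \<in> U" and q: "smooth_curve A I q" "open I" "t \<in> I"
    and c: "c \<in> A" "q t \<in> fst c"
  shows "(\<lambda>s. to_coords A c (q s) (Y (q s))) differentiable (at t)"
proof -
  let ?\<eta> = "\<lambda>x. to_coords A c (chart_inv c x) (Y (chart_inv c x))"
  have U: "open U" using Y(1) by (simp add: smooth_vf_def)
  have "smooth_on (snd c ` (U \<inter> fst c)) ?\<eta>" using Y(1) c by (simp add: smooth_vf_def)
  from smooth_on_has_derivative[OF this, of "snd c (q t)"]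
  have 1: "?\<eta> differentiable (at ((snd c \<circ> q) t))" using Y(2) c(2) by (auto simp: differentiable_def)
  have 2: "(snd c \<circ> q) differentiable (at t)"
    using velocity_coords[OF q c] differentiableI_vector by blast
  have "(?\<eta> \<circ> (snd c \<circ> q)) differentiable (at t)" by (rule differentiable_chain_at[OF 2 1])
  then obtain D' where "((?\<eta> \<circ> (snd c \<circ> q)) has_derivative D') (at t)" unfolding differentiable_def ..
  then have "((\<lambda>s. to_coords A c (q s) (Y (q s))) has_derivative D') (at t)"
    by (rule has_derivative_transform_within_open[OF _ smooth_curve_open[OF q(1,2) open_domain[OF c(1)]]])
       (use q c in \<open>auto simp: chart_inv_chart\<close>)
  then show ?thesis by (rule differentiableI)
qed

text \<open>The derivative of a field in the direction of the velocity of a curve depends only on the values of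
  the field along the curve: the differentials of the components in \<open>conn_frame\<close> are derivatives
  along the curve, and the other terms involve the value at the point alone.\<close>

lemma connection_along_curve:
  assumes D: "affine_connection A D" and Y: "smooth_vf A U Y" "q t \<in> U"
    and q: "smooth_curve A I q" "open I" "t \<in> I" and c: "c \<in> A" "q t \<in> fst c"
  shows "D (q t) (velocity A q t) Y =
    of_coords A c (q t) (vector_derivative (\<lambda>s. to_coords A c (q s) (Y (q s))) (at t)) +
    D (q t) (velocity A q t) (\<lambda>p. of_coords A c p (to_coords A c (q t) (Y (q t))))"
proof -
  let ?v = "velocity A q t" and ?\<eta> = "\<lambda>s. to_coords A c (q s) (Y (q s))"
  let ?V = "U \<inter> fst c"
  define f where "f b p = to_coords A c p (Y p) \<bullet> b" for b p
  have U: "open U" using Y(1) by (simp add: smooth_vf_def)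
  have V: "open ?V" using U c by (intro open_Int open_domain)
  have oV: "open (snd c ` ?V)" by (rule open_chart_image[OF c(1) V]) simp
  have sf: "smooth_fun A ?V (f b)" for b
  proof (subst smooth_fun_chart[OF c(1) V])
    show "smooth_on (snd c ` ?V) (\<lambda>x. f b (chart_inv c x))"
      unfolding f_def
      by (rule smooth_on_inner[OF oV _ smooth_on_const]) (use Y(1) c in \<open>simp add: smooth_vf_def\<close>)
  qed simp
  have d: "(?\<eta> has_vector_derivative vector_derivative ?\<eta> (at t)) (at t)"
    using vf_along_curve[OF Y q c] vector_derivative_works by blast
  have df: "differential A (f b) (q t) ?v = vector_derivative ?\<eta> (at t) \<bullet> b" for b
  proof -
    have 1: "((\<lambda>s. f b (q s)) has_vector_derivative differential A (f b) (q t) ?v) (at t)"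
      by (rule differential_curve[OF sf _ q]) (use Y c in auto)
    have 2: "((\<lambda>s. f b (q s)) has_vector_derivative (vector_derivative ?\<eta> (at t) \<bullet> b)) (at t)"
      unfolding f_def
      by (rule bounded_linear.has_vector_derivative[OF bounded_linear_inner_left d])
    show ?thesis using vector_derivative_at[OF 1] vector_derivative_at[OF 2] by simp
  qed
  have "D (q t) ?v Y = (\<Sum>b\<in>Basis. differential A (f b) (q t) ?v *\<^sub>R of_coords A c (q t) b) +
     (\<Sum>b\<in>Basis. f b (q t) *\<^sub>R D (q t) ?v (\<lambda>x. of_coords A c x b))"
  proof (rule conn_frame[OF D c(1) _ _ sf smooth_vf_subset[OF Y(1) V]])
    show "Y x = (\<Sum>b\<in>Basis. f b x *\<^sub>R of_coords A c x b)" if "x \<in> ?V" for x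
      using linear_expand[OF of_coords_linear[OF c(1)], of x "to_coords A c x (Y x)"]
        of_coords_to_coords[OF c(1), of x "Y x"] that by (simp add: f_def)
  qed (use Y c in auto)
  also have "(\<Sum>b\<in>Basis. differential A (f b) (q t) ?v *\<^sub>R of_coords A c (q t) b) =
      of_coords A c (q t) (vector_derivative ?\<eta> (at t))"
    unfolding df by (rule linear_expand[OF of_coords_linear[OF c], symmetric])
  also have "(\<Sum>b\<in>Basis. f b (q t) *\<^sub>R D (q t) ?v (\<lambda>x. of_coords A c x b)) =
      D (q t) ?v (\<lambda>p. of_coords A c p (to_coords A c (q t) (Y (q t))))"
    unfolding f_def by (rule conn_coord_field[OF D c, symmetric])
  finally show ?thesis .
qed

lemma smooth_curve_coords_open:
  assumes q: "smooth_curve A I q" "open I" and c: "c \<in> A"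
  shows "open {s \<in> I. q s \<in> fst c}"
  by (rule smooth_curve_open[OF q open_domain[OF c]])

lemma smooth_curve_second_derivative:
  assumes q: "smooth_curve A I q" "open I" "t \<in> I" and c: "c \<in> A" "q t \<in> fst c"
  shows "((\<lambda>s. to_coords A c (q s) (velocity A q s)) has_vector_derivative
    vector_derivative (\<lambda>s. vector_derivative (snd c \<circ> q) (at s)) (at t)) (at t)"
proof -
  let ?J = "{s \<in> I. q s \<in> fst c}"
  have o: "open ?J" by (rule smooth_curve_coords_open[OF q(1,2) c(1)])
  have "smooth_on ?J (\<lambda>s. vector_derivative (snd c \<circ> q) (at s))"
    by (rule smooth_on_vector_derivative[OF smooth_curve_in_chart[OF q(1) c(1)] o])
  from smooth_on_has_vector_derivative[OF this]
  have "((\<lambda>s. vector_derivative (snd c \<circ> q) (at s)) has_vector_derivative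
    vector_derivative (\<lambda>s. vector_derivative (snd c \<circ> q) (at s)) (at t)) (at t)" using q c by simp
  then show ?thesis
  proof (rule has_vector_derivative_transform_within_open[OF _ o])
    show "vector_derivative (snd c \<circ> q) (at s) = to_coords A c (q s) (velocity A q s)" if "s \<in> ?J" for s
      by (rule vector_derivative_at[OF velocity_coords[OF q(1,2) _ c(1)]]) (use that in auto)
  qed (use q c in auto)
qed

text \<open>Let \<open>x1\<close> and \<open>y1\<close> be the velocity components in the two charts and \<open>M s\<close> the derivative of the
  transition map at \<open>q s\<close>, so that \<open>x1 s = M s (y1 s)\<close>. By the product rule \<open>x1'\<close> exceeds \<open>M t (y1')\<close> by
  the derivative of \<open>M s w\<close> with \<open>w = y1 t\<close> held fixed. The same term appears when the connection is
  applied to the field with the constant components \<open>w\<close> in the second chart and this field is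
  expressed in the first one.\<close>

lemma cov_deriv_velocity_chart:
  assumes D: "affine_connection A D" and q: "smooth_curve A I q" "open I" "t \<in> I"
    and c: "c \<in> A" "q t \<in> fst c" and c': "c' \<in> A" "q t \<in> fst c'"
  shows "cov_deriv_in A c' D q (velocity A q) t = cov_deriv_in A c D q (velocity A q) t"
proof -
  define p where "p = q t"
  define v where "v = velocity A q t"
  define x1 where "x1 s = to_coords A c (q s) (velocity A q s)" for s
  define y1 where "y1 s = to_coords A c' (q s) (velocity A q s)" for s
  define M where "M s w = to_coords A c (q s) (of_coords A c' (q s) w)" for s w
  define N where "N w = vector_derivative (\<lambda>s. M s w) (at t)" for w
  let ?J = "{s \<in> I. q s \<in> fst c} \<inter> {s \<in> I. q s \<in> fst c'}"
  have J: "open ?J" by (intro open_Int smooth_curve_coords_open q c c')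
  have tJ: "t \<in> ?J" using q c c' by simp
  have linM: "linear (M s)" if "s \<in> ?J" for s
    unfolding M_def[abs_def]
    using linear_compose[OF of_coords_linear[OF c'(1)] to_coords_linear[OF c(1)], of "q s" "q s"] that
    by (simp add: o_def)
  have dM: "((\<lambda>s. M s w) has_vector_derivative N w) (at t)" for w
    unfolding M_def N_def
    by (rule vf_along_curve[OF smooth_vf_coord_field[OF c'(1)] c'(2) q c, unfolded vector_derivative_works])
  have dy: "(y1 has_vector_derivative vector_derivative y1 (at t)) (at t)"
    unfolding y1_def[abs_def]
    by (rule differentiableI_vector[OF smooth_curve_second_derivative[OF q c'], unfolded vector_derivative_works])
  have xM: "x1 s = (\<Sum>b\<in>Basis. (y1 s \<bullet> b) *\<^sub>R M s b)" if "s \<in> ?J" for s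
  proof -
    have "x1 s = M s (y1 s)"
      using that c'(1) by (simp add: x1_def M_def y1_def of_coords_to_coords)
    then show ?thesis by (rule trans[OF _ linear_expand[OF linM[OF that]]])
  qed
  have "((\<lambda>s. \<Sum>b\<in>Basis. (y1 s \<bullet> b) *\<^sub>R M s b) has_vector_derivative
      (\<Sum>b\<in>Basis. (y1 t \<bullet> b) *\<^sub>R N b + (vector_derivative y1 (at t) \<bullet> b) *\<^sub>R M t b)) (at t)"
  proof (rule has_vector_derivative_sum)
    fix b
    have "((\<lambda>s. y1 s \<bullet> b) has_field_derivative (vector_derivative y1 (at t) \<bullet> b)) (at t)"
      unfolding has_real_derivative_iff_has_vector_derivative
      by (rule bounded_linear.has_vector_derivative[OF bounded_linear_inner_left dy])
    from has_vector_derivative_scaleR[OF this dM]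
    show "((\<lambda>s. (y1 s \<bullet> b) *\<^sub>R M s b) has_vector_derivative
       (y1 t \<bullet> b) *\<^sub>R N b + (vector_derivative y1 (at t) \<bullet> b) *\<^sub>R M t b) (at t)" .
  qed
  then have "(x1 has_vector_derivative
      (\<Sum>b\<in>Basis. (y1 t \<bullet> b) *\<^sub>R N b + (vector_derivative y1 (at t) \<bullet> b) *\<^sub>R M t b)) (at t)"
    by (rule has_vector_derivative_transform_within_open[OF _ J tJ]) (simp only: xM)
  from vector_derivative_at[OF this]
  have dx: "vector_derivative x1 (at t) = (\<Sum>b\<in>Basis. (y1 t \<bullet> b) *\<^sub>R N b) + M t (vector_derivative y1 (at t))"
    by (simp only: sum.distrib linear_expand[OF linM[OF tJ], symmetric])
  have N: "N (y1 t) = (\<Sum>b\<in>Basis. (y1 t \<bullet> b) *\<^sub>R N b)"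
  proof -
    have "((\<lambda>s. \<Sum>b\<in>Basis. (y1 t \<bullet> b) *\<^sub>R M s b) has_vector_derivative
       (\<Sum>b\<in>Basis. (y1 t \<bullet> b) *\<^sub>R N b)) (at t)"
      by (intro has_vector_derivative_sum bounded_linear.has_vector_derivative[OF bounded_linear_scaleR_right dM])
    then have "((\<lambda>s. M s (y1 t)) has_vector_derivative (\<Sum>b\<in>Basis. (y1 t \<bullet> b) *\<^sub>R N b)) (at t)"
      by (rule has_vector_derivative_transform_within_open[OF _ J tJ])
         (simp only: linear_expand[OF linM, symmetric])
    from vector_derivative_at[OF this] show ?thesis by (simp only: N_def)
  qed
  have "cov_deriv_in A c' D q (velocity A q) t =
     of_coords A c' p (vector_derivative y1 (at t)) + D p v (\<lambda>p. of_coords A c' p (y1 t))"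
    by (simp add: cov_deriv_in_def p_def v_def y1_def[abs_def])
  also have "D p v (\<lambda>p. of_coords A c' p (y1 t)) =
     of_coords A c p (N (y1 t)) + D p v (\<lambda>z. of_coords A c z (M t (y1 t)))"
    using connection_along_curve[OF D smooth_vf_coord_field[OF c'(1)] c'(2) q c, of "y1 t"]
    by (simp add: p_def v_def N_def M_def)
  also have "of_coords A c' p (vector_derivative y1 (at t)) =
     of_coords A c p (M t (vector_derivative y1 (at t)))"
    using of_coords_to_coords[OF c] by (simp add: M_def p_def)
  also have "M t (y1 t) = x1 t"
    using c' by (simp add: x1_def M_def y1_def of_coords_to_coords)
  finally have "cov_deriv_in A c' D q (velocity A q) t =
     of_coords A c p (M t (vector_derivative y1 (at t))) + (of_coords A c p (N (y1 t)) +
     D p v (\<lambda>z. of_coords A c z (x1 t)))" .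
  also have "\<dots> = of_coords A c p (vector_derivative x1 (at t)) + D p v (\<lambda>z. of_coords A c z (x1 t))"
    using linear_add[OF of_coords_linear[OF c]] by (simp add: dx N p_def)
  also have "\<dots> = cov_deriv_in A c D q (velocity A q) t"
    by (simp add: cov_deriv_in_def p_def v_def x1_def[abs_def])
  finally show ?thesis .
qed

end

section \<open>Locality and translation in time\<close>

lemma vector_derivative_local:
  assumes "open J" "t \<in> J" "\<And>s. s \<in> J \<Longrightarrow> f s = g s"
  shows "vector_derivative f (at t) = vector_derivative g (at t)"
  by (rule vector_derivative_cong_eq)
     (use assms in \<open>auto simp: eventually_nhds\<close>)

lemma velocity_local:
  assumes "open J" "t \<in> J" "\<And>s. s \<in> J \<Longrightarrow> q s = q' s"
  shows "velocity A q t = velocity A q' t"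
  unfolding velocity_def using assms(3)[OF assms(2)]
  by (auto intro!: vector_derivative_local[OF assms(1,2)] simp: assms(3))

lemma acceleration_local:
  assumes "open J" "t \<in> J" "\<And>s. s \<in> J \<Longrightarrow> q s = q' s"
  shows "acceleration L q t = acceleration L q' t"
proof -
  let ?A = "atlas L" and ?c = "chart_at (atlas L) (q' t)"
  have v: "velocity ?A q s = velocity ?A q' s" if "s \<in> J" for s
    by (rule velocity_local[OF assms(1) that assms(3)])
  have "vector_derivative (\<lambda>s. to_coords ?A ?c (q s) (velocity ?A q s)) (at t) =
      vector_derivative (\<lambda>s. to_coords ?A ?c (q' s) (velocity ?A q' s)) (at t)"
    by (rule vector_derivative_local[OF assms(1,2)]) (simp add: assms(3) v)
  then show ?thesis
    by (simp add: acceleration_def cov_deriv_in_def assms(3)[OF assms(2)] v[OF assms(2)])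
qed

lemma has_vector_derivative_translate:
  "(f has_vector_derivative D) (at (t + a)) \<longleftrightarrow> ((\<lambda>s. f (s + a)) has_vector_derivative D) (at (t::real))"
proof -
  have *: "((\<lambda>s. f (s + a)) has_vector_derivative D) (at t)"
    if "(f has_vector_derivative D) (at (t + a))" for f and a t :: real
  proof -
    have "((\<lambda>s. s + a) has_vector_derivative 1) (at t)"
      by (auto intro!: derivative_eq_intros)
    from vector_diff_chain_at[OF this that] show ?thesis by (simp add: o_def)
  qed
  show ?thesis using *[of f t a] *[of "\<lambda>s. f (s + a)" "t + a" "- a"] by auto
qed

lemma vector_derivative_translate:
  "vector_derivative (\<lambda>s. f (s + a)) (at t) = vector_derivative f (at (t + a))"
  by (simp add: vector_derivative_def has_vector_derivative_translate)

lemma velocity_translate: "velocity A (\<lambda>s. q (s + a)) t = velocity A q (t + a)"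
  using vector_derivative_translate[of "snd (chart_at A (q (t + a))) \<circ> q" a t]
  by (simp add: velocity_def o_def)

lemma acceleration_translate: "acceleration L (\<lambda>s. q (s + a)) t = acceleration L q (t + a)"
  using vector_derivative_translate[of "\<lambda>s. to_coords (atlas L) (chart_at (atlas L) (q (t + a))) (q s)
      (velocity (atlas L) q s)" a t]
  by (simp add: acceleration_def cov_deriv_in_def velocity_translate[of "atlas L" q a])

lemma smooth_on_translate:
  fixes f :: "real \<Rightarrow> 'a::euclidean_space"
  assumes "open J" "smooth_on J f"
  shows "smooth_on {s. s + a \<in> J} (\<lambda>s. f (s + a))"
proof -
  have o: "open {s. s + a \<in> J}"
    using open_vimage[OF assms(1), of "\<lambda>s. s + a"] by (simp add: vimage_def continuous_on_add)
  have "smooth_on {s. s + a \<in> J} (f \<circ> (\<lambda>s. s + a))"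
    by (rule smooth_on_compose[OF o smooth_on_add[OF o smooth_on_id smooth_on_const] assms(2)]) auto
  then show ?thesis by (simp add: o_def)
qed

context smooth_manifold
begin

lemma smooth_curve_local:
  assumes "\<And>t. t \<in> I \<Longrightarrow> \<exists>J q'. open J \<and> t \<in> J \<and> smooth_curve A J q' \<and> (\<forall>s\<in>J. q' s = q s)"
  shows "smooth_curve A I q"
proof (rule smooth_curveI)
  fix t assume "t \<in> I"
  then obtain J q' where J: "open J" "t \<in> J" "smooth_curve A J q'" "\<forall>s\<in>J. q' s = q s" using assms by blast
  let ?c = "chart_at A (q t)"
  let ?J = "{s \<in> J. q' s \<in> fst ?c}"
  have o: "open ?J" by (rule smooth_curve_coords_open[OF J(3,1) chart_at(1)])
  moreover have "t \<in> ?J" using J chart_at by simp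
  moreover have "q ` ?J \<subseteq> fst ?c" using J(4) by auto
  moreover have "smooth_on ?J (snd ?c \<circ> q)"
    by (rule smooth_on_cong[OF o, THEN iffD1, OF _ smooth_curve_in_chart[OF J(3) chart_at(1)]])
       (use J(4) in auto)
  ultimately show "\<exists>c\<in>A. \<exists>J. open J \<and> t \<in> J \<and> q ` J \<subseteq> fst c \<and> smooth_on J (snd c \<circ> q)"
    using chart_at(1) by auto
qed

lemma smooth_curve_translate:
  assumes q: "smooth_curve A J q" "open J"
  shows "smooth_curve A {s. s + a \<in> J} (\<lambda>s. q (s + a))"
proof (rule smooth_curveI)
  fix t assume t: "t \<in> {s. s + a \<in> J}"
  let ?c = "chart_at A (q (t + a))"
  let ?J = "{s \<in> J. q s \<in> fst ?c}"
  have o: "open ?J" by (rule smooth_curve_coords_open[OF q chart_at(1)])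
  have "open {s. s + a \<in> ?J}"
    using open_vimage[OF o, of "\<lambda>s. s + a"] by (simp add: vimage_def continuous_on_add)
  moreover have "t \<in> {s. s + a \<in> ?J}" using t chart_at by simp
  moreover have "(\<lambda>s. q (s + a)) ` {s. s + a \<in> ?J} \<subseteq> fst ?c" by auto
  moreover have "smooth_on {s. s + a \<in> ?J} (snd ?c \<circ> (\<lambda>s. q (s + a)))"
    using smooth_on_translate[OF o smooth_curve_in_chart[OF q(1) chart_at(1)], of a] by (simp add: o_def)
  ultimately show "\<exists>c\<in>A. \<exists>K. open K \<and> t \<in> K \<and> (\<lambda>s. q (s + a)) ` K \<subseteq> fst c \<and>
      smooth_on K (snd c \<circ> (\<lambda>s. q (s + a)))"
    using chart_at(1) by blast
qed

end

section \<open>Integral curves and their maximal extensions\<close>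

locale lagrangian_system =
  fixes L :: "('q::{t2_space,second_countable_topology}, 'e::euclidean_space) control_system"
  assumes lcs: "lagrangian_control_system L"

sublocale lagrangian_system \<subseteq> smooth_manifold "atlas L"
  by (unfold_locales) (use lcs in \<open>simp add: lagrangian_control_system_def\<close>)

context lagrangian_system
begin

lemma base_integral_curve_local:
  assumes I: "open_interval I"
    and loc: "\<And>t. t \<in> I \<Longrightarrow> \<exists>J q'. t \<in> J \<and> base_integral_curve L \<tau> J q' \<and> (\<forall>s\<in>J. q' s = q s)"
  shows "base_integral_curve L \<tau> I q"
  unfolding base_integral_curve_def
proof (intro conjI ballI I)
  show "smooth_curve (atlas L) I q"
  proof (rule smooth_curve_local)
    fix t assume "t \<in> I"
    from loc[OF this] obtain J q' where J: "t \<in> J" "base_integral_curve L \<tau> J q'" "\<forall>s\<in>J. q' s = q s"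
      by auto
    from J(2) have "open J" "smooth_curve (atlas L) J q'"
      by (simp_all add: base_integral_curve_def open_interval_def)
    with J show "\<exists>J q'. open J \<and> t \<in> J \<and> smooth_curve (atlas L) J q' \<and> (\<forall>s\<in>J. q' s = q s)"
      by (intro exI[of _ J] exI[of _ q']) simp
  qed
  fix t assume "t \<in> I"
  then obtain J q' where J: "t \<in> J" "base_integral_curve L \<tau> J q'" "\<And>s. s \<in> J \<Longrightarrow> q' s = q s"
    using loc[of t] by auto
  then have o: "open J" by (simp add: base_integral_curve_def open_interval_def)
  have "acceleration L q' t = - grad_potential L (q' t) +
        (\<Sum>i<num_forces L. \<tau> i (q' t) (velocity (atlas L) q' t) *\<^sub>R sharp L (q' t) (force L i (q' t)))"
    using J(1,2) by (simp add: base_integral_curve_def)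
  then show "acceleration L q t = - grad_potential L (q t) +
        (\<Sum>i<num_forces L. \<tau> i (q t) (velocity (atlas L) q t) *\<^sub>R sharp L (q t) (force L i (q t)))"
    using acceleration_local[OF o J(1,3), where L = L] velocity_local[OF o J(1,3), where A = "atlas L"] J(1,3) by simp
qed

text \<open>The equation of motion does not involve time explicitly. Invariance of \<open>TC\<close> is a statement about
  curves that start at time zero, and translation carries it to other times.\<close>

lemma base_integral_curve_translate:
  assumes "base_integral_curve L \<tau> J q"
  shows "base_integral_curve L \<tau> {s. s + a \<in> J} (\<lambda>s. q (s + a))"
proof -
  have J: "open J" "is_interval J" "J \<noteq> {}" and q: "smooth_curve (atlas L) J q"
    using assms by (auto simp: base_integral_curve_def open_interval_def)
  have "open {s. s + a \<in> J}"
    using open_vimage[OF J(1), of "\<lambda>s. s + a"] by (simp add: vimage_def continuous_on_add)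
  moreover have "is_interval {s. s + a \<in> J}"
    unfolding is_interval_1
  proof (intro ballI allI impI)
    fix x y z assume "x \<in> {s. s + a \<in> J}" "y \<in> {s. s + a \<in> J}" "x \<le> z \<and> z \<le> y"
    then show "z \<in> {s. s + a \<in> J}"
      using J(2)[unfolded is_interval_1, THEN bspec[of _ _ "x + a"], THEN bspec[of _ _ "y + a"],
        THEN spec[of _ "z + a"]] by simp
  qed
  moreover have "{s. s + a \<in> J} \<noteq> {}"
  proof -
    obtain t where "t \<in> J" using J(3) by blast
    then have "t - a \<in> {s. s + a \<in> J}" by simp
    then show ?thesis by blast
  qed
  ultimately show ?thesis
    using assms smooth_curve_translate[OF q J(1), of a]
    by (simp add: base_integral_curve_def open_interval_def acceleration_translate[of L q a]
        velocity_translate[of "atlas L" q a])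
qed

lemma maximal_base_integral_curve_translate:
  assumes "maximal_base_integral_curve L \<tau> J q"
  shows "maximal_base_integral_curve L \<tau> {s. s + a \<in> J} (\<lambda>s. q (s + a))"
  unfolding maximal_base_integral_curve_def
proof (intro conjI notI)
  have b: "base_integral_curve L \<tau> J q" using assms by (simp add: maximal_base_integral_curve_def)
  from base_integral_curve_translate[OF b, of a]
  show "base_integral_curve L \<tau> {s. s + a \<in> J} (\<lambda>s. q (s + a))" .
  assume "\<exists>K q'. {s. s + a \<in> J} \<subset> K \<and> base_integral_curve L \<tau> K q' \<and> (\<forall>t\<in>{s. s + a \<in> J}. q' t = q (t + a))"
  then obtain K q' where K: "{s. s + a \<in> J} \<subset> K" "base_integral_curve L \<tau> K q'"
    "\<forall>t\<in>{s. s + a \<in> J}. q' t = q (t + a)" by (elim exE conjE)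
  let ?K = "{s. s + - a \<in> K}" and ?q = "\<lambda>s. q' (s + - a)"
  have "base_integral_curve L \<tau> ?K ?q" by (rule base_integral_curve_translate[OF K(2)])
  moreover have "J \<subset> ?K"
  proof -
    obtain t where "t \<in> K" "t + a \<notin> J" using K(1) by blast
    then have "t + a \<in> ?K" "t + a \<notin> J" by simp_all
    moreover have "J \<subseteq> ?K"
    proof
      fix t assume "t \<in> J"
      then have "t + - a \<in> {s. s + a \<in> J}" by simp
      then show "t \<in> ?K" using psubset_imp_subset[OF K(1)] by auto
    qed
    ultimately show ?thesis by blast
  qed
  moreover have "\<forall>t\<in>J. ?q t = q t"
  proof
    fix t assume "t \<in> J"
    then show "?q t = q t" using bspec[OF K(3), of "t + - a"] by simp
  qed
  ultimately have "\<exists>K q'. J \<subset> K \<and> base_integral_curve L \<tau> K q' \<and> (\<forall>t\<in>J. q' t = q t)"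
    by (intro exI[of _ ?K] exI[of _ ?q] conjI)
  moreover have "\<not> (\<exists>K q'. J \<subset> K \<and> base_integral_curve L \<tau> K q' \<and> (\<forall>t\<in>J. q' t = q t))"
    using assms unfolding maximal_base_integral_curve_def by (rule conjunct2)
  ultimately show False by contradiction
qed

lemma is_interval_mem: "is_interval J \<Longrightarrow> a \<in> J \<Longrightarrow> b \<in> J \<Longrightarrow> a \<le> x \<Longrightarrow> x \<le> b \<Longrightarrow> x \<in> J" for J :: "real set"
  unfolding is_interval_1 by blast

text \<open>Zorn's lemma on the graphs of the integral curves that extend the given one. The union of a chain of
  graphs is again a graph; its domain is an open interval because the domains are nested.\<close>

lemma maximal_extension:
  assumes "base_integral_curve L \<tau> I q"
  shows "\<exists>J q'. I \<subseteq> J \<and> maximal_base_integral_curve L \<tau> J q' \<and> (\<forall>t\<in>I. q' t = q t)"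
proof -
  define gr where "gr J q = (\<lambda>t. (t, q t)) ` J" for J :: "real set" and q :: "real \<Rightarrow> 'q"
  have gr_mem: "(t, y) \<in> gr J q \<longleftrightarrow> t \<in> J \<and> q t = y" for J q t y
    unfolding gr_def by auto
  have gr_sub: "gr J q \<subseteq> gr K r \<longleftrightarrow> J \<subseteq> K \<and> (\<forall>t\<in>J. r t = q t)" for J K q r
  proof -
    have "gr J q \<subseteq> gr K r \<longleftrightarrow> (\<forall>t\<in>J. (t, q t) \<in> gr K r)"
      unfolding gr_def[of J q] by (rule image_subset_iff)
    then show ?thesis unfolding gr_mem by (auto simp only: subset_iff Ball_def)
  qed
  define \<A> where "\<A> = {gr J r |J r. base_integral_curve L \<tau> J r \<and> gr I q \<subseteq> gr J r}"
  have \<A>_I: "gr J r \<in> \<A>" if "base_integral_curve L \<tau> J r" "gr I q \<subseteq> gr J r" for J r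
    unfolding \<A>_def using that by (intro CollectI exI[of _ J] exI[of _ r] conjI refl)
  have \<A>_E: "\<exists>J r. X = gr J r \<and> base_integral_curve L \<tau> J r \<and> gr I q \<subseteq> gr J r" if "X \<in> \<A>" for X
    using that unfolding \<A>_def by (rule CollectD)
  have "\<exists>M\<in>\<A>. \<forall>X\<in>\<A>. M \<subseteq> X \<longrightarrow> X = M"
  proof (rule subset_Zorn_nonempty)
    show "\<A> \<noteq> {}" using \<A>_I[OF assms order_refl] by auto
    fix \<C> assume ne: "\<C> \<noteq> {}" and ch: "subset.chain \<A> \<C>"
    have mem: "\<exists>J r. X = gr J r \<and> base_integral_curve L \<tau> J r \<and> gr I q \<subseteq> gr J r" if "X \<in> \<C>" for X
      using \<A>_E that ch unfolding subset.chain_def by auto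
    have cmp: "X \<subseteq> Y \<or> Y \<subseteq> X" if "X \<in> \<C>" "Y \<in> \<C>" for X Y
      using that ch unfolding subset.chain_def by blast
    define K where "K = fst ` \<Union>\<C>"
    define r where "r t = (SOME y. (t, y) \<in> \<Union>\<C>)" for t
    \<comment> \<open>Two graphs of the chain are nested, so together they assign one value to each time.\<close>
    have uniq: "y = y'" if yy: "(t, y) \<in> \<Union>\<C>" "(t, y') \<in> \<Union>\<C>" for t y y'
    proof -
      obtain X Y where X: "X \<in> \<C>" "(t, y) \<in> X" and Y: "Y \<in> \<C>" "(t, y') \<in> Y" using yy by blast
      obtain Z where "Z \<in> \<C>" "(t, y) \<in> Z" "(t, y') \<in> Z" using cmp[OF X(1) Y(1)] X Y by blast
      moreover obtain J s where "Z = gr J s" using mem[OF \<open>Z \<in> \<C>\<close>] by auto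
      ultimately show ?thesis by (simp add: gr_mem)
    qed
    have r: "r t = y" if "(t, y) \<in> \<Union>\<C>" for t y
      unfolding r_def by (rule some_equality[where P = "\<lambda>y. (t, y) \<in> \<Union>\<C>", OF that]) (rule uniq[OF _ that])
    have U: "\<Union>\<C> = gr K r"
    proof
      show "\<Union>\<C> \<subseteq> gr K r"
      proof
        fix z assume z: "z \<in> \<Union>\<C>"
        then have "fst z \<in> K" by (simp add: K_def)
        moreover have "z = (fst z, r (fst z))" using r[of "fst z" "snd z"] z by simp
        ultimately show "z \<in> gr K r" by (metis gr_mem)
      qed
      show "gr K r \<subseteq> \<Union>\<C>"
      proof
        fix z assume "z \<in> gr K r"
        then obtain t where t: "t \<in> K" "z = (t, r t)" unfolding gr_def by auto
        then obtain y where "(t, y) \<in> \<Union>\<C>" unfolding K_def by force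
        then show "z \<in> \<Union>\<C>" using r t by metis
      qed
    qed
    have inK: "\<exists>J s. t \<in> J \<and> J \<subseteq> K \<and> base_integral_curve L \<tau> J s \<and> (\<forall>u\<in>J. s u = r u) \<and> gr J s \<in> \<C>" if "t \<in> K" for t
    proof -
      obtain X y where X: "X \<in> \<C>" "(t, y) \<in> X" using \<open>t \<in> K\<close> unfolding K_def by force
      obtain J s where J: "X = gr J s" "base_integral_curve L \<tau> J s" using mem[OF X(1)] by auto
      have "gr J s \<subseteq> gr K r" using X(1) J(1) U by blast
      then have "J \<subseteq> K" "\<forall>u\<in>J. s u = r u" unfolding gr_sub by auto
      moreover have "t \<in> J" using X(2) J(1) by (simp add: gr_mem)
      ultimately show ?thesis using J X(1) by auto
    qed
    have gIK: "gr I q \<subseteq> gr K r"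
    proof -
      obtain X where X: "X \<in> \<C>" using ne by blast
      then have "gr I q \<subseteq> X" using mem[OF X] by auto
      also have "X \<subseteq> \<Union>\<C>" using X by auto
      finally show ?thesis using U by simp
    qed
    have "open K"
    proof (subst open_subopen, intro ballI)
      fix t assume "t \<in> K"
      from inK[OF this] obtain J s where "t \<in> J" "J \<subseteq> K" "base_integral_curve L \<tau> J s" by auto
      then show "\<exists>T. open T \<and> t \<in> T \<and> T \<subseteq> K"
        by (intro exI[of _ J]) (simp add: base_integral_curve_def open_interval_def)
    qed
    moreover have "is_interval K"
      unfolding is_interval_1
    proof (intro ballI allI impI)
      fix a b x assume ab: "a \<in> K" "b \<in> K" "a \<le> x \<and> x \<le> b"
      obtain Ja sa where Ja: "a \<in> Ja" "Ja \<subseteq> K" "base_integral_curve L \<tau> Ja sa" "gr Ja sa \<in> \<C>"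
        using inK[OF ab(1)] by auto
      obtain Jb sb where Jb: "b \<in> Jb" "Jb \<subseteq> K" "base_integral_curve L \<tau> Jb sb" "gr Jb sb \<in> \<C>"
        using inK[OF ab(2)] by auto
      have "Ja \<subseteq> Jb \<or> Jb \<subseteq> Ja" using cmp[OF Ja(4) Jb(4)] unfolding gr_sub
        by (rule disj_forward) (erule conjunct1)+
      moreover have "is_interval Ja" "is_interval Jb"
        using Ja(3) Jb(3) by (simp_all add: base_integral_curve_def open_interval_def)
      ultimately show "x \<in> K"
      proof (elim disjE)
        assume "Ja \<subseteq> Jb"
        then have "a \<in> Jb" using Ja(1) by auto
        then have "x \<in> Jb" using Jb(1) ab(3) is_interval_mem[OF \<open>is_interval Jb\<close>] by blast
        then show ?thesis using Jb(2) by auto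
      next
        assume "Jb \<subseteq> Ja"
        then have "b \<in> Ja" using Jb(1) by auto
        then have "x \<in> Ja" using Ja(1) ab(3) is_interval_mem[OF \<open>is_interval Ja\<close>] by blast
        then show ?thesis using Ja(2) by auto
      qed
    qed
    moreover have "K \<noteq> {}"
    proof -
      have "I \<subseteq> K" using gIK gr_sub by simp
      moreover have "I \<noteq> {}" using assms by (simp add: base_integral_curve_def open_interval_def)
      ultimately show ?thesis by auto
    qed
    ultimately have "open_interval K" by (simp add: open_interval_def)
    then have "base_integral_curve L \<tau> K r"
    proof (rule base_integral_curve_local)
      fix t assume "t \<in> K"
      from inK[OF this] show "\<exists>J s. t \<in> J \<and> base_integral_curve L \<tau> J s \<and> (\<forall>u\<in>J. s u = r u)" by auto
    qed
    then show "\<Union>\<C> \<in> \<A>" using \<A>_I[OF _ gIK] U by simp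
  qed
  then obtain M where M: "M \<in> \<A>" and max: "\<forall>X\<in>\<A>. M \<subseteq> X \<longrightarrow> X = M" by (elim bexE)
  obtain J r where J: "M = gr J r" "base_integral_curve L \<tau> J r" "gr I q \<subseteq> gr J r"
    using \<A>_E[OF M] by (elim exE conjE)
  have "maximal_base_integral_curve L \<tau> J r"
    unfolding maximal_base_integral_curve_def
  proof (intro conjI J(2) notI)
    assume "\<exists>K s. J \<subset> K \<and> base_integral_curve L \<tau> K s \<and> (\<forall>t\<in>J. s t = r t)"
    then obtain K s where K: "J \<subset> K" "base_integral_curve L \<tau> K s" "\<forall>t\<in>J. s t = r t"
      by (elim exE conjE)
    have sub: "gr J r \<subseteq> gr K s" unfolding gr_sub using K(1,3) by (intro conjI psubset_imp_subset)
    have "gr K s \<in> \<A>" by (rule \<A>_I[OF K(2) order_trans[OF J(3) sub]])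
    from max[rule_format, OF this] sub have "gr K s = gr J r" unfolding J(1) .
    then have "gr K s \<subseteq> gr J r" by simp
    then show False using K(1) unfolding gr_sub by (auto simp only: psubset_eq)
  qed
  then show ?thesis using J(3) unfolding gr_sub by (intro exI[of _ J] exI[of _ r] conjI) simp_all
qed

section \<open>Local solutions of the equation of motion\<close>

lemma connection_affine: "affine_connection (atlas L) (connection L)"
  using lcs by (simp add: lagrangian_control_system_def levi_civita_def)

lemma metric: "riemannian_metric (atlas L) (metric L)"
  using lcs by (simp add: lagrangian_control_system_def)

lemma
  shows metric_bilinear: "bilinear (metric L p)"
    and metric_pos: "v \<noteq> 0 \<Longrightarrow> metric L p v v > 0"
  using metric unfolding riemannian_metric_def by auto

lemma metric_smooth:
  "c \<in> atlas L \<Longrightarrow> smooth_fun (atlas L) (fst c) (\<lambda>p. metric L p (of_coords (atlas L) c p u) (of_coords (atlas L) c p v))"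
  using metric unfolding riemannian_metric_def by simp

text \<open>The metric is nondegenerate, so the linear map that sends \<open>w\<close> to the components of the form
  \<open>metric L p w\<close> is injective, hence bijective.\<close>

lemma sharp:
  assumes \<alpha>: "linear \<alpha>"
  shows "metric L p (sharp L p \<alpha>) v = \<alpha> v"
proof -
  let ?g = "metric L p"
  note g = metric_bilinear[of p]
  have lr: "linear (?g w)" and ll: "linear (\<lambda>w. ?g w v)" for w v
    using g by (simp_all add: bilinear_def)
  define h where "h w = (\<Sum>b\<in>Basis. ?g w b *\<^sub>R b)" for w
  have hb: "h w \<bullet> b = ?g w b" if "b \<in> Basis" for w b
    using that by (simp add: h_def inner_sum_left inner_Basis if_distrib cong: if_cong)
  have gexp: "?g w v = (\<Sum>b\<in>Basis. (v \<bullet> b) *\<^sub>R ?g w b)" for w v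
    by (rule linear_expand[OF lr])
  have lh: "linear h"
    unfolding h_def
    by (rule linearI) (simp_all add: linear_add[OF ll] linear_cmul[OF ll] scaleR_left_distrib sum.distrib scaleR_sum_right)
  have unq: "w = w'" if "\<And>v. ?g w v = ?g w' v" for w w'
  proof (rule ccontr)
    assume "w \<noteq> w'"
    then have "?g (w - w') (w - w') > 0" by (intro metric_pos) simp
    moreover have "?g (w - w') (w - w') = 0"
      using that by (simp add: linear_diff[OF ll])
    ultimately show False by simp
  qed
  have "inj h"
  proof (rule injI)
    fix w w' assume "h w = h w'"
    then have "?g w b = ?g w' b" if "b \<in> Basis" for b using hb[OF that] by metis
    then have "?g w v = ?g w' v" for v unfolding gexp[of w v] gexp[of w' v] by simp
    then show "w = w'" by (rule unq)
  qed
  then have "surj h" by (rule linear_inj_imp_surj[OF lh])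
  then obtain w where w: "h w = (\<Sum>b\<in>Basis. \<alpha> b *\<^sub>R b)" by (metis surjD)
  have "?g w b = \<alpha> b" if "b \<in> Basis" for b
    using hb[OF that, of w] that by (simp add: w inner_sum_left inner_Basis if_distrib cong: if_cong)
  then have gw: "\<alpha> v = ?g w v" for v
    unfolding gexp[of w v] linear_expand[OF \<alpha>, of v] by simp
  have "sharp L p \<alpha> = w"
    unfolding sharp_def
  proof (rule the_equality)
    show "\<forall>v. \<alpha> v = ?g w v" using gw by simp
    show "w' = w" if "\<forall>v. \<alpha> v = ?g w' v" for w' by (rule unq) (use that gw in metis)
  qed
  then show ?thesis using gw by simp
qed

text \<open>In a chart, the components of the sharp of a form solve the linear system whose matrix is the Gram
  matrix of the coordinate fields.\<close>

lemma smooth_sharp: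
  assumes c: "c \<in> atlas L" and lin: "\<And>p. p \<in> fst c \<Longrightarrow> linear (\<alpha> p)"
    and sm: "\<And>u. smooth_fun (atlas L) (fst c) (\<lambda>p. \<alpha> p (of_coords (atlas L) c p u))"
  shows "smooth_on (snd c ` fst c)
    (\<lambda>x. to_coords (atlas L) c (chart_inv c x) (sharp L (chart_inv c x) (\<alpha> (chart_inv c x))))"
proof -
  let ?A = "atlas L" and ?S = "snd c ` fst c"
  define G where "G x w = (\<Sum>b\<in>Basis. metric L (chart_inv c x) (of_coords ?A c (chart_inv c x) w)
     (of_coords ?A c (chart_inv c x) b) *\<^sub>R b)" for x w
  have S: "open ?S" by (rule open_codomain[OF c])
  note sfc = smooth_fun_chart[OF c open_domain[OF c] order_refl, THEN iffD1]
  have ll: "linear (\<lambda>w. metric L p w v)" and lr: "linear (metric L p w)" for p v w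
    using metric_bilinear[of p] by (simp_all add: bilinear_def)
  show ?thesis
  proof (rule smooth_on_linear_system[where A = G and b = "\<lambda>x. \<Sum>b\<in>Basis. \<alpha> (chart_inv c x) (of_coords ?A c (chart_inv c x) b) *\<^sub>R b", OF S])
    fix x assume x: "x \<in> ?S"
    let ?p = "chart_inv c x"
    have p: "?p \<in> fst c" by (rule chart_inv_in[OF c x])
    note lo = of_coords_linear[OF c p]
    show lG: "linear (G x)"
      unfolding G_def
      by (rule linearI) (simp_all add: linear_add[OF lo] linear_cmul[OF lo] linear_add[OF ll] linear_cmul[OF ll]
          scaleR_left_distrib sum.distrib scaleR_sum_right)
    show "inj (G x)"
      unfolding linear_injective_0[OF lG]
    proof (intro allI impI)
      fix w assume 0: "G x w = 0"
      have "metric L ?p (of_coords ?A c ?p w) (of_coords ?A c ?p b) = G x w \<bullet> b" if "b \<in> Basis" for b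
        using that by (simp add: G_def inner_sum_left inner_Basis if_distrib cong: if_cong)
      then have z: "metric L ?p (of_coords ?A c ?p w) (of_coords ?A c ?p b) = 0" if "b \<in> Basis" for b
        using that 0 by simp
      have "metric L ?p (of_coords ?A c ?p w) (of_coords ?A c ?p w) =
         (\<Sum>b\<in>Basis. (w \<bullet> b) *\<^sub>R metric L ?p (of_coords ?A c ?p w) (of_coords ?A c ?p b))"
        using linear_expand[OF linear_compose[OF lo lr[of ?p "of_coords ?A c ?p w"]], of w] by (simp add: o_def)
      also have "\<dots> = 0" by (simp add: z)
      finally have "of_coords ?A c ?p w = 0"
        using metric_pos[of "of_coords ?A c ?p w" ?p] by auto
      then show "w = 0" using to_coords_of_coords[OF c p, of w] linear_0[OF to_coords_linear[OF c p]] by simp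
    qed
    show "G x (to_coords ?A c ?p (sharp L ?p (\<alpha> ?p))) = (\<Sum>b\<in>Basis. \<alpha> ?p (of_coords ?A c ?p b) *\<^sub>R b)"
      by (simp add: G_def of_coords_to_coords[OF c p] sharp[OF lin[OF p]])
  next
    show "smooth_on ?S (\<lambda>x. G x u)" for u
      unfolding G_def
      by (intro smooth_on_sum S smooth_on_scaleR smooth_on_const sfc metric_smooth c)
    show "smooth_on ?S (\<lambda>x. \<Sum>b\<in>Basis. \<alpha> (chart_inv c x) (of_coords ?A c (chart_inv c x) b) *\<^sub>R b)"
      by (intro smooth_on_sum S smooth_on_scaleR smooth_on_const sfc sm)
  qed
qed

lemma smooth_force_field:
  assumes "c \<in> atlas L" "i < num_forces L"
  shows "smooth_on (snd c ` fst c)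
    (\<lambda>x. to_coords (atlas L) c (chart_inv c x) (sharp L (chart_inv c x) (force L i (chart_inv c x))))"
proof -
  have f: "smooth_one_form (atlas L) (force L i)"
    using lcs assms(2) by (simp add: lagrangian_control_system_def)
  show ?thesis
    by (rule smooth_sharp[OF assms(1)]) (use f assms(1) in \<open>simp_all add: smooth_one_form_def\<close>)
qed

lemma smooth_grad_potential:
  assumes c: "c \<in> atlas L"
  shows "smooth_on (snd c ` fst c)
    (\<lambda>x. to_coords (atlas L) c (chart_inv c x) (grad_potential L (chart_inv c x)))"
  unfolding grad_potential_def
proof (rule smooth_sharp[OF c])
  let ?A = "atlas L" and ?P = "potential L"
  have P: "smooth_fun ?A UNIV ?P" using lcs by (simp add: lagrangian_control_system_def)
  have d: "((\<lambda>x. ?P (chart_inv c x)) has_derivative (\<lambda>u. differential ?A ?P p (of_coords ?A c p u))) (at (snd c p))"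
    if "p \<in> fst c" for p
    by (rule differential_of_coords[OF P UNIV_I c that])
  show "linear (differential ?A ?P p)" if "p \<in> fst c" for p
  proof -
    have "linear ((\<lambda>u. differential ?A ?P p (of_coords ?A c p u)) \<circ> to_coords ?A c p)"
      by (rule linear_compose[OF to_coords_linear[OF c that] has_derivative_linear[OF d[OF that]]])
    then show ?thesis by (simp add: o_def of_coords_to_coords[OF c that])
  qed
  fix u
  show "smooth_fun ?A (fst c) (\<lambda>p. differential ?A ?P p (of_coords ?A c p u))"
    unfolding smooth_fun_chart[OF c open_domain[OF c] order_refl]
  proof (rule smooth_on_cong[OF open_codomain[OF c], THEN iffD1])
    have "smooth_on (snd c ` (UNIV \<inter> fst c)) (?P \<circ> chart_inv c)" using P c unfolding smooth_fun_def by blast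
    then have "smooth_on (snd c ` fst c) (\<lambda>x. ?P (chart_inv c x))" by (simp add: o_def)
    then show "smooth_on (snd c ` fst c) (\<lambda>x. frechet_derivative (\<lambda>x. ?P (chart_inv c x)) (at x) u)"
      by (rule smooth_on_frechet)
    fix x assume x: "x \<in> snd c ` fst c"
    show "frechet_derivative (\<lambda>x. ?P (chart_inv c x)) (at x) u =
        differential ?A ?P (chart_inv c x) (of_coords ?A c (chart_inv c x) u)"
      using frechet_derivative_at[OF d[OF chart_inv_in[OF c x]]] by (simp add: chart_chart_inv[OF c x] fun_eq_iff)
  qed
qed

text \<open>The quadratic term of the geodesic equation. Its coefficients \<open>\<Gamma> a b\<close> are the Christoffel symbols of
  the chart.\<close>

lemma smooth_connection_coords:
  assumes c: "c \<in> atlas L"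
  shows "smooth_on (snd c ` fst c \<times> UNIV) (\<lambda>z. to_coords (atlas L) c (chart_inv c (fst z))
    (connection L (chart_inv c (fst z)) (of_coords (atlas L) c (chart_inv c (fst z)) (snd z))
      (\<lambda>p. of_coords (atlas L) c p (snd z))))"
proof -
  let ?A = "atlas L" and ?S = "snd c ` fst c" and ?D = "connection L"
  \<comment> \<open>As a connection is tensorial in its direction and linear in constant components, finitely many smooth coefficients suffice.\<close>
  define \<Gamma> where "\<Gamma> a b x = to_coords ?A c (chart_inv c x) (?D (chart_inv c x)
     (of_coords ?A c (chart_inv c x) a) (\<lambda>p. of_coords ?A c p b))" for a b x
  have S: "open (?S \<times> (UNIV :: 'e set))" by (rule open_Times[OF open_codomain[OF c] open_UNIV])
  have s\<Gamma>: "smooth_on ?S (\<Gamma> a b)" for a b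
  proof -
    have "smooth_vf ?A (fst c) (\<lambda>p. ?D p (of_coords ?A c p a) (\<lambda>p. of_coords ?A c p b))"
      by (rule conn_smooth[OF connection_affine smooth_vf_coord_field[OF c] smooth_vf_coord_field[OF c]])
    then show ?thesis
      unfolding smooth_vf_chart[OF c open_domain[OF c] order_refl] \<Gamma>_def[abs_def] .
  qed
  have fst: "smooth_on (?S \<times> (UNIV :: 'e set)) (\<lambda>z. \<Gamma> a b (fst z))" for a b
    using smooth_on_compose[OF S smooth_on_linear[OF bounded_linear_fst] s\<Gamma>[of a b]] by (simp add: o_def)
  have snd: "smooth_on (?S \<times> UNIV) (\<lambda>z. snd z \<bullet> a)" for a :: 'e
    by (intro smooth_on_inner S smooth_on_linear[OF bounded_linear_snd] smooth_on_const)
  have sm: "smooth_on (?S \<times> UNIV) (\<lambda>z. \<Sum>b\<in>Basis. (snd z \<bullet> b) *\<^sub>R (\<Sum>a\<in>Basis. (snd z \<bullet> a) *\<^sub>R \<Gamma> a b (fst z)))"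
    by (intro smooth_on_sum S smooth_on_scaleR fst snd)
  show ?thesis
  proof (rule smooth_on_cong[OF S, THEN iffD1, OF _ sm])
    fix z :: "'e \<times> 'e" assume "z \<in> ?S \<times> UNIV"
    then have p: "chart_inv c (fst z) \<in> fst c" using chart_inv_in[OF c] by auto
    let ?p = "chart_inv c (fst z)" and ?w = "snd z"
    have "to_coords ?A c ?p (?D ?p v (\<lambda>p. of_coords ?A c p ?w)) =
       (\<Sum>b\<in>Basis. (?w \<bullet> b) *\<^sub>R to_coords ?A c ?p (?D ?p v (\<lambda>x. of_coords ?A c x b)))" for v
      unfolding conn_coord_field[OF connection_affine c p, of v ?w]
      by (simp add: linear_sum[OF to_coords_linear[OF c p]] linear_cmul[OF to_coords_linear[OF c p]])
    moreover have "to_coords ?A c ?p (?D ?p (of_coords ?A c ?p ?w) (\<lambda>x. of_coords ?A c x b)) =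
        (\<Sum>a\<in>Basis. (?w \<bullet> a) *\<^sub>R \<Gamma> a b (fst z))" for b
    proof -
      have "linear (to_coords ?A c ?p \<circ> ((\<lambda>v. ?D ?p v (\<lambda>x. of_coords ?A c x b)) \<circ> of_coords ?A c ?p))"
        by (intro linear_compose[OF linear_compose[OF of_coords_linear[OF c p]
              conn_linear[OF connection_affine smooth_vf_coord_field[OF c] p]] to_coords_linear[OF c p]])
      from linear_expand[OF this, of ?w] show ?thesis by (simp add: \<Gamma>_def)
    qed
    ultimately show "(\<Sum>b\<in>Basis. (?w \<bullet> b) *\<^sub>R (\<Sum>a\<in>Basis. (?w \<bullet> a) *\<^sub>R \<Gamma> a b (fst z))) =
      to_coords ?A c ?p (?D ?p (of_coords ?A c ?p ?w) (\<lambda>p. of_coords ?A c p ?w))"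
      by simp
  qed
qed

text \<open>In a chart around \<open>p\<close> the equation of motion becomes a first-order system for the position and the
  velocity components, with the smooth right-hand side \<open>(snd z, F z)\<close>.\<close>

lemma base_integral_curve_exists:
  assumes \<tau>: "smooth_feedback L \<tau>"
  shows "\<exists>I q. base_integral_curve L \<tau> I q \<and> 0 \<in> I \<and> q 0 = p \<and> velocity (atlas L) q 0 = v"
proof -
  let ?A = "atlas L" and ?D = "connection L"
  define c where "c = chart_at ?A p"
  have c: "c \<in> ?A" "p \<in> fst c" unfolding c_def by (rule chart_at)+
  let ?S = "snd c ` fst c"
  define W where "W = ?S \<times> (UNIV :: 'e set)"
  have S: "open W" unfolding W_def by (rule open_Times[OF open_codomain[OF c(1)] open_UNIV])
  define rhs where "rhs x u = - grad_potential L x + (\<Sum>i<num_forces L. \<tau> i x u *\<^sub>R sharp L x (force L i x))" for x u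
  define F where "F z = to_coords ?A c (chart_inv c (fst z)) (rhs (chart_inv c (fst z)) (of_coords ?A c (chart_inv c (fst z)) (snd z)))
    - to_coords ?A c (chart_inv c (fst z)) (?D (chart_inv c (fst z)) (of_coords ?A c (chart_inv c (fst z)) (snd z))
      (\<lambda>p. of_coords ?A c p (snd z)))" for z
  have pos: "smooth_on W (\<lambda>z. h (fst z))" if "smooth_on ?S h" for h :: "'e \<Rightarrow> 'e"
    using smooth_on_compose[OF S smooth_on_linear[OF bounded_linear_fst] that] by (simp add: o_def W_def)
  have sr: "smooth_on W (\<lambda>z. - to_coords ?A c (chart_inv c (fst z)) (grad_potential L (chart_inv c (fst z))) +
     (\<Sum>i<num_forces L. \<tau> i (chart_inv c (fst z)) (of_coords ?A c (chart_inv c (fst z)) (snd z)) *\<^sub>R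
        to_coords ?A c (chart_inv c (fst z)) (sharp L (chart_inv c (fst z)) (force L i (chart_inv c (fst z))))))"
  proof (intro smooth_on_add smooth_on_minus S smooth_on_sum smooth_on_scaleR)
    show "smooth_on W (\<lambda>z. to_coords ?A c (chart_inv c (fst z)) (grad_potential L (chart_inv c (fst z))))"
      by (rule pos[OF smooth_grad_potential[OF c(1)]])
    fix i assume "i \<in> {..<num_forces L}"
    then have i: "i < num_forces L" by simp
    show "smooth_on W (\<lambda>z. to_coords ?A c (chart_inv c (fst z)) (sharp L (chart_inv c (fst z)) (force L i (chart_inv c (fst z)))))"
      by (rule pos[OF smooth_force_field[OF c(1) i]])
    show "smooth_on W (\<lambda>z. \<tau> i (chart_inv c (fst z)) (of_coords ?A c (chart_inv c (fst z)) (snd z)))"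
      using \<tau> i c(1) unfolding smooth_feedback_def W_def by (simp add: case_prod_unfold)
  qed
  have sF: "smooth_on W F"
  proof -
    have "smooth_on W (\<lambda>z. (- to_coords ?A c (chart_inv c (fst z)) (grad_potential L (chart_inv c (fst z))) +
     (\<Sum>i<num_forces L. \<tau> i (chart_inv c (fst z)) (of_coords ?A c (chart_inv c (fst z)) (snd z)) *\<^sub>R
        to_coords ?A c (chart_inv c (fst z)) (sharp L (chart_inv c (fst z)) (force L i (chart_inv c (fst z)))))) +
     - to_coords ?A c (chart_inv c (fst z)) (?D (chart_inv c (fst z)) (of_coords ?A c (chart_inv c (fst z)) (snd z))
      (\<lambda>p. of_coords ?A c p (snd z))))"
      by (rule smooth_on_add[OF S sr smooth_on_minus[OF S]])
         (unfold W_def, rule smooth_connection_coords[OF c(1)])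
    then show ?thesis
    proof (rule smooth_on_cong[OF S, THEN iffD1, rotated])
      fix z assume "z \<in> W"
      then have p: "chart_inv c (fst z) \<in> fst c" using chart_inv_in[OF c(1)] unfolding W_def by auto
      note l = to_coords_linear[OF c(1) p]
      show "(- to_coords ?A c (chart_inv c (fst z)) (grad_potential L (chart_inv c (fst z))) +
     (\<Sum>i<num_forces L. \<tau> i (chart_inv c (fst z)) (of_coords ?A c (chart_inv c (fst z)) (snd z)) *\<^sub>R
        to_coords ?A c (chart_inv c (fst z)) (sharp L (chart_inv c (fst z)) (force L i (chart_inv c (fst z)))))) +
     - to_coords ?A c (chart_inv c (fst z)) (?D (chart_inv c (fst z)) (of_coords ?A c (chart_inv c (fst z)) (snd z))
      (\<lambda>p. of_coords ?A c p (snd z))) = F z"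
        by (simp add: F_def rhs_def linear_add[OF l] linear_neg[OF l] linear_diff[OF l] linear_sum[OF l] linear_cmul[OF l])
    qed
  qed
  have sV: "smooth_on W (\<lambda>z. (snd z, F z))"
    by (intro smooth_on_Pair S sF smooth_on_linear[OF bounded_linear_snd])
  have "(snd c p, to_coords ?A c p v) \<in> W" using c by (simp add: W_def)
  from smooth_ode_local_existence[OF S sV this]
  obtain e z where e: "e > 0" and z0: "z 0 = (snd c p, to_coords ?A c p v)"
    and sz: "smooth_on {-e<..<e} z"
    and z: "\<forall>t\<in>{-e<..<e}. z t \<in> W \<and> (z has_vector_derivative (snd (z t), F (z t))) (at t)"
    by (elim exE conjE)
  define I where "I = {-e<..<e}"
  have I: "open I" "0 \<in> I" "open_interval I" using e by (auto simp: I_def open_interval_def)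
  define q where "q t = chart_inv c (fst (z t))" for t
  have zS: "fst (z t) \<in> ?S" if "t \<in> I" for t using bspec[OF z, of t] that by (auto simp: I_def W_def)
  have q: "q t \<in> fst c" "(snd c \<circ> q) t = fst (z t)" if "t \<in> I" for t
    using chart_inv_in[OF c(1) zS[OF that]] chart_chart_inv[OF c(1) zS[OF that]] by (simp_all add: q_def)
  have dz: "(z has_vector_derivative (snd (z t), F (z t))) (at t)" if "t \<in> I" for t
    using bspec[OF z, of t] that by (simp add: I_def)
  have "smooth_on I (\<lambda>t. fst (z t))"
    by (rule smooth_on_compose_linear[OF I(1) bounded_linear_fst]) (use sz in \<open>simp add: I_def\<close>)
  then have sx: "smooth_on I (snd c \<circ> q)"
    by (rule smooth_on_cong[OF I(1), THEN iffD1, rotated]) (simp only: q)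
  have sc: "smooth_curve ?A I q"
  proof (rule smooth_curveI)
    fix t assume "t \<in> I"
    then show "\<exists>c\<in>?A. \<exists>J. open J \<and> t \<in> J \<and> q ` J \<subseteq> fst c \<and> smooth_on J (snd c \<circ> q)"
      by (intro bexI[OF _ c(1)] exI[of _ I] conjI I(1) sx image_subsetI q(1))
  qed
  have dq: "((snd c \<circ> q) has_vector_derivative snd (z t)) (at t)" if "t \<in> I" for t
  proof -
    have "((\<lambda>t. fst (z t)) has_vector_derivative snd (z t)) (at t)"
      using bounded_linear.has_vector_derivative[OF bounded_linear_fst dz[OF that]] by simp
    then show ?thesis
      by (rule has_vector_derivative_transform_within_open[OF _ I(1) that]) (simp only: q)
  qed
  have vel: "velocity ?A q t = of_coords ?A c (q t) (snd (z t))" if "t \<in> I" for t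
    by (rule velocity_eq[OF c(1) I(1) that q(1) dq[OF that]])
  have vel': "to_coords ?A c (q t) (velocity ?A q t) = snd (z t)" if "t \<in> I" for t
    by (simp add: vel[OF that] to_coords_of_coords[OF c(1) q(1)[OF that]])
  have acc: "acceleration L q t = rhs (q t) (velocity ?A q t)" if t: "t \<in> I" for t
  proof -
    have "((\<lambda>t. snd (z t)) has_vector_derivative F (z t)) (at t)"
      using bounded_linear.has_vector_derivative[OF bounded_linear_snd dz[OF that]] by simp
    then have "((\<lambda>s. to_coords ?A c (q s) (velocity ?A q s)) has_vector_derivative F (z t)) (at t)"
      by (rule has_vector_derivative_transform_within_open[OF _ I(1) that]) (simp only: vel')
    from vector_derivative_at[OF this]
    have "acceleration L q t = of_coords ?A c (q t) (F (z t)) +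
       ?D (q t) (velocity ?A q t) (\<lambda>p. of_coords ?A c p (snd (z t)))"
      unfolding acceleration_def cov_deriv_velocity_chart[OF connection_affine sc I(1) t c(1) q(1)[OF t] chart_at]
      by (simp add: cov_deriv_in_def vel'[OF t])
    also have "F (z t) = to_coords ?A c (q t) (rhs (q t) (velocity ?A q t)
        - ?D (q t) (velocity ?A q t) (\<lambda>p. of_coords ?A c p (snd (z t))))"
      unfolding F_def q_def[symmetric] vel[OF t, symmetric]
      by (rule linear_diff[OF to_coords_linear[OF c(1) q(1)[OF t]], symmetric])
    finally show ?thesis by (simp add: of_coords_to_coords[OF c(1) q(1)[OF t]])
  qed
  have "base_integral_curve L \<tau> I q"
    unfolding base_integral_curve_def rhs_def[symmetric] using I(3) sc acc by simp
  moreover have q0: "q 0 = p" using c by (simp add: q_def z0 chart_inv_chart)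
  moreover have "velocity ?A q 0 = v"
    using vel[OF I(2)] by (simp add: q0 z0 of_coords_to_coords[OF c])
  ultimately show ?thesis using I(2) by (intro exI[of _ I] exI[of _ q] conjI)
qed

end

section \<open>Slice charts and tangent spaces\<close>

text \<open>A subspace is its own double orthogonal complement, and the inner product with a vector orthogonal
  to it vanishes along the curve.\<close>

lemma has_vector_derivative_in_subspace:
  fixes f :: "real \<Rightarrow> 'a::euclidean_space"
  assumes S: "subspace S" and J: "open J" "t \<in> J" and f: "\<And>s. s \<in> J \<Longrightarrow> f s \<in> S"
    and d: "(f has_vector_derivative D) (at t)"
  shows "D \<in> S"
proof -
  have "D \<in> S\<^sup>\<bottom>\<^sup>\<bottom>"
    unfolding orthogonal_comp_def
  proof (rule CollectI, rule ballI)
    fix y assume "y \<in> {x. \<forall>y\<in>S. orthogonal y x}"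
    then have y: "f s \<bullet> y = 0" if "s \<in> J" for s using f[OF that] by (simp add: orthogonal_def)
    have "((\<lambda>s. f s \<bullet> y) has_vector_derivative D \<bullet> y) (at t)"
      by (rule bounded_linear.has_vector_derivative[OF bounded_linear_inner_left d])
    then have "((\<lambda>s. 0) has_vector_derivative D \<bullet> y) (at t)"
      by (rule has_vector_derivative_transform_within_open[OF _ J]) (rule y)
    from vector_derivative_at[OF this] have "D \<bullet> y = 0" by simp
    then show "orthogonal y D" by (simp add: orthogonal_def inner_commute)
  qed
  then show ?thesis by (simp add: orthogonal_comp_self[OF S])
qed

context smooth_manifold
begin

lemma slice_chart_in:
  assumes "slice_chart A C S c" "p \<in> C" "p \<in> fst c"
  shows "snd c p \<in> S"
  using assms unfolding slice_chart_def by blast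

lemma slice_chart_mem:
  assumes sl: "slice_chart A C S c" and x: "x \<in> snd c ` fst c" "x \<in> S"
  shows "chart_inv c x \<in> C"
proof -
  have "x \<in> snd c ` (fst c \<inter> C)" using assms unfolding slice_chart_def by blast
  then obtain p where "p \<in> fst c" "p \<in> C" "x = snd c p" by auto
  moreover have "c \<in> A" using sl by (simp add: slice_chart_def)
  ultimately show ?thesis by (simp add: chart_inv_chart)
qed

lemma slice_chart_velocity:
  assumes sl: "slice_chart A C S c" and q: "smooth_curve A I q" "open I" "q ` I \<subseteq> C" "t \<in> I" "q t \<in> fst c"
  shows "to_coords A c (q t) (velocity A q t) \<in> S"
proof (rule has_vector_derivative_in_subspace[where J = "{s \<in> I. q s \<in> fst c}"])
  have c: "c \<in> A" and "subspace S" using sl by (simp_all add: slice_chart_def)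
  then show "subspace S" by simp
  show "open {s \<in> I. q s \<in> fst c}" by (rule smooth_curve_coords_open[OF q(1,2) c])
  show "((snd c \<circ> q) has_vector_derivative to_coords A c (q t) (velocity A q t)) (at t)"
    by (rule velocity_coords[OF q(1,2,4) c q(5)])
  show "(snd c \<circ> q) s \<in> S" if "s \<in> {s \<in> I. q s \<in> fst c}" for s
    using slice_chart_in[OF sl, of "q s"] that q(3) by auto
qed (use q in simp)

lemma slice_chart_second_derivative:
  assumes sl: "slice_chart A C S c" and q: "smooth_curve A I q" "open I" "q ` I \<subseteq> C" "t \<in> I" "q t \<in> fst c"
  shows "vector_derivative (\<lambda>s. to_coords A c (q s) (velocity A q s)) (at t) \<in> S"
proof (rule has_vector_derivative_in_subspace[where J = "{s \<in> I. q s \<in> fst c}"])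
  have c: "c \<in> A" and "subspace S" using sl by (simp_all add: slice_chart_def)
  then show "subspace S" by simp
  show "open {s \<in> I. q s \<in> fst c}" by (rule smooth_curve_coords_open[OF q(1,2) c])
  show "((\<lambda>s. to_coords A c (q s) (velocity A q s)) has_vector_derivative
    vector_derivative (\<lambda>s. to_coords A c (q s) (velocity A q s)) (at t)) (at t)"
    by (rule differentiableI_vector[OF smooth_curve_second_derivative[OF q(1,2,4) c q(5)],
        unfolded vector_derivative_works])
  show "to_coords A c (q s) (velocity A q s) \<in> S" if "s \<in> {s \<in> I. q s \<in> fst c}" for s
    by (rule slice_chart_velocity[OF sl q(1-3)]) (use that in auto)
qed (use q in simp)

text \<open>For the inclusion from right to left, a vector of \<open>S\<close> is the velocity of a straight line in the
  coordinates. The line stays in \<open>S\<close>, so the curve stays in \<open>C\<close>.\<close>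

lemma tangent_space_slice_chart:
  assumes sl: "slice_chart A C S c" and p: "p \<in> C" "p \<in> fst c"
  shows "tangent_space A C p = of_coords A c p ` S"
proof
  have c: "c \<in> A" and S: "subspace S" using sl by (simp_all add: slice_chart_def)
  show "tangent_space A C p \<subseteq> of_coords A c p ` S"
  proof
    fix v assume "v \<in> tangent_space A C p"
    then obtain I \<gamma> where I: "open_interval I" "0 \<in> I" "smooth_curve A I \<gamma>" "\<gamma> ` I \<subseteq> C" "\<gamma> 0 = p"
      "velocity A \<gamma> 0 = v"
      unfolding tangent_space_def by (elim CollectE exE conjE)
    have "to_coords A c (\<gamma> 0) (velocity A \<gamma> 0) \<in> S"
      by (rule slice_chart_velocity[OF sl I(3) _ I(4,2)]) (use I p in \<open>simp_all add: open_interval_def\<close>)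
    then have "to_coords A c p v \<in> S" by (simp add: I)
    then show "v \<in> of_coords A c p ` S"
      using of_coords_to_coords[OF c p(2), of v] by (metis imageI)
  qed
  show "of_coords A c p ` S \<subseteq> tangent_space A C p"
  proof
    fix v assume "v \<in> of_coords A c p ` S"
    then obtain s where s: "s \<in> S" "v = of_coords A c p s" by blast
    let ?x = "\<lambda>t::real. snd c p + t *\<^sub>R s"
    have "open {t. ?x t \<in> snd c ` fst c}"
      using open_vimage[OF open_codomain[OF c], of ?x]
      by (simp add: vimage_def continuous_on_add continuous_on_scaleR)
    moreover have "0 \<in> {t. ?x t \<in> snd c ` fst c}" using p by simp
    ultimately obtain e where e: "e > 0" "ball 0 e \<subseteq> {t. ?x t \<in> snd c ` fst c}"
      using open_contains_ball by blast
    define I where "I = {-e<..<e}"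
    have oI: "open I" "0 \<in> I" using e by (simp_all add: I_def)
    have xI: "?x t \<in> snd c ` fst c" if "t \<in> I" for t
      using subsetD[OF e(2), of t] that by (simp add: I_def abs_less_iff)
    define \<gamma> where "\<gamma> t = chart_inv c (?x t)" for t
    have cg: "(snd c \<circ> \<gamma>) t = ?x t" "\<gamma> t \<in> fst c" if "t \<in> I" for t
      using chart_chart_inv[OF c xI[OF that]] chart_inv_in[OF c xI[OF that]] by (simp_all add: \<gamma>_def)
    have sx: "smooth_on I ?x"
      by (intro smooth_on_add smooth_on_scaleR smooth_on_const smooth_on_id oI)
    have "smooth_on I (snd c \<circ> \<gamma>)"
      by (rule smooth_on_cong[OF oI(1), THEN iffD1, OF _ sx]) (simp only: cg)
    then have sc: "smooth_curve A I \<gamma>"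
      by (intro smooth_curveI) (use c oI cg in \<open>auto intro!: bexI[of _ c] exI[of _ I]\<close>)
    have x0: "snd c p \<in> S" by (rule slice_chart_in[OF sl p])
    have "\<gamma> t \<in> C" if "t \<in> I" for t
      unfolding \<gamma>_def
      by (rule slice_chart_mem[OF sl xI[OF that]]) (use x0 s S in \<open>simp add: subspace_add subspace_scale\<close>)
    then have gC: "\<gamma> ` I \<subseteq> C" by blast
    have g0: "\<gamma> 0 = p" using p c by (simp add: \<gamma>_def chart_inv_chart)
    have "(?x has_vector_derivative s) (at 0)"
      by (auto intro!: derivative_eq_intros)
    then have d: "((snd c \<circ> \<gamma>) has_vector_derivative s) (at 0)"
      by (rule has_vector_derivative_transform_within_open[OF _ oI]) (simp only: cg)
    have "velocity A \<gamma> 0 = of_coords A c (\<gamma> 0) s"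
      by (rule velocity_eq[OF c oI _ d]) (rule cg(2))
    then have v: "velocity A \<gamma> 0 = v" by (simp add: g0 s)
    have "open_interval I" using e by (simp add: open_interval_def I_def)
    then show "v \<in> tangent_space A C p"
      unfolding tangent_space_def using oI sc gC g0 v by (intro CollectI exI[of _ I] exI[of _ \<gamma>] conjI)
  qed
qed

end

section \<open>The acceleration of a curve in the constraint\<close>

locale constrained_system = lagrangian_system L
  for L :: "('q::{t2_space,second_countable_topology}, 'e::euclidean_space) control_system" +
  fixes C :: "'q set"
  assumes vhc: "regular_vhc L C"
begin

abbreviation TC where "TC \<equiv> tangent_space (atlas L) C"
abbreviation DA where "DA \<equiv> acceleration_distribution L"

lemma slice_chart_exists:
  assumes "p \<in> C"
  shows "\<exists>c S. slice_chart (atlas L) C S c \<and> p \<in> fst c"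
  using vhc assms unfolding regular_vhc_def embedded_submanifold_def by blast

lemma subspace_tangent:
  assumes "p \<in> C" shows "subspace (TC p)"
proof -
  obtain c S where c: "slice_chart (atlas L) C S c" "p \<in> fst c" using slice_chart_exists[OF assms] by blast
  then have "c \<in> atlas L" "subspace S" by (simp_all add: slice_chart_def)
  then show ?thesis
    using tangent_space_slice_chart[OF c(1) assms c(2)] linear_subspace_image[OF of_coords_linear] c(2) by simp
qed

lemma subspace_DA: "subspace (DA p)"
  by (simp add: acceleration_distribution_def)

lemma proj_eq:
  assumes p: "p \<in> C" and u: "u \<in> TC p" "v - u \<in> DA p"
  shows "proj L C p v = u"
  unfolding proj_def
proof (rule the_equality)
  show "u \<in> TC p \<and> v - u \<in> DA p" using u by simp
  fix w assume w: "w \<in> TC p \<and> v - w \<in> DA p"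
  have "w - u \<in> TC p" using subspace_diff[OF subspace_tangent[OF p]] w u by simp
  moreover have "(v - u) - (v - w) \<in> DA p" using subspace_diff[OF subspace_DA] w u by blast
  then have "w - u \<in> DA p" by simp
  moreover have "TC p \<inter> DA p = {0}" using vhc p by (simp add: regular_vhc_def)
  ultimately have "w - u = 0" by blast
  then show "w = u" by simp
qed

lemma
  assumes p: "p \<in> C"
  shows proj_tangent: "proj L C p v \<in> TC p" and proj_diff: "v - proj L C p v \<in> DA p"
proof -
  have "v \<in> {u + w |u w. u \<in> TC p \<and> w \<in> DA p}" using vhc p unfolding regular_vhc_def by blast
  then obtain u w where u: "v = u + w" "u \<in> TC p" "w \<in> DA p" by blast
  then have "proj L C p v = u" by (intro proj_eq[OF p]) simp_all
  with u show "proj L C p v \<in> TC p" "v - proj L C p v \<in> DA p" by simp_all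
qed

lemma curve_velocity_tangent:
  assumes q: "smooth_curve (atlas L) I q" "open I" "q ` I \<subseteq> C" "t \<in> I"
  shows "velocity (atlas L) q t \<in> TC (q t)"
proof -
  have p: "q t \<in> C" using q by blast
  obtain c S where c: "slice_chart (atlas L) C S c" "q t \<in> fst c" using slice_chart_exists[OF p] by blast
  have cA: "c \<in> atlas L" using c by (simp add: slice_chart_def)
  have "to_coords (atlas L) c (q t) (velocity (atlas L) q t) \<in> S"
    by (rule slice_chart_velocity[OF c(1) q c(2)])
  then show ?thesis
    unfolding tangent_space_slice_chart[OF c(1) p c(2)]
    using of_coords_to_coords[OF cA c(2), of "velocity (atlas L) q t"] by (metis imageI)
qed

lemma acceleration_chart:
  assumes q: "smooth_curve (atlas L) I q" "open I" "t \<in> I" and c: "c \<in> atlas L" "q t \<in> fst c"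
  shows "acceleration L q t = cov_deriv_in (atlas L) c (connection L) q (velocity (atlas L) q) t"
  unfolding acceleration_def by (rule cov_deriv_velocity_chart[OF connection_affine q c chart_at])

text \<open>In a slice chart the acceleration is the sum of the second derivative of the coordinates and a
  connection term. The former lies in \<open>S\<close> and is therefore tangent, so the projection fixes it and acts
  on the connection term alone, which is what the induced connection does. The extension \<open>Z\<close>
  that the induced connection picks agrees with \<open>Y\<close> along the curve, and the curve determines the
  derivative.\<close>

lemma constrained_acceleration_eq_proj:
  assumes q: "smooth_curve (atlas L) I q" "open I" "q ` I \<subseteq> C" "t \<in> I"
  shows "constrained_acceleration L C q t = proj L C (q t) (acceleration L q t)"
proof -
  let ?A = "atlas L" and ?v = "velocity (atlas L) q t" and ?p = "q t" and ?D = "connection L"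
  have p: "q t \<in> C" using q by blast
  define c where "c = (SOME c. \<exists>S. slice_chart (atlas L) C S c \<and> q t \<in> fst c)"
  have "\<exists>S. slice_chart (atlas L) C S c \<and> q t \<in> fst c"
    unfolding c_def by (rule someI_ex) (rule slice_chart_exists[OF p])
  then obtain S where S: "slice_chart ?A C S c" "q t \<in> fst c" by blast
  have c: "c \<in> ?A" using S by (simp add: slice_chart_def)
  define w where "w = to_coords ?A c ?p ?v"
  define Y where "Y = (\<lambda>p. of_coords ?A c p w)"
  define Z where "Z = (SOME Z. \<exists>U. ?p \<in> U \<and> smooth_vf ?A U Z \<and> (\<forall>x\<in>U \<inter> C. Z x = Y x))"
  have Y: "smooth_vf ?A (fst c) Y" unfolding Y_def by (rule smooth_vf_coord_field[OF c])
  have "\<exists>U. ?p \<in> U \<and> smooth_vf ?A U Z \<and> (\<forall>x\<in>U \<inter> C. Z x = Y x)"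
    unfolding Z_def
    by (rule someI[where x = Y]) (intro exI[of _ "fst c"] conjI S Y ballI refl)
  then obtain U where U: "?p \<in> U" "smooth_vf ?A U Z" "\<forall>x\<in>U \<inter> C. Z x = Y x" by (elim exE conjE)
  \<comment> \<open>The choice of the extension does not matter, as both fields agree on the curve.\<close>
  have ZY: "?D ?p ?v Z = ?D ?p ?v Y"
  proof -
    have o: "open {s \<in> I. q s \<in> U}"
      by (rule smooth_curve_open[OF q(1,2)]) (use U in \<open>simp add: smooth_vf_def\<close>)
    have eq: "Z (q s) = Y (q s)" if "s \<in> {s \<in> I. q s \<in> U}" for s using bspec[OF U(3), of "q s"] that q(3) by auto
    have "vector_derivative (\<lambda>s. to_coords ?A c (q s) (Z (q s))) (at t) =
        vector_derivative (\<lambda>s. to_coords ?A c (q s) (Y (q s))) (at t)"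
      by (rule vector_derivative_local[OF o]) (use q U eq in auto)
    moreover have "Z ?p = Y ?p" by (rule eq) (use q U in simp)
    ultimately show ?thesis
      using connection_along_curve[OF connection_affine U(2,1) q(1,2,4) c S(2)]
        connection_along_curve[OF connection_affine Y S(2) q(1,2,4) c S(2)] by simp
  qed
  let ?a = "of_coords ?A c ?p (vector_derivative (\<lambda>s. to_coords ?A c (q s) (velocity ?A q s)) (at t))"
  have aT: "?a \<in> TC ?p"
    unfolding tangent_space_slice_chart[OF S(1) p S(2)]
    by (rule imageI, rule slice_chart_second_derivative[OF S(1) q S(2)])
  have ca: "constrained_acceleration L C q t = ?a + proj L C ?p (?D ?p ?v Y)"
    unfolding constrained_acceleration_def cov_deriv_in_def induced_connection_def c_def[symmetric]
      w_def[symmetric] Y_def[symmetric] Z_def[symmetric] ZY ..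
  have ac: "acceleration L q t = ?a + ?D ?p ?v Y"
    unfolding acceleration_chart[OF q(1,2,4) c S(2)] cov_deriv_in_def w_def[symmetric] Y_def[symmetric] ..
  have "proj L C ?p (?a + ?D ?p ?v Y) = ?a + proj L C ?p (?D ?p ?v Y)"
  proof (rule proj_eq[OF p])
    show "?a + proj L C ?p (?D ?p ?v Y) \<in> TC ?p"
      by (rule subspace_add[OF subspace_tangent[OF p] aT proj_tangent[OF p]])
    show "?a + ?D ?p ?v Y - (?a + proj L C ?p (?D ?p ?v Y)) \<in> DA ?p"
      using proj_diff[OF p, of "?D ?p ?v Y"] by simp
  qed
  then show ?thesis by (simp only: ca ac)
qed

text \<open>When position and velocity agree, the connection terms of the two accelerations cancel, and the
  difference of the second derivatives of the coordinates lies in \<open>S\<close>.\<close>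

lemma acceleration_difference_tangent:
  assumes q: "smooth_curve (atlas L) I q" "open I" "q ` I \<subseteq> C" "t \<in> I"
    and r: "smooth_curve (atlas L) J r" "open J" "r ` J \<subseteq> C" "s \<in> J"
    and eq: "q t = r s" "velocity (atlas L) q t = velocity (atlas L) r s"
  shows "acceleration L q t - acceleration L r s \<in> TC (q t)"
proof -
  let ?A = "atlas L"
  have p: "q t \<in> C" using q by blast
  obtain c S where c: "slice_chart ?A C S c" "q t \<in> fst c" using slice_chart_exists[OF p] by blast
  have cA: "c \<in> ?A" and S: "subspace S" using c by (simp_all add: slice_chart_def)
  have r': "r s \<in> fst c" using c eq by simp
  let ?x = "vector_derivative (\<lambda>s. to_coords ?A c (q s) (velocity ?A q s)) (at t)"
  let ?y = "vector_derivative (\<lambda>s. to_coords ?A c (r s) (velocity ?A r s)) (at s)"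
  have "acceleration L q t - acceleration L r s = of_coords ?A c (q t) ?x - of_coords ?A c (q t) ?y"
    unfolding acceleration_chart[OF q(1,2,4) cA c(2)] acceleration_chart[OF r(1,2,4) cA r']
    by (simp add: cov_deriv_in_def eq)
  also have "\<dots> = of_coords ?A c (q t) (?x - ?y)"
    by (rule linear_diff[OF of_coords_linear[OF cA c(2)], symmetric])
  also have "\<dots> \<in> TC (q t)"
    unfolding tangent_space_slice_chart[OF c(1) p c(2)]
    by (intro imageI subspace_diff[OF S] slice_chart_second_derivative[OF c(1) q c(2)]
        slice_chart_second_derivative[OF c(1) r r'])
  finally show ?thesis .
qed

text \<open>The control forces lie in the acceleration distribution, which is the kernel of the projection.\<close>

lemma base_integral_curve_constrained:
  assumes q: "base_integral_curve L \<tau> I q" "q ` I \<subseteq> C"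
  shows "constrained_integral_curve L C I q"
  unfolding constrained_integral_curve_def
proof (intro conjI ballI q(2))
  show I: "open_interval I" and s: "smooth_curve (atlas L) I q" using q by (simp_all add: base_integral_curve_def)
  fix t assume t: "t \<in> I"
  have p: "q t \<in> C" using t q(2) by blast
  let ?F = "\<Sum>i<num_forces L. \<tau> i (q t) (velocity (atlas L) q t) *\<^sub>R sharp L (q t) (force L i (q t))"
  have a: "acceleration L q t = - grad_potential L (q t) + ?F"
    using q(1) t by (simp add: base_integral_curve_def)
  have F: "?F \<in> DA (q t)"
    unfolding acceleration_distribution_def
    by (intro subspace_sum subspace_span subspace_scale[OF subspace_span] span_base imageI) simp
  have "proj L C (q t) (acceleration L q t) = - proj L C (q t) (grad_potential L (q t))"
  proof (rule proj_eq[OF p])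
    show "- proj L C (q t) (grad_potential L (q t)) \<in> TC (q t)"
      by (rule subspace_neg[OF subspace_tangent[OF p] proj_tangent[OF p]])
    have "?F - (grad_potential L (q t) - proj L C (q t) (grad_potential L (q t))) \<in> DA (q t)"
      by (rule subspace_diff[OF subspace_DA F proj_diff[OF p]])
    then show "acceleration L q t - - proj L C (q t) (grad_potential L (q t)) \<in> DA (q t)"
      by (simp add: a algebra_simps)
  qed
  moreover have "open I" using I by (simp add: open_interval_def)
  ultimately show "constrained_acceleration L C q t = - proj L C (q t) (grad_potential L (q t))"
    using constrained_acceleration_eq_proj[OF s _ q(2) t] by simp
qed

section \<open>Constrained and controlled motion\<close>

lemma renders_invariantD:
  assumes "renders_invariant L C \<tau>" "smooth_extension L C \<tau> \<tau>'" "maximal_base_integral_curve L \<tau>' I q"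
    and "0 \<in> I" "q 0 \<in> C" "velocity (atlas L) q 0 \<in> TC (q 0)" "t \<in> I"
  shows "q t \<in> C"
  by (rule assms(1)[unfolded renders_invariant_def, rule_format, OF assms(2,5,6) _ assms(7)])
     (simp add: assms)

text \<open>At a fixed time, compare the given curve with a solution \<open>r\<close> of the controlled system that has the
  same position and velocity. Invariance keeps \<open>r\<close> in \<open>C\<close>, so \<open>r\<close> solves the constrained equation as
  well, and the two accelerations have the same projection. Their difference lies in the acceleration
  distribution and in the tangent space of \<open>C\<close>, hence is zero.\<close>

lemma constrained_integral_curve_base:
  assumes ext: "smooth_extension L C \<tau> \<tau>'" and inv: "renders_invariant L C \<tau>"
    and q: "constrained_integral_curve L C I q"
  shows "base_integral_curve L \<tau>' I q"
  unfolding base_integral_curve_def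
proof (intro conjI ballI)
  let ?A = "atlas L"
  show I: "open_interval I" and s: "smooth_curve ?A I q" using q by (simp_all add: constrained_integral_curve_def)
  have qC: "q ` I \<subseteq> C" using q by (simp add: constrained_integral_curve_def)
  have oI: "open I" using I by (simp add: open_interval_def)
  fix t assume t: "t \<in> I"
  have p: "q t \<in> C" using qC t by blast
  have v: "velocity ?A q t \<in> TC (q t)" by (rule curve_velocity_tangent[OF s oI qC t])
  have "smooth_feedback L \<tau>'" using ext by (simp add: smooth_extension_def)
  from base_integral_curve_exists[OF this, of "q t" "velocity ?A q t"]
  obtain K r0 where K: "base_integral_curve L \<tau>' K r0" "0 \<in> K" "r0 0 = q t"
    "velocity ?A r0 0 = velocity ?A q t" by (elim exE conjE)
  obtain J r where J: "K \<subseteq> J" "maximal_base_integral_curve L \<tau>' J r" "\<forall>t\<in>K. r t = r0 t"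
    using maximal_extension[OF K(1)] by (elim exE conjE)
  have oK: "open K" using K(1) by (simp add: base_integral_curve_def open_interval_def)
  have r0: "0 \<in> J" "r 0 = q t" using K(2,3) J(1) bspec[OF J(3) K(2)] by auto
  have rv: "velocity ?A r 0 = velocity ?A q t"
    unfolding K(4)[symmetric] by (rule velocity_local[OF oK K(2)]) (use J in simp)
  have rC: "r ` J \<subseteq> C"
    by (rule image_subsetI, rule renders_invariantD[OF inv ext J(2) r0(1)]) (simp_all only: r0 rv p v)
  have rb: "base_integral_curve L \<tau>' J r" using J(2) by (simp add: maximal_base_integral_curve_def)
  have rs: "smooth_curve ?A J r" and oJ: "open J"
    using rb by (simp_all add: base_integral_curve_def open_interval_def)
  have rc: "constrained_integral_curve L C J r" by (rule base_integral_curve_constrained[OF rb rC])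
  let ?a = "acceleration L q t" and ?b = "acceleration L r 0"
  have "proj L C (q t) ?a = - proj L C (q t) (grad_potential L (q t))"
    using q t constrained_acceleration_eq_proj[OF s oI qC t] by (simp add: constrained_integral_curve_def)
  moreover have "proj L C (q t) ?b = - proj L C (q t) (grad_potential L (q t))"
    using rc r0 constrained_acceleration_eq_proj[OF rs oJ rC r0(1)] by (simp add: constrained_integral_curve_def)
  ultimately have pe: "proj L C (q t) ?a = proj L C (q t) ?b" by simp
  have "(?a - proj L C (q t) ?a) - (?b - proj L C (q t) ?b) \<in> DA (q t)"
    by (rule subspace_diff[OF subspace_DA proj_diff[OF p] proj_diff[OF p]])
  then have "?a - ?b \<in> DA (q t)" by (simp add: pe)
  moreover have "?a - ?b \<in> TC (q t)"
    by (rule acceleration_difference_tangent[OF s oI qC t rs oJ rC r0(1) r0(2)[symmetric] rv[symmetric]])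
  moreover have "TC (q t) \<inter> DA (q t) = {0}" using vhc p by (simp add: regular_vhc_def)
  ultimately have "?a - ?b = 0" by blast
  then have "?a = ?b" by simp
  moreover have "?b = - grad_potential L (r 0) +
     (\<Sum>i<num_forces L. \<tau>' i (r 0) (velocity ?A r 0) *\<^sub>R sharp L (r 0) (force L i (r 0)))"
    using rb r0(1) by (simp add: base_integral_curve_def)
  ultimately show "?a = - grad_potential L (q t) +
     (\<Sum>i<num_forces L. \<tau>' i (q t) (velocity ?A q t) *\<^sub>R sharp L (q t) (force L i (q t)))"
    by (simp only: r0(2) rv)
qed

text \<open>The curve passes through \<open>C\<close> at a time \<open>t\<close> with a tangent velocity. Translating \<open>t\<close> to zero makes
  the invariance applicable.\<close>

lemma maximal_base_integral_curve_stays: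
  assumes ext: "smooth_extension L C \<tau> \<tau>'" and inv: "renders_invariant L C \<tau>"
    and q: "maximal_base_integral_curve L \<tau>' J q"
    and I: "open I" "I \<subseteq> J" "t \<in> I" "q ` I \<subseteq> C"
  shows "q ` J \<subseteq> C"
proof -
  let ?A = "atlas L"
  have sJ: "smooth_curve ?A J q" using q by (simp add: maximal_base_integral_curve_def base_integral_curve_def)
  have sI: "smooth_curve ?A I q"
  proof (rule smooth_curve_local)
    fix s assume "s \<in> I"
    moreover have "open J" using q by (simp add: maximal_base_integral_curve_def base_integral_curve_def open_interval_def)
    ultimately show "\<exists>J q'. open J \<and> s \<in> J \<and> smooth_curve ?A J q' \<and> (\<forall>s\<in>J. q' s = q s)"
      using sJ subsetD[OF I(2)] by (intro exI[of _ J] exI[of _ q] conjI ballI refl)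
  qed
  have p: "q t \<in> C" using I by blast
  have v: "velocity ?A q t \<in> TC (q t)" by (rule curve_velocity_tangent[OF sI I(1,4,3)])
  let ?J = "{s. s + t \<in> J}" and ?q = "\<lambda>s. q (s + t)"
  have m: "maximal_base_integral_curve L \<tau>' ?J ?q" by (rule maximal_base_integral_curve_translate[OF q])
  have v': "velocity ?A ?q 0 = velocity ?A q t" using velocity_translate[of ?A q t 0] by simp
  have *: "q (s + t) \<in> C" if "s \<in> ?J" for s
    by (rule renders_invariantD[OF inv ext m _ _ _ that]) (use p v v' I(2,3) in auto)
  show ?thesis
  proof (rule image_subsetI)
    fix s assume "s \<in> J"
    then show "q s \<in> C" using *[of "s - t"] by simp
  qed
qed

text \<open>For the maximality statements, an extension of either kind is turned into an extension of the other
  kind. In the second part the extension leaves the interval where the curve is known to lie in \<open>C\<close>; it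
  is first enlarged to a maximal curve, so that invariance confines it to \<open>C\<close>.\<close>

theorem constrained_dynamics:
  assumes ext: "smooth_extension L C \<tau> \<tau>'" and inv: "renders_invariant L C \<tau>"
  shows "maximal_base_integral_curve L \<tau>' I q \<Longrightarrow> q ` I \<subseteq> C \<Longrightarrow> maximal_constrained_integral_curve L C I q"
    and "maximal_constrained_integral_curve L C I q \<Longrightarrow> maximal_base_integral_curve L \<tau>' I q"
proof -
  assume q: "maximal_base_integral_curve L \<tau>' I q" "q ` I \<subseteq> C"
  show "maximal_constrained_integral_curve L C I q"
    unfolding maximal_constrained_integral_curve_def
  proof (intro conjI notI)
    show "constrained_integral_curve L C I q"
      by (rule base_integral_curve_constrained[OF _ q(2), of \<tau>']) (use q(1) in \<open>simp add: maximal_base_integral_curve_def\<close>)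
    assume "\<exists>J q'. I \<subset> J \<and> constrained_integral_curve L C J q' \<and> (\<forall>t\<in>I. q' t = q t)"
    then obtain J q' where J: "I \<subset> J" "constrained_integral_curve L C J q'" "\<forall>t\<in>I. q' t = q t"
      by (elim exE conjE)
    have "\<exists>J q'. I \<subset> J \<and> base_integral_curve L \<tau>' J q' \<and> (\<forall>t\<in>I. q' t = q t)"
      using J(1) constrained_integral_curve_base[OF ext inv J(2)] J(3)
      by (intro exI[of _ J] exI[of _ q'] conjI)
    moreover have "\<not> (\<exists>J q'. I \<subset> J \<and> base_integral_curve L \<tau>' J q' \<and> (\<forall>t\<in>I. q' t = q t))"
      using q(1) unfolding maximal_base_integral_curve_def by (rule conjunct2)
    ultimately show False by contradiction
  qed
next
  assume q: "maximal_constrained_integral_curve L C I q"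
  then have qc: "constrained_integral_curve L C I q" by (simp add: maximal_constrained_integral_curve_def)
  then have I: "open I" "I \<noteq> {}" and qC: "q ` I \<subseteq> C"
    by (simp_all add: constrained_integral_curve_def open_interval_def)
  show "maximal_base_integral_curve L \<tau>' I q"
    unfolding maximal_base_integral_curve_def
  proof (intro conjI notI)
    show "base_integral_curve L \<tau>' I q" by (rule constrained_integral_curve_base[OF ext inv qc])
    assume "\<exists>J q'. I \<subset> J \<and> base_integral_curve L \<tau>' J q' \<and> (\<forall>t\<in>I. q' t = q t)"
    then obtain J q' where J: "I \<subset> J" "base_integral_curve L \<tau>' J q'" "\<forall>t\<in>I. q' t = q t"
      by (elim exE conjE)
    obtain K r where K: "J \<subseteq> K" "maximal_base_integral_curve L \<tau>' K r" "\<forall>t\<in>J. r t = q' t"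
      using maximal_extension[OF J(2)] by (elim exE conjE)
    have IK: "I \<subset> K" using J(1) K(1) by blast
    have rq: "r t = q t" if "t \<in> I" for t
    proof -
      have "t \<in> J" using J(1) that by blast
      then show ?thesis using bspec[OF K(3)] bspec[OF J(3) that] by simp
    qed
    obtain t where t: "t \<in> I" using I(2) by blast
    have "r ` I \<subseteq> C" using qC rq by auto
    then have "r ` K \<subseteq> C"
      by (rule maximal_base_integral_curve_stays[OF ext inv K(2) I(1) psubset_imp_subset[OF IK] t])
    then have "constrained_integral_curve L C K r"
      by (rule base_integral_curve_constrained[where \<tau> = \<tau>', rotated]) (use K(2) in \<open>simp add: maximal_base_integral_curve_def\<close>)
    then have "\<exists>J q'. I \<subset> J \<and> constrained_integral_curve L C J q' \<and> (\<forall>t\<in>I. q' t = q t)"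
      using IK rq by (intro exI[of _ K] exI[of _ r] conjI ballI)
    moreover have "\<not> (\<exists>J q'. I \<subset> J \<and> constrained_integral_curve L C J q' \<and> (\<forall>t\<in>I. q' t = q t))"
      using q unfolding maximal_constrained_integral_curve_def by (rule conjunct2)
    ultimately show False by contradiction
  qed
qed

end

theorem theorem4p4:
  fixes L :: "('q::{t2_space,second_countable_topology}, 'e::euclidean_space) control_system"
    and C :: "'q set"
    and \<tau> \<tau>' :: "nat \<Rightarrow> 'q \<Rightarrow> 'e \<Rightarrow> real"
  assumes "lagrangian_control_system L"
    and "regular_vhc L C"
    and "smooth_feedback_on L C \<tau>"
    and "renders_invariant L C \<tau>"
    and "smooth_extension L C \<tau> \<tau>'"
  shows "(\<forall>I q. maximal_base_integral_curve L \<tau>' I q \<and> q ` I \<subseteq> C \<longrightarrow>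
            maximal_constrained_integral_curve L C I q) \<and>
         (\<forall>I q. maximal_constrained_integral_curve L C I q \<longrightarrow>
            maximal_base_integral_curve L \<tau>' I q)"
proof -
  interpret constrained_system L C
    by unfold_locales (fact assms(1), fact assms(2))
  show ?thesis
    using constrained_dynamics[OF assms(5,4)] by blast
qed

end
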